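(* Let $c>0$, $n=\lfloor cN^2\rfloor$, and let $\rho_N$ be the probability measure on $\mathbb{GT}_N$ whose Schur generating function is $\frac{(x_1+\dots+x_N)^n}{N^n}$ (the decomposition measure of the representation of $U(N)$ on $(\mathbb C^N)^{\otimes n}$). Let $p_k^{(N)}=\sum_{i=1}^N(\lambda_i+N-i)^k$ with $\lambda\sim\rho_N$. Then $\{N^{-k}(p_k^{(N)}-\mathbf Ep_k^{(N)})\}_{k\ge1}$ converges in the sense of moments to a centered Gaussian vector with covariance $$\lim_{N\to\infty}\frac{\mathrm{cov}(p_{k_1}^{(N)},p_{k_2}^{(N)})}{N^{k_1+k_2}}=\frac1{(2\pi\mathbf i)^2}\oint_{|z|=\epsilon}\oint_{|w|=2\epsilon}\Big(\frac1z+1+c+cz\Big)^{k_1}\Big(\frac1w+1+c+cw\Big)^{k_2}\Big(-c+\frac1{(z-w)^2}\Big)dz\,dw,$$ counter-clockwise contours, $\epsilon>0$ small.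
   Context: Signatures $\lambda=(\lambda_1\ge\dots\ge\lambda_N)\in\mathbb Z^N$ form $\mathbb{GT}_N$; the Schur generating function of a probability measure $\rho$ on $\mathbb{GT}_N$ is $\sum_\lambda\rho(\lambda)s_\lambda(x_1,\dots,x_N)/s_\lambda(1^N)$, with $s_\lambda$ the Schur function. *)

theory Defs
  imports "HOL-Probability.Probability"
begin

text \<open>A signature of length N is a weakly decreasing integer list of length N;
  entry l ! i (0-based) is lambda_(i+1).\<close>
definition GT :: "nat \<Rightarrow> int list set" where
  "GT N = {l. length l = N \<and> sorted_wrt (\<ge>) l}"

text \<open>Shape of the partition lambda - lambda_N (all parts shifted to be nonnegative).\<close>
definition cells :: "nat \<Rightarrow> int list \<Rightarrow> (nat \<times> nat) set" where
  "cells N l = {(i, j). i < N \<and> int j < l ! i - l ! (N - 1)}"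

text \<open>Semistandard Young tableaux of that shape with entries in {0..<N}
  (entry a stands for the variable x_(a+1)).\<close>
definition SSYT :: "nat \<Rightarrow> int list \<Rightarrow> ((nat \<times> nat) \<Rightarrow> nat) set" where
  "SSYT N l = {T. T \<in> cells N l \<rightarrow>\<^sub>E {0..<N} \<and>
     (\<forall>i j. (i, j) \<in> cells N l \<and> (i, Suc j) \<in> cells N l \<longrightarrow> T (i, j) \<le> T (i, Suc j)) \<and>
     (\<forall>i j. (i, j) \<in> cells N l \<and> (Suc i, j) \<in> cells N l \<longrightarrow> T (i, j) < T (Suc i, j))}"

text \<open>s_lambda(x_1..x_N) = (x_1...x_N)^(lambda_N) * s_(lambda - lambda_N)(x), the latter
  given by the tableau formula.\<close>
definition schur :: "nat \<Rightarrow> int list \<Rightarrow> (nat \<Rightarrow> real) \<Rightarrow> real" where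
  "schur N l x = (\<Prod>i<N. x i) powi (l ! (N - 1)) *
     (\<Sum>T\<in>SSYT N l. \<Prod>c\<in>cells N l. x (T c))"

definition has_SGF :: "nat \<Rightarrow> int list pmf \<Rightarrow> ((nat \<Rightarrow> real) \<Rightarrow> real) \<Rightarrow> bool" where
  "has_SGF N \<rho> S \<longleftrightarrow> set_pmf \<rho> \<subseteq> GT N \<and>
     (\<forall>x. (\<forall>i<N. x i > 0) \<longrightarrow>
        ((\<lambda>l. pmf \<rho> l * schur N l x / schur N l (\<lambda>_. 1)) has_sum S x) (GT N))"

definition tensor_measure :: "nat \<Rightarrow> nat \<Rightarrow> int list pmf" where
  "tensor_measure N n =
     (THE \<rho>. has_SGF N \<rho> (\<lambda>x. (\<Sum>i<N. x i) ^ n / real N ^ n))"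

definition pk :: "nat \<Rightarrow> nat \<Rightarrow> int list \<Rightarrow> real" where
  "pk N k l = (\<Sum>i<N. real_of_int (l ! i + int N - int (Suc i)) ^ k)"

definition centered_moment :: "real \<Rightarrow> nat \<Rightarrow> nat list \<Rightarrow> real" where
  "centered_moment c N ks =
     (let \<rho> = tensor_measure N (nat \<lfloor>c * real N ^ 2\<rfloor>) in
      measure_pmf.expectation \<rho>
        (\<lambda>l. \<Prod>k\<leftarrow>ks. (pk N k l - measure_pmf.expectation \<rho> (pk N k)) / real N ^ k))"

text \<open>Sum over perfect matchings of the product of covariances: the joint moment
  E[prod X_k] of a centered Gaussian family with covariance C.\<close>
function wick :: "('a \<Rightarrow> 'a \<Rightarrow> complex) \<Rightarrow> 'a list \<Rightarrow> complex" where
  "wick C [] = 1"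
| "wick C (k # ks) =
     (\<Sum>j<length ks. C k (ks ! j) * wick C (take j ks @ drop (Suc j) ks))"
  by pat_completeness auto
termination
  by (relation "Wellfounded.measure (\<lambda>(C, ks). length ks)") auto

definition circle_integral :: "real \<Rightarrow> (complex \<Rightarrow> complex) \<Rightarrow> complex" where
  "circle_integral r f =
     integral {0..2 * pi} (\<lambda>t. f (of_real r * exp (\<i> * of_real t)) * (\<i> * of_real r * exp (\<i> * of_real t)))"

definition limit_cov :: "real \<Rightarrow> real \<Rightarrow> nat \<Rightarrow> nat \<Rightarrow> complex" where
  "limit_cov c \<epsilon> k1 k2 =
     1 / (2 * of_real pi * \<i>)^2 *
     circle_integral (2 * \<epsilon>) (\<lambda>w. circle_integral \<epsilon> (\<lambda>z.
        (1 / z + 1 + of_real c + of_real c * z) ^ k1 *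
        (1 / w + 1 + of_real c + of_real c * w) ^ k2 *
        (- of_real c + 1 / (z - w)^2)))"

end

theory Submission
  imports Defs
    "HOL-Complex_Analysis.Complex_Analysis"
    "HOL-Computational_Algebra.Computational_Algebra"
    "HOL-Combinatorics.Permutations"
begin

text \<open>
  Pieri's rule \<open>p\<^sub>1 s\<^sub>\<lambda> = \<Sum> s\<^sub>\<lambda>\<^sub>+\<^sub>e\<^sub>i\<close> shows that \<open>\<rho>\<^sub>N\<close> is the law at time \<open>n\<close> of a Markov chain on
  signatures adding one box at a time.  In the coordinates \<open>L\<^sub>i = \<lambda>\<^sub>i + N - i\<close> the \<open>i\<close>-th particle moves with
  probability \<open>N\<^sup>-\<^sup>1 \<Prod>\<^sub>j (L\<^sub>i + 1 - L\<^sub>j) / (L\<^sub>i - L\<^sub>j)\<close>, and the moments of the moving particle are polynomials in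
  the power sums \<open>p\<^sub>k\<close> given by a Newton recursion.  Hence the moments of the centred power sums satisfy
  difference equations in \<open>n\<close> which are triangular with respect to \<open>k\<^sub>1 + \<dots> + k\<^sub>r\<close>.  By induction on this
  weight they converge, in the macroscopic time \<open>c = n / N\<^sup>2\<close>, to the solution of a linear system whose
  solutions are Wick sums of a covariance with \<open>C' = A C + C A\<^sup>T + Q\<close> and \<open>C(0) = 0\<close>.  Lagrange inversion for
  \<open>f(u) = 1/u + 1 + c + c u\<close> shows that the double contour integral is this covariance.
\<close>

section \<open>The growth chain on signatures\<close>

text \<open>The measure is given only by a definite description through its Schur generating
  function, so existence and uniqueness precede any moment computation. The chain supplies
  existence, and its nested finite sums keep the moment calculus free of integrability questions.
  The scaling explains the shape of the limit: one step changes a normalised fluctuation by order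
  1/N and there are of order N^2 steps, so first-order terms naively add up to order N. They stay
  bounded because the step is centred: its conditional mean is, to leading order, 1/N times a linear
  combination of fluctuations, which gives the drift. Products of two steps give \<open>Q\<close>;
  products of three or more disappear. The obstacle is that every expansion in 1/N leaves remainders
  controlled only through moments. Since a step replaces a factor of weight k by one of weight k -
  1, the remainders met at weight W + 1 are tested only against moments of weight at most W.\<close>

definition pos :: "nat \<Rightarrow> int list \<Rightarrow> nat \<Rightarrow> real" where
  "pos N l i = real_of_int (l ! i + int N - int (Suc i))"

definition wgt :: "nat \<Rightarrow> int list \<Rightarrow> nat \<Rightarrow> real" where
  "wgt N l i = (\<Prod>j\<in>{..<N} - {i}. (pos N l i + 1 - pos N l j) / (pos N l i - pos N l j)) / real N"

definition add_box :: "int list \<Rightarrow> nat \<Rightarrow> int list" where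
  "add_box l i = l[i := l ! i + 1]"

text \<open>\<open>EE N n F\<close> is the expectation of \<open>F\<close> after \<open>n\<close> steps of the chain started from the empty diagram.\<close>

primrec EE :: "nat \<Rightarrow> nat \<Rightarrow> (int list \<Rightarrow> real) \<Rightarrow> real" where
  "EE N 0 F = F (replicate N 0)"
| "EE N (Suc n) F = EE N n (\<lambda>l. \<Sum>i<N. wgt N l i * F (add_box l i))"

lemma pk_pos: "pk N k l = (\<Sum>i<N. pos N l i ^ k)"
  by (simp add: pk_def pos_def)

lemma pos_mono:
  assumes "l \<in> GT N" "i < j" "j < N"
  shows "pos N l j + 1 \<le> pos N l i"
proof -
  have "l ! j \<le> l ! i"
    using assms sorted_wrt_nth_less[of "(\<ge>)" l i j] by (auto simp: GT_def)
  then have "l ! j + int N - int (Suc j) + 1 \<le> l ! i + int N - int (Suc i)" using assms by linarith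
  then show ?thesis unfolding pos_def
    by (metis of_int_1 of_int_add of_int_le_iff)
qed

lemma pos_inj: "l \<in> GT N \<Longrightarrow> inj_on (pos N l) {..<N}"
  by (rule inj_onI) (metis add_le_same_cancel1 lessThan_iff linorder_neqE_nat not_one_le_zero pos_mono)

text \<open>Particles are at distance at least one, so moving particle i by one step cannot reverse
  the sign of a difference; no factor of the product is negative.\<close>

lemma wgt_nonneg:
  assumes "l \<in> GT N" "i < N"
  shows "wgt N l i \<ge> 0"
proof -
  have "(pos N l i + 1 - pos N l j) / (pos N l i - pos N l j) \<ge> 0" if "j \<in> {..<N} - {i}" for j
  proof (cases "i < j")
    case True
    then have "pos N l j + 1 \<le> pos N l i" using pos_mono assms that by auto
    then show ?thesis by simp
  next
    case False
    then have "pos N l i + 1 \<le> pos N l j" using pos_mono[of l N j i] assms that by auto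
    then show ?thesis by (simp add: divide_nonpos_nonpos)
  qed
  then have "0 \<le> (\<Prod>j\<in>{..<N} - {i}. (pos N l i + 1 - pos N l j) / (pos N l i - pos N l j))"
    by (rule prod_nonneg)
  then show ?thesis unfolding wgt_def by simp
qed

text \<open>If the row above has the same length, particle i - 1 sits exactly one unit ahead and its
  factor in the weight is zero.\<close>

lemma add_box_GT:
  assumes "l \<in> GT N" "i < N" "wgt N l i \<noteq> 0"
  shows "add_box l i \<in> GT N"
proof -
  have len: "length l = N" and sl: "\<And>a b. a < b \<Longrightarrow> b < N \<Longrightarrow> l ! b \<le> l ! a"
    using assms by (auto simp: GT_def sorted_wrt_iff_nth_less)
  have "l ! i + 1 \<le> l ! a" if a: "a < i" for a
  proof -
    have "l ! i \<noteq> l ! (i - 1)"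
    proof
      assume e: "l ! i = l ! (i - 1)"
      have "pos N l i + 1 - pos N l (i - 1) = 0"
        using e a unfolding pos_def by (simp add: of_nat_diff)
      then have "wgt N l i = 0"
        unfolding wgt_def using a assms(2) by (intro divide_eq_0_iff[THEN iffD2] disjI1 prod_zero)
          (auto intro!: bexI[of _ "i - 1"])
      with assms(3) show False by simp
    qed
    moreover have "l ! i \<le> l ! (i - 1)" using sl[of "i - 1" i] a assms(2) by simp
    moreover have "l ! (i - 1) \<le> l ! a" using sl[of a "i - 1"] a assms(2) by (cases "a = i - 1") auto
    ultimately show ?thesis by simp
  qed
  moreover have "l ! b \<le> l ! i + 1" if "i < b" "b < N" for b using sl[of i b] that by simp
  ultimately have "add_box l i ! b \<le> add_box l i ! a" if "a < b" "b < N" for a b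
    using sl[OF that] that len assms(2) unfolding add_box_def
    by (cases "a = i"; cases "b = i") (simp_all add: nth_list_update)
  then show ?thesis
    using len unfolding GT_def sorted_wrt_iff_nth_less by (simp add: add_box_def)
qed

lemma GT_replicate: "replicate N 0 \<in> GT N"
  by (simp add: GT_def sorted_wrt_iff_nth_less)

text \<open>Transitions out of \<open>I\<close> carry weight zero, so values off \<open>I\<close>
  never enter. The test functions stay arbitrary in the induction because the recursion for
  \<open>EE\<close> replaces \<open>F\<close> by its one-step average.\<close>

lemma EE_cong_invariant:
  assumes "replicate N 0 \<in> I" "\<And>l i. l \<in> I \<Longrightarrow> i < N \<Longrightarrow> wgt N l i \<noteq> 0 \<Longrightarrow> add_box l i \<in> I"
    and "\<And>l. l \<in> I \<Longrightarrow> F l = G l"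
  shows "EE N n F = EE N n G"
  using assms(3)
proof (induction n arbitrary: F G)
  case 0
  then show ?case using assms(1) by simp
next
  case (Suc n)
  show ?case unfolding EE.simps
  proof (rule Suc.IH)
    fix l assume l: "l \<in> I"
    show "(\<Sum>i<N. wgt N l i * F (add_box l i)) = (\<Sum>i<N. wgt N l i * G (add_box l i))"
    proof (rule sum.cong)
      fix i assume "i \<in> {..<N}"
      then show "wgt N l i * F (add_box l i) = wgt N l i * G (add_box l i)"
        using assms(2)[OF l, of i] Suc.prems by (cases "wgt N l i = 0") auto
    qed simp
  qed
qed

lemma EE_cong: "(\<And>l. l \<in> GT N \<Longrightarrow> F l = G l) \<Longrightarrow> EE N n F = EE N n G"
  by (rule EE_cong_invariant[where I = "GT N"]) (rule GT_replicate, rule add_box_GT)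

lemma EE_add: "EE N n (\<lambda>l. F l + G l) = EE N n F + EE N n G"
  by (induction n arbitrary: F G) (simp_all add: distrib_left sum.distrib)

lemma EE_cmult: "EE N n (\<lambda>l. c * F l) = c * EE N n F"
proof (induction n arbitrary: F)
  case (Suc n)
  have "(\<lambda>l. \<Sum>i<N. wgt N l i * (c * F (add_box l i))) = (\<lambda>l. c * (\<Sum>i<N. wgt N l i * F (add_box l i)))"
    by (simp add: sum_distrib_left mult_ac)
  then show ?case using Suc by simp
qed simp

lemma EE_0: "EE N n (\<lambda>l. 0) = 0"
  using EE_cmult[of N n 0 "\<lambda>_. 0"] by simp

lemma EE_sum: "EE N n (\<lambda>l. \<Sum>a\<in>A. F a l) = (\<Sum>a\<in>A. EE N n (F a))"
  by (induction A rule: infinite_finite_induct) (simp_all add: EE_0 EE_add)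

lemma EE_diff: "EE N n (\<lambda>l. F l - G l) = EE N n F - EE N n G"
  using EE_add[of N n F "\<lambda>l. - 1 * G l"] EE_cmult[of N n "-1" G] by simp

section \<open>The law of the moving particle\<close>

text \<open>Partial fractions for prod (z + 1 - L_j) / (z - L_j), cleared of denominators. Both
  products are monic of degree n, so their difference has degree below n and is determined by its
  values at the n nodes L_i, where only the i-th summand survives.\<close>

lemma lagrange_shift_identity:
  fixes L :: "'i \<Rightarrow> real"
  assumes "finite I" "inj_on L I"
  shows "(\<Prod>j\<in>I. [:1 - L j, 1:]) = (\<Prod>j\<in>I. [:- L j, 1:]) +
    (\<Sum>i\<in>I. smult (\<Prod>j\<in>I - {i}. (L i + 1 - L j) / (L i - L j)) (\<Prod>j\<in>I - {i}. [:- L j, 1:]))"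
    (is "?p = ?q + ?s")
proof (cases "I = {}")
  case False
  define n where "n = card I"
  have n: "n > 0" using False assms by (simp add: n_def card_gt_0_iff)
  have deg: "degree (\<Prod>j\<in>J. [:a j, 1:]) = card J" for J :: "'i set" and a :: "'i \<Rightarrow> real"
    by (subst degree_prod_eq_sum_degree) auto
  have lead: "coeff (\<Prod>j\<in>J. [:a j, 1:]) (card J) = 1" for J :: "'i set" and a :: "'i \<Rightarrow> real"
    using lead_coeff_prod[of "\<lambda>j. [:a j, 1:]" J] by (simp add: deg)
  have d1: "degree (?p - ?q) < card (L ` I)"
  proof -
    have "degree (?p - ?q) \<le> n" by (rule degree_diff_le) (simp_all add: deg n_def)
    moreover have "coeff (?p - ?q) n = 0" by (simp add: n_def lead)
    ultimately have "degree (?p - ?q) < n"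
      using n by (metis degree_0 leading_coeff_0_iff order_le_less)
    then show ?thesis using assms by (simp add: n_def card_image)
  qed
  have d2: "degree ?s < card (L ` I)"
  proof -
    have "degree ?s \<le> n - 1"
    proof (rule degree_sum_le[OF assms(1)])
      fix i assume "i \<in> I"
      then show "degree (smult (\<Prod>j\<in>I - {i}. (L i + 1 - L j) / (L i - L j)) (\<Prod>j\<in>I - {i}. [:- L j, 1:])) \<le> n - 1"
        using degree_smult_le[of _ "\<Prod>j\<in>I - {i}. [:- L j, 1:]"] by (simp add: deg n_def assms)
    qed
    then show ?thesis using assms n by (simp add: n_def card_image)
  qed
  have "?p - ?q = ?s"
  proof (rule poly_eqI_degree[OF _ d1 d2])
    fix z assume "z \<in> L ` I"
    then obtain i where i: "i \<in> I" "z = L i" by auto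
    have q0: "poly ?q z = 0" using i assms(1) by (auto simp: poly_prod)
    have s0: "poly (\<Prod>j\<in>I - {k}. [:- L j, 1:]) z = 0" if "k \<in> I" "k \<noteq> i" for k
      using i that assms(1) by (auto simp: poly_prod)
    have "poly ?s z = (\<Prod>j\<in>I - {i}. (L i + 1 - L j) / (L i - L j)) * (\<Prod>j\<in>I - {i}. L i - L j)"
      unfolding poly_sum using i s0 assms(1)
      by (subst sum.remove[of _ i]) (auto simp: poly_prod intro!: sum.neutral)
    also have "\<dots> = (\<Prod>j\<in>I - {i}. L i + 1 - L j)"
      unfolding prod.distrib[symmetric] using assms(2) i
      by (intro prod.cong) (auto simp: inj_on_def)
    also have "\<dots> = poly ?p z"
      using i assms(1) by (subst prod.remove[of _ i]) (auto simp: poly_prod algebra_simps)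
    finally show "poly (?p - ?q) z = poly ?s z" using q0 by simp
  qed
  then show ?thesis by (simp add: algebra_simps)
qed simp

text \<open>Substituting z = 1/h and multiplying by h^n reverses the coefficients, which makes the
  factors invertible as power series. The products over \<open>I - {i}\<close> absorb only n - 1 of
  these powers, hence the factor \<open>[:0, 1:]\<close>.\<close>

lemma lagrange_shift_identity_reversed:
  fixes L :: "'i \<Rightarrow> real"
  assumes "finite I" "inj_on L I"
  shows "(\<Prod>j\<in>I. [:1, 1 - L j:]) = (\<Prod>j\<in>I. [:1, - L j:]) +
    [:0, 1:] * (\<Sum>i\<in>I. smult (\<Prod>j\<in>I - {i}. (L i + 1 - L j) / (L i - L j)) (\<Prod>j\<in>I - {i}. [:1, - L j:]))"
    (is "?p = ?q + [:0,1:] * ?s")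
proof -
  have "poly (?p - (?q + [:0,1:] * ?s)) h = 0" if h: "h \<noteq> 0" for h
  proof -
    let ?c = "\<lambda>i. (\<Prod>j\<in>I - {i}. (L i + 1 - L j) / (L i - L j))"
    have e: "h ^ card J * (\<Prod>j\<in>J. a j + 1 / h) = (\<Prod>j\<in>J. 1 + h * a j)" for J and a :: "'i \<Rightarrow> real"
    proof -
      have "h ^ card J * (\<Prod>j\<in>J. a j + 1 / h) = (\<Prod>j\<in>J. h * (a j + 1 / h))"
        by (simp add: prod.distrib)
      also have "\<dots> = (\<Prod>j\<in>J. 1 + h * a j)" using h by (intro prod.cong) (simp_all add: field_simps)
      finally show ?thesis .
    qed
    have "poly (\<Prod>j\<in>I. [:1 - L j, 1:]) (1 / h) = poly ((\<Prod>j\<in>I. [:- L j, 1:]) +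
      (\<Sum>i\<in>I. smult (?c i) (\<Prod>j\<in>I - {i}. [:- L j, 1:]))) (1 / h)"
      using lagrange_shift_identity[OF assms] by simp
    then have "(\<Prod>j\<in>I. (1 - L j) + 1 / h) = (\<Prod>j\<in>I. - L j + 1 / h) + (\<Sum>i\<in>I. ?c i * (\<Prod>j\<in>I - {i}. - L j + 1 / h))"
      by (simp add: poly_prod poly_sum)
    then have "h ^ card I * (\<Prod>j\<in>I. (1 - L j) + 1 / h) = h ^ card I * (\<Prod>j\<in>I. - L j + 1 / h)
        + (\<Sum>i\<in>I. ?c i * (h ^ card I * (\<Prod>j\<in>I - {i}. - L j + 1 / h)))"
      by (simp add: distrib_left sum_distrib_left mult_ac)
    also have "(\<Sum>i\<in>I. ?c i * (h ^ card I * (\<Prod>j\<in>I - {i}. - L j + 1 / h))) =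
       (\<Sum>i\<in>I. ?c i * (h * (\<Prod>j\<in>I - {i}. 1 + h * - L j)))"
    proof (rule sum.cong)
      fix i assume "i \<in> I"
      then have "h ^ card I = h * h ^ card (I - {i})"
        using assms(1) by (metis card_Suc_Diff1 power_Suc)
      then show "?c i * (h ^ card I * (\<Prod>j\<in>I - {i}. - L j + 1 / h)) = ?c i * (h * (\<Prod>j\<in>I - {i}. 1 + h * - L j))"
        using e[of "I - {i}" "\<lambda>j. - L j"] by (simp add: mult.assoc)
    qed simp
    finally have "(\<Prod>j\<in>I. 1 + h * (1 - L j)) = (\<Prod>j\<in>I. 1 + h * - L j) + (\<Sum>i\<in>I. ?c i * (h * (\<Prod>j\<in>I - {i}. 1 + h * - L j)))"
      unfolding e .
    then show ?thesis
      by (simp add: poly_prod poly_sum sum_distrib_left mult_ac)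
  qed
  then have "UNIV - {0} \<subseteq> {h. poly (?p - (?q + [:0,1:] * ?s)) h = 0}" by auto
  then have "\<not> finite {h. poly (?p - (?q + [:0,1:] * ?s)) h = 0}"
    by (rule infinite_super) (simp add: infinite_UNIV_char_0)
  then have "?p - (?q + [:0,1:] * ?s) = 0" using poly_roots_finite by blast
  then show ?thesis by simp
qed

section \<open>Generating series for the moments of the moving particle\<close>

definition geo_fps :: "real \<Rightarrow> real fps" where "geo_fps a = Abs_fps (\<lambda>m. a ^ m)"

lemma geo_fps_inverse: "(1 - fps_const a * fps_X) * geo_fps a = 1"
proof (rule fps_ext)
  fix n show "((1 - fps_const a * fps_X) * geo_fps a) $ n = 1 $ n"
    by (cases n) (simp_all add: left_diff_distrib mult.assoc geo_fps_def)
qed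

lemma fps_of_poly_linear: "fps_of_poly [:1, b:] = 1 - fps_const (- b) * fps_X" for b :: real
  by (simp add: fps_of_poly_pCons fps_const_neg[symmetric] mult.commute del: fps_const_neg)

text \<open>The reversed identity divided by prod (1 - L_j X): each factor becomes (1 - (L_j - 1) X)
  / (1 - L_j X), and for m >= 1 the coefficient of X^m on the right is a weighted sum of
  L_i^(m-1).\<close>

lemma shifted_ratio_fps:
  fixes L :: "'i \<Rightarrow> real"
  assumes "finite I" "inj_on L I"
  shows "(\<Prod>j\<in>I. 1 + fps_X * geo_fps (L j)) = 1 + fps_X *
    (\<Sum>i\<in>I. fps_const (\<Prod>j\<in>I - {i}. (L i + 1 - L j) / (L i - L j)) * geo_fps (L i))"
proof -
  let ?c = "\<lambda>i. (\<Prod>j\<in>I - {i}. (L i + 1 - L j) / (L i - L j))"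
  have "fps_of_poly (\<Prod>j\<in>I. [:1, 1 - L j:]) = fps_of_poly ((\<Prod>j\<in>I. [:1, - L j:]) +
    [:0, 1:] * (\<Sum>i\<in>I. smult (?c i) (\<Prod>j\<in>I - {i}. [:1, - L j:])))"
    using lagrange_shift_identity_reversed[OF assms] by simp
  then have e: "(\<Prod>j\<in>I. 1 - fps_const (L j - 1) * fps_X) = (\<Prod>j\<in>I. 1 - fps_const (L j) * fps_X) +
    fps_X * (\<Sum>i\<in>I. fps_const (?c i) * (\<Prod>j\<in>I - {i}. 1 - fps_const (L j) * fps_X))"
    unfolding fps_of_poly_add fps_of_poly_mult fps_of_poly_sum fps_of_poly_prod fps_of_poly_smult
      fps_of_poly_linear
    by (simp add: fps_of_poly_pCons)
  have one: "(\<Prod>j\<in>J. 1 - fps_const (L j) * fps_X) * (\<Prod>j\<in>J. geo_fps (L j)) = 1" for J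
    unfolding prod.distrib[symmetric] by (simp add: geo_fps_inverse)
  have g: "1 + fps_X * geo_fps a = (1 - fps_const (a - 1) * fps_X) * geo_fps a" for a
  proof -
    have "(1 - fps_const (a - 1) * fps_X) = (1 - fps_const a * fps_X) + fps_X"
      by (simp add: fps_const_sub[symmetric] algebra_simps del: fps_const_sub)
    then show ?thesis by (simp only: distrib_right geo_fps_inverse)
  qed
  have "(\<Prod>j\<in>I. 1 + fps_X * geo_fps (L j)) = (\<Prod>j\<in>I. 1 - fps_const (L j - 1) * fps_X) * (\<Prod>j\<in>I. geo_fps (L j))"
    by (simp add: g prod.distrib)
  also have "\<dots> = 1 + fps_X * (\<Sum>i\<in>I. fps_const (?c i) * ((\<Prod>j\<in>I - {i}. 1 - fps_const (L j) * fps_X) * (\<Prod>j\<in>I. geo_fps (L j))))"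
    unfolding e distrib_right one by (simp add: sum_distrib_right mult.assoc)
  also have "(\<Sum>i\<in>I. fps_const (?c i) * ((\<Prod>j\<in>I - {i}. 1 - fps_const (L j) * fps_X) * (\<Prod>j\<in>I. geo_fps (L j)))) =
      (\<Sum>i\<in>I. fps_const (?c i) * geo_fps (L i))"
  proof (rule sum.cong)
    fix i assume "i \<in> I"
    then have "(\<Prod>j\<in>I. geo_fps (L j)) = (\<Prod>j\<in>I - {i}. geo_fps (L j)) * geo_fps (L i)"
      using assms(1) by (simp add: prod.remove mult.commute)
    then show "fps_const (?c i) * ((\<Prod>j\<in>I - {i}. 1 - fps_const (L j) * fps_X) * (\<Prod>j\<in>I. geo_fps (L j))) =
        fps_const (?c i) * geo_fps (L i)"
      using one[of "I - {i}"] by (simp only: mult.assoc[symmetric] mult_1_left)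
  qed simp
  finally show ?thesis .
qed

text \<open>The factor is (1 - (a - 1) X) / (1 - a X). X times its logarithmic derivative is
  \<open>geo_fps a - 1\<close> minus \<open>geo_fps (a - 1) - 1\<close>.\<close>

lemma geo_fps_log_deriv:
  "fps_X * fps_deriv (1 + fps_X * geo_fps a) = (1 + fps_X * geo_fps a) * (geo_fps a - geo_fps (a - 1))"
proof -
  let ?G = "geo_fps a" and ?H = "geo_fps (a - 1)" and ?u = "1 - fps_const a * fps_X"
  have u0: "?u \<noteq> 0" using geo_fps_inverse[of a] by auto
  have e0: "fps_deriv (?u * ?G) = 0" unfolding geo_fps_inverse by simp
  have "fps_deriv (?u * ?G) = ?u * fps_deriv ?G - fps_const a * ?G"
    by (simp add: fps_const_neg[symmetric] del: fps_const_neg)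
  then have d: "?u * fps_deriv ?G = fps_const a * ?G"
    using e0 by (metis right_minus_eq)
  have "?u * (?G + fps_X * fps_deriv ?G) = 1 + fps_X * (?u * fps_deriv ?G)"
    by (simp only: distrib_left geo_fps_inverse mult.left_commute)
  also have "\<dots> = 1 + fps_const a * fps_X * ?G" unfolding d by (simp only: mult_ac)
  also have "\<dots> = ?G" using geo_fps_inverse[of a] by (simp add: algebra_simps)
  also have "\<dots> = ?u * ?G * ?G" by (simp add: geo_fps_inverse)
  finally have "?u * (?G + fps_X * fps_deriv ?G) = ?u * (?G * ?G)" by (simp only: mult.assoc)
  then have 1: "?G + fps_X * fps_deriv ?G = ?G * ?G" using u0 by (metis mult_left_cancel)
  have "(1 - fps_const (a - 1) * fps_X) = ?u + fps_X"
    by (simp add: fps_const_sub[symmetric] algebra_simps del: fps_const_sub)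
  then have g: "1 + fps_X * ?G = (1 - fps_const (a - 1) * fps_X) * ?G"
    by (simp only: distrib_right geo_fps_inverse)
  have "(1 + fps_X * ?G) * ?H = ?G"
    unfolding g using geo_fps_inverse[of "a - 1"]
    by (metis (no_types, lifting) mult.assoc mult.commute mult_1_left)
  then have "(1 + fps_X * ?G) * (?G - ?H) = fps_X * (?G * ?G)"
    by (simp only: right_diff_distrib) (simp add: algebra_simps)
  also have "\<dots> = fps_X * fps_deriv (1 + fps_X * ?G)"
    by (simp add: 1[symmetric] algebra_simps)
  finally show ?thesis by simp
qed

lemma fps_log_deriv_prod:
  fixes g S :: "'i \<Rightarrow> real fps"
  assumes "finite I" "\<And>i. i \<in> I \<Longrightarrow> fps_X * fps_deriv (g i) = g i * S i"
  shows "fps_X * fps_deriv (\<Prod>i\<in>I. g i) = (\<Prod>i\<in>I. g i) * (\<Sum>i\<in>I. S i)"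
  using assms
proof (induction I)
  case (insert i I)
  have "fps_X * fps_deriv (\<Prod>i\<in>insert i I. g i) =
     g i * (fps_X * fps_deriv (\<Prod>i\<in>I. g i)) + (fps_X * fps_deriv (g i)) * (\<Prod>i\<in>I. g i)"
    using insert.hyps by (simp add: algebra_simps)
  also have "\<dots> = g i * ((\<Prod>i\<in>I. g i) * (\<Sum>i\<in>I. S i)) + (g i * S i) * (\<Prod>i\<in>I. g i)"
    using insert by simp
  finally show ?case using insert.hyps by (simp add: algebra_simps)
qed simp

definition shift_sum :: "nat \<Rightarrow> int list \<Rightarrow> nat \<Rightarrow> real" where
  "shift_sum N l a = (\<Sum>i<N. pos N l i ^ a - (pos N l i - 1) ^ a)"

text \<open>The coefficient of X^m in prod (1 + X / (1 - L_j X)), which is N times the moment of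
  order m - 1 of the position of the moving particle. The value 1 at m = 0 is the constant term that
  starts the Newton recursion.\<close>

definition shift_moment :: "nat \<Rightarrow> int list \<Rightarrow> nat \<Rightarrow> real" where
  "shift_moment N l m = (if m = 0 then 1 else real N * (\<Sum>i<N. wgt N l i * pos N l i ^ (m - 1)))"

lemma shift_moment_0: "shift_moment N l 0 = 1" by (simp add: shift_moment_def)

text \<open>Coefficients of X R' = R S, where R is the product over the particles. The constant
  coefficient of S is zero, so the recursion reaches back only to smaller indices.\<close>

lemma shift_moment_Newton:
  assumes "l \<in> GT N" "N \<ge> 1"
  shows "real m * shift_moment N l m = (\<Sum>a<m. shift_sum N l (Suc a) * shift_moment N l (m - Suc a))"
proof -
  let ?R = "\<Prod>j\<in>{..<N}. 1 + fps_X * geo_fps (pos N l j)"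
  let ?S = "\<Sum>j\<in>{..<N}. geo_fps (pos N l j) - geo_fps (pos N l j - 1)"
  have R: "?R $ m = shift_moment N l m" for m
  proof (cases m)
    case (Suc k)
    have N: "real N * wgt N l i = (\<Prod>j\<in>{..<N} - {i}. (pos N l i + 1 - pos N l j) / (pos N l i - pos N l j))" for i
      using assms(2) by (simp add: wgt_def)
    have shift: "(1 + fps_X * A) $ Suc k = A $ k" for A :: "real fps" by simp
    show ?thesis
      unfolding shifted_ratio_fps[OF finite_lessThan pos_inj[OF assms(1)]] Suc shift shift_moment_def
      by (simp add: fps_sum_nth geo_fps_def sum_distrib_left mult.assoc[symmetric] N)
  qed (simp add: shifted_ratio_fps[OF finite_lessThan pos_inj[OF assms(1)]] shift_moment_def)
  have S: "?S $ a = shift_sum N l a" for a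
    by (simp add: fps_sum_nth geo_fps_def shift_sum_def)
  have "fps_X * fps_deriv ?R = ?R * ?S"
    by (rule fps_log_deriv_prod) (simp, rule geo_fps_log_deriv)
  then have "(fps_X * fps_deriv ?R) $ m = (?S * ?R) $ m" by (simp add: mult.commute)
  also have "(fps_X * fps_deriv ?R) $ m = real m * shift_moment N l m"
    by (cases m) (simp_all add: R[symmetric])
  also have "(?S * ?R) $ m = (\<Sum>a=0..m. shift_sum N l a * shift_moment N l (m - a))"
    unfolding fps_mult_nth R S ..
  also have "\<dots> = (\<Sum>a\<in>{1..m}. shift_sum N l a * shift_moment N l (m - a))"
    by (rule sum.mono_neutral_right) (auto simp: shift_sum_def not_less_eq_eq)
  also have "\<dots> = (\<Sum>a<m. shift_sum N l (Suc a) * shift_moment N l (m - Suc a))"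
    by (rule sum.reindex_bij_witness[of _ Suc "\<lambda>a. a - 1"]) auto
  finally show ?thesis .
qed

text \<open>The top power cancels in x^(a+1) - (x - 1)^(a+1). This is why the drift of p_k involves
  only power sums of smaller order.\<close>

lemma shift_sum_pk: "shift_sum N l (Suc a) = (\<Sum>b\<le>a. real (Suc a choose b) * (- 1) ^ (a - b) * pk N b l)"
proof -
  have "x ^ Suc a - (x - 1) ^ Suc a = (\<Sum>b\<le>a. real (Suc a choose b) * (- 1) ^ (a - b) * x ^ b)" for x :: real
  proof -
    have "(x - 1) ^ Suc a = (\<Sum>b\<le>Suc a. real (Suc a choose b) * x ^ b * (- 1) ^ (Suc a - b))"
      using binomial_ring[of x "-1" "Suc a"] by simp
    also have "\<dots> = x ^ Suc a + (\<Sum>b\<le>a. real (Suc a choose b) * x ^ b * (- 1) ^ (Suc a - b))"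
      by (simp only: sum.atMost_Suc) simp
    also have "(\<Sum>b\<le>a. real (Suc a choose b) * x ^ b * (- 1) ^ (Suc a - b)) =
        - (\<Sum>b\<le>a. real (Suc a choose b) * (- 1) ^ (a - b) * x ^ b)"
      unfolding sum_negf[symmetric] by (rule sum.cong) (auto simp: Suc_diff_le)
    finally show ?thesis by simp
  qed
  then show ?thesis
    unfolding shift_sum_def pk_pos by (simp add: sum_distrib_left sum.swap[of _ "{..a}"])
qed

text \<open>The Newton recursion at m = 1, where the shift sum counts the N particles, says that the
  moves have total probability one.\<close>

lemma sum_wgt:
  assumes "l \<in> GT N" "N \<ge> 1"
  shows "(\<Sum>i<N. wgt N l i) = 1"
proof -
  have "shift_moment N l 1 = real N" using shift_moment_Newton[OF assms, of 1] by (simp add: shift_moment_0 shift_sum_def)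
  then show ?thesis using assms(2) by (simp add: shift_moment_def)
qed

section \<open>Uniform asymptotics of arrays\<close>

text \<open>Arrays indexed by the size and the time of the chain are compared with functions of
  the macroscopic time \<open>n / N\<^sup>2\<close>, uniformly up to time \<open>T\<close>.\<close>

definition upto_time :: "real \<Rightarrow> nat \<Rightarrow> nat \<Rightarrow> bool" where
  "upto_time T N n \<longleftrightarrow> real n \<le> T * (real N)\<^sup>2"

text \<open>Continuity of the limit belongs to the notion: it makes limits bounded on the compact
  time interval, as products need, and uniformly continuous, as the summation of increments
  needs.\<close>

definition unif_conv :: "real \<Rightarrow> (nat \<Rightarrow> nat \<Rightarrow> real) \<Rightarrow> (real \<Rightarrow> real) \<Rightarrow> bool" where
  "unif_conv T f \<phi> \<longleftrightarrow> continuous_on {0..T} \<phi> \<and>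
     (\<forall>e>0. \<forall>\<^sub>F N in sequentially. \<forall>n. upto_time T N n \<longrightarrow> \<bar>f N n - \<phi> (real n / (real N)\<^sup>2)\<bar> \<le> e)"

definition unif_bdd :: "real \<Rightarrow> (nat \<Rightarrow> nat \<Rightarrow> real) \<Rightarrow> bool" where
  "unif_bdd T f \<longleftrightarrow> (\<exists>B. \<forall>\<^sub>F N in sequentially. \<forall>n. upto_time T N n \<longrightarrow> \<bar>f N n\<bar> \<le> B)"

lemma macro_time:
  assumes "upto_time T N n" "N \<ge> 1"
  shows "real n / (real N)\<^sup>2 \<in> {0..T}"
  using assms by (simp add: upto_time_def divide_le_eq)

lemma Bdd_I: "(\<And>N n. N \<ge> 1 \<Longrightarrow> \<bar>f N n\<bar> \<le> B) \<Longrightarrow> unif_bdd T f"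
  unfolding unif_bdd_def by (intro exI[of _ B]) (auto simp: eventually_sequentially)

lemma Bdd_cong:
  assumes "unif_bdd T f" "\<And>N n. N \<ge> 1 \<Longrightarrow> f N n = g N n"
  shows "unif_bdd T g"
proof -
  obtain B where "\<forall>\<^sub>F N in sequentially. \<forall>n. upto_time T N n \<longrightarrow> \<bar>f N n\<bar> \<le> B"
    using assms(1) by (auto simp: unif_bdd_def)
  then have "\<forall>\<^sub>F N in sequentially. \<forall>n. upto_time T N n \<longrightarrow> \<bar>g N n\<bar> \<le> B"
    using eventually_ge_at_top[of 1] by eventually_elim (simp add: assms(2))
  then show ?thesis by (auto simp: unif_bdd_def)
qed

lemma Bdd_const [simp]: "unif_bdd T (\<lambda>N n. a)"
  by (rule Bdd_I[of _ "\<bar>a\<bar>"]) simp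

lemma Bdd_add:
  assumes "unif_bdd T f" "unif_bdd T g"
  shows "unif_bdd T (\<lambda>N n. f N n + g N n)"
proof -
  obtain A B where "\<forall>\<^sub>F N in sequentially. \<forall>n. upto_time T N n \<longrightarrow> \<bar>f N n\<bar> \<le> A"
      "\<forall>\<^sub>F N in sequentially. \<forall>n. upto_time T N n \<longrightarrow> \<bar>g N n\<bar> \<le> B"
    using assms by (auto simp: unif_bdd_def)
  then have "\<forall>\<^sub>F N in sequentially. \<forall>n. upto_time T N n \<longrightarrow> \<bar>f N n + g N n\<bar> \<le> A + B"
    by eventually_elim (meson abs_triangle_ineq add_mono order_trans)
  then show ?thesis by (auto simp: unif_bdd_def)
qed

lemma Bdd_mult:
  assumes "unif_bdd T f" "unif_bdd T g"
  shows "unif_bdd T (\<lambda>N n. f N n * g N n)"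
proof -
  obtain A B where "\<forall>\<^sub>F N in sequentially. \<forall>n. upto_time T N n \<longrightarrow> \<bar>f N n\<bar> \<le> A"
      "\<forall>\<^sub>F N in sequentially. \<forall>n. upto_time T N n \<longrightarrow> \<bar>g N n\<bar> \<le> B"
    using assms by (auto simp: unif_bdd_def)
  then have "\<forall>\<^sub>F N in sequentially. \<forall>n. upto_time T N n \<longrightarrow> \<bar>f N n * g N n\<bar> \<le> A * B"
  proof eventually_elim
    case (elim N)
    show ?case
    proof (intro allI impI)
      fix n assume n: "upto_time T N n"
      have "\<bar>f N n\<bar> * \<bar>g N n\<bar> \<le> A * B"
        by (intro mult_mono') (use elim n in auto)
      then show "\<bar>f N n * g N n\<bar> \<le> A * B" by (simp add: abs_mult)
    qed
  qed
  then show ?thesis by (auto simp: unif_bdd_def)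
qed

lemma Bdd_inverse_N: "unif_bdd T (\<lambda>N n. 1 / real N ^ p)"
  by (rule Bdd_I[of _ 1]) simp

lemma conv_Bdd:
  assumes "unif_conv T f \<phi>"
  shows "unif_bdd T f"
proof -
  have "bounded (\<phi> ` {0..T})"
    using assms compact_continuous_image[of "{0..T}" \<phi>] by (auto simp: unif_conv_def compact_imp_bounded)
  then obtain B where B: "\<forall>t\<in>{0..T}. \<bar>\<phi> t\<bar> \<le> B" by (auto simp: bounded_iff)
  have "\<forall>\<^sub>F N in sequentially. \<forall>n. upto_time T N n \<longrightarrow> \<bar>f N n - \<phi> (real n / (real N)\<^sup>2)\<bar> \<le> 1"
    using assms by (simp add: unif_conv_def)
  then have "\<forall>\<^sub>F N in sequentially. \<forall>n. upto_time T N n \<longrightarrow> \<bar>f N n\<bar> \<le> B + 1"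
    using eventually_ge_at_top[of 1]
  proof eventually_elim
    case (elim N)
    then show ?case using B macro_time by fastforce
  qed
  then show ?thesis by (auto simp: unif_bdd_def)
qed

lemma conv_const: "unif_conv T (\<lambda>N n. a) (\<lambda>t. a)"
  by (simp add: unif_conv_def)

lemma conv_cong:
  assumes "unif_conv T f \<phi>" "\<And>N n. N \<ge> 1 \<Longrightarrow> f N n = g N n" "\<And>t. \<phi> t = \<psi> t"
  shows "unif_conv T g \<psi>"
proof -
  have e: "\<psi> = \<phi>" using assms(3) by auto
  have "\<forall>\<^sub>F N in sequentially. \<forall>n. upto_time T N n \<longrightarrow> \<bar>g N n - \<phi> (real n / (real N)\<^sup>2)\<bar> \<le> e" if "e > 0" for e
  proof -
    have "\<forall>\<^sub>F N in sequentially. \<forall>n. upto_time T N n \<longrightarrow> \<bar>f N n - \<phi> (real n / (real N)\<^sup>2)\<bar> \<le> e"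
      using assms(1) that by (auto simp: unif_conv_def)
    then show ?thesis using eventually_ge_at_top[of 1] by eventually_elim (simp add: assms(2))
  qed
  then show ?thesis using assms(1) by (simp add: unif_conv_def e)
qed

lemma conv_add:
  assumes "unif_conv T f \<phi>" "unif_conv T g \<psi>"
  shows "unif_conv T (\<lambda>N n. f N n + g N n) (\<lambda>t. \<phi> t + \<psi> t)"
  unfolding unif_conv_def
proof (intro conjI allI impI)
  show "continuous_on {0..T} (\<lambda>t. \<phi> t + \<psi> t)" using assms by (auto simp: unif_conv_def intro: continuous_on_add)
  fix e :: real assume e: "e > 0"
  have "\<forall>\<^sub>F N in sequentially. \<forall>n. upto_time T N n \<longrightarrow> \<bar>f N n - \<phi> (real n / (real N)\<^sup>2)\<bar> \<le> e / 2"
       "\<forall>\<^sub>F N in sequentially. \<forall>n. upto_time T N n \<longrightarrow> \<bar>g N n - \<psi> (real n / (real N)\<^sup>2)\<bar> \<le> e / 2"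
    using assms e half_gt_zero[OF e] unfolding unif_conv_def by blast+
  then show "\<forall>\<^sub>F N in sequentially. \<forall>n. upto_time T N n \<longrightarrow>
      \<bar>f N n + g N n - (\<phi> (real n / (real N)\<^sup>2) + \<psi> (real n / (real N)\<^sup>2))\<bar> \<le> e"
  proof eventually_elim
    case (elim N)
    show ?case
    proof (intro allI impI)
      fix n assume "upto_time T N n"
      then have "\<bar>f N n - \<phi> (real n / (real N)\<^sup>2)\<bar> \<le> e / 2" "\<bar>g N n - \<psi> (real n / (real N)\<^sup>2)\<bar> \<le> e / 2"
        using elim by auto
      then show "\<bar>f N n + g N n - (\<phi> (real n / (real N)\<^sup>2) + \<psi> (real n / (real N)\<^sup>2))\<bar> \<le> e" by linarith
    qed
  qed
qed

lemma conv_null_mult: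
  assumes "unif_bdd T f" "unif_conv T g (\<lambda>t. 0)"
  shows "unif_conv T (\<lambda>N n. f N n * g N n) (\<lambda>t. 0)"
  unfolding unif_conv_def
proof (intro conjI allI impI)
  fix e :: real assume e: "e > 0"
  obtain B where B: "\<forall>\<^sub>F N in sequentially. \<forall>n. upto_time T N n \<longrightarrow> \<bar>f N n\<bar> \<le> B"
    using assms by (auto simp: unif_bdd_def)
  define B' where "B' = max B 1"
  have B': "B' > 0" "B \<le> B'" by (auto simp: B'_def)
  have "\<forall>\<^sub>F N in sequentially. \<forall>n. upto_time T N n \<longrightarrow> \<bar>g N n\<bar> \<le> e / B'"
    using assms e B' by (auto simp: unif_conv_def)
  with B show "\<forall>\<^sub>F N in sequentially. \<forall>n. upto_time T N n \<longrightarrow> \<bar>f N n * g N n - 0\<bar> \<le> e"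
  proof eventually_elim
    case (elim N)
    show ?case
    proof (intro allI impI)
      fix n assume n: "upto_time T N n"
      have "\<bar>f N n\<bar> * \<bar>g N n\<bar> \<le> B' * (e / B')"
        by (intro mult_mono') (use elim n B' in \<open>auto intro: order_trans\<close>)
      then show "\<bar>f N n * g N n - 0\<bar> \<le> e" using B' by (simp add: abs_mult)
    qed
  qed
qed simp

lemma conv_inverse_N: "unif_conv T (\<lambda>N n. 1 / real N) (\<lambda>t. 0)"
  unfolding unif_conv_def
proof (intro conjI allI impI)
  fix e :: real assume e: "e > 0"
  have "(\<lambda>N. 1 / real N) \<longlonglongrightarrow> 0" by (rule lim_1_over_n)
  then have "\<forall>\<^sub>F N in sequentially. \<bar>1 / real N\<bar> < e"
    using e by (auto dest!: tendstoD[of _ _ _ e] simp: dist_real_def)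
  then show "\<forall>\<^sub>F N in sequentially. \<forall>n. upto_time T N n \<longrightarrow> \<bar>1 / real N - 0\<bar> \<le> e"
    by eventually_elim auto
qed simp

lemma conv_Bdd_div_N: "unif_bdd T f \<Longrightarrow> unif_conv T (\<lambda>N n. f N n / real N) (\<lambda>t. 0)"
  using conv_null_mult[OF _ conv_inverse_N] by (simp add: divide_inverse)

lemma conv_deviation:
  assumes "unif_conv T f \<phi>"
  shows "unif_conv T (\<lambda>N n. f N n - \<phi> (real n / (real N)\<^sup>2)) (\<lambda>t. 0)"
  using assms by (simp add: unif_conv_def)

lemma conv_limit:
  assumes "continuous_on {0..T} \<phi>"
  shows "unif_conv T (\<lambda>N n. \<phi> (real n / (real N)\<^sup>2)) \<phi>"
  using assms by (simp add: unif_conv_def)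

lemma conv_mult:
  assumes "unif_conv T f \<phi>" "unif_conv T g \<psi>"
  shows "unif_conv T (\<lambda>N n. f N n * g N n) (\<lambda>t. \<phi> t * \<psi> t)"
proof -
  have c: "continuous_on {0..T} \<phi>" "continuous_on {0..T} \<psi>" using assms by (auto simp: unif_conv_def)
  have 1: "unif_conv T (\<lambda>N n. f N n * (g N n - \<psi> (real n / (real N)\<^sup>2))) (\<lambda>t. 0)"
    by (rule conv_null_mult[OF conv_Bdd[OF assms(1)] conv_deviation[OF assms(2)]])
  have 2: "unif_conv T (\<lambda>N n. \<psi> (real n / (real N)\<^sup>2) * (f N n - \<phi> (real n / (real N)\<^sup>2))) (\<lambda>t. 0)"
    by (rule conv_null_mult[OF conv_Bdd[OF conv_limit[OF c(2)]] conv_deviation[OF assms(1)]])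
  have 3: "unif_conv T (\<lambda>N n. \<phi> (real n / (real N)\<^sup>2) * \<psi> (real n / (real N)\<^sup>2)) (\<lambda>t. \<phi> t * \<psi> t)"
    by (rule conv_limit) (intro continuous_on_mult c)
  show ?thesis by (rule conv_cong[OF conv_add[OF conv_add[OF 1 2] 3]]) (simp_all add: algebra_simps)
qed

lemma conv_sum: "(\<And>a. a \<in> A \<Longrightarrow> unif_conv T (f a) (\<phi> a)) \<Longrightarrow> unif_conv T (\<lambda>N n. \<Sum>a\<in>A. f a N n) (\<lambda>t. \<Sum>a\<in>A. \<phi> a t)"
  by (induction A rule: infinite_finite_induct) (auto intro: conv_add conv_const)

lemma conv_cmult: "unif_conv T f \<phi> \<Longrightarrow> unif_conv T (\<lambda>N n. a * f N n) (\<lambda>t. a * \<phi> t)"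
  by (rule conv_mult[OF conv_const])

lemma conv_inverse_N_pow: "unif_conv T (\<lambda>N n. 1 / real N ^ p) (\<lambda>t. if p = 0 then 1 else 0)"
proof (cases p)
  case (Suc q)
  then show ?thesis using conv_Bdd_div_N[OF Bdd_inverse_N[of T q]]
    by (simp add: field_simps)
qed (simp add: conv_const)

text \<open>An Euler scheme with step 1/N^2 for a right-hand side already known to converge. Each
  step adds an error of at most 2 d / N^2: one d from \<open>g\<close> against \<phi>, one from the
  variation of \<phi> within the step.\<close>

lemma conv_from_increments:
  assumes g: "unif_conv T g \<phi>"
    and step: "\<And>N n. N \<ge> 1 \<Longrightarrow> F N (Suc n) - F N n = g N n / (real N)\<^sup>2"
    and deriv: "\<And>t. (\<Phi> has_real_derivative \<phi> t) (at t)"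
    and init: "(\<lambda>N. F N 0) \<longlonglongrightarrow> \<Phi> 0"
    and T: "T > 0"
  shows "unif_conv T F \<Phi>"
  unfolding unif_conv_def
proof (intro conjI allI impI)
  show "continuous_on {0..T} \<Phi>"
    using deriv by (meson DERIV_isCont continuous_at_imp_continuous_on)
  fix e :: real assume e: "e > 0"
  \<comment> \<open>Over the total time T the steps contribute T * (2 * d) = e / 2; the other half
    is for the initial value.\<close>
  define d where "d = e / (2 * (2 * T))"
  have d: "d > 0" using e T by (simp add: d_def)
  have "uniformly_continuous_on {0..T} \<phi>"
    using g by (intro compact_uniformly_continuous) (auto simp: unif_conv_def)
  then obtain r where r: "r > 0" and
      r': "\<And>s t. s \<in> {0..T} \<Longrightarrow> t \<in> {0..T} \<Longrightarrow> \<bar>s - t\<bar> < r \<Longrightarrow> \<bar>\<phi> s - \<phi> t\<bar> < d"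
    using d unfolding uniformly_continuous_on_def dist_real_def by metis
  have "(\<lambda>N. 1 / real N) \<longlonglongrightarrow> 0" by (rule lim_1_over_n)
  then have E1: "\<forall>\<^sub>F N in sequentially. \<bar>1 / real N\<bar> < r"
    using r by (auto dest!: tendstoD[of _ _ _ r] simp: dist_real_def)
  have E2: "\<forall>\<^sub>F N in sequentially. \<bar>F N 0 - \<Phi> 0\<bar> < e / 2"
    using init e by (auto dest!: tendstoD[of _ _ _ "e/2"] simp: dist_real_def)
  have E3: "\<forall>\<^sub>F N in sequentially. \<forall>n. upto_time T N n \<longrightarrow> \<bar>g N n - \<phi> (real n / (real N)\<^sup>2)\<bar> \<le> d"
    using g d by (simp add: unif_conv_def)
  show "\<forall>\<^sub>F N in sequentially. \<forall>n. upto_time T N n \<longrightarrow> \<bar>F N n - \<Phi> (real n / (real N)\<^sup>2)\<bar> \<le> e"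
    using E1 E2 E3 eventually_ge_at_top[of 1]
  proof eventually_elim
    case (elim N)
    define h where "h = 1 / (real N)\<^sup>2"
    have h: "h > 0" using elim by (simp add: h_def)
    have "1 / (real N)\<^sup>2 \<le> 1 / real N"
      using elim(4) by (simp add: power2_eq_square field_simps)
    then have hr: "h < r" using elim(1) by (simp add: h_def)
    have "\<bar>F N n - \<Phi> (real n * h)\<bar> \<le> e / 2 + real n * h * (2 * d)" if "upto_time T N n" for n
      using that
    proof (induction n)
      case 0
      then show ?case using elim by simp
    next
      case (Suc n)
      have un: "upto_time T N n" using Suc.prems by (simp add: upto_time_def)
      have t: "real n * h \<in> {0..T}" "real (Suc n) * h \<in> {0..T}"
        using macro_time[OF un elim(4)] macro_time[OF Suc.prems elim(4)] by (simp_all add: h_def)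
      obtain z where z: "real n * h < z" "z < real (Suc n) * h"
          "\<Phi> (real (Suc n) * h) - \<Phi> (real n * h) = (real (Suc n) * h - real n * h) * \<phi> z"
        using MVT2[of "real n * h" "real (Suc n) * h" \<Phi> \<phi>] deriv h by auto
      have zz: "\<Phi> (real (Suc n) * h) - \<Phi> (real n * h) = h * \<phi> z"
        using z(3) by (simp add: algebra_simps)
      have "\<bar>\<phi> z - \<phi> (real n * h)\<bar> < d"
      proof (rule r'[OF _ t(1)])
        show "z \<in> {0..T}" using t z(1,2) by auto
        show "\<bar>z - real n * h\<bar> < r" using z(1,2) hr by (simp add: algebra_simps)
      qed
      moreover have "\<bar>g N n - \<phi> (real n * h)\<bar> \<le> d"
        using elim un by (auto simp: h_def)
      ultimately have "\<bar>g N n - \<phi> z\<bar> \<le> 2 * d" by linarith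
      then have "h * \<bar>g N n - \<phi> z\<bar> \<le> h * (2 * d)" using h by (intro mult_left_mono) auto
      then have "\<bar>h * g N n - h * \<phi> z\<bar> \<le> h * (2 * d)"
        using h by (simp add: abs_mult right_diff_distrib[symmetric])
      moreover have "F N (Suc n) = F N n + h * g N n" using step[of N n] elim by (simp add: h_def)
      ultimately have "\<bar>F N (Suc n) - \<Phi> (real (Suc n) * h)\<bar> \<le> e / 2 + real n * h * (2 * d) + h * (2 * d)"
        using Suc.IH[OF un] zz by linarith
      then show ?case by (simp add: algebra_simps)
    qed
    moreover have "real n * h * (2 * d) \<le> e / 2" if "upto_time T N n" for n
    proof -
      have "real n * h \<le> T" using macro_time[OF that elim(4)] by (simp add: h_def)
      then have "real n * h * (2 * d) \<le> T * (2 * d)" using d by (intro mult_right_mono) auto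
      also have "\<dots> = e / 2" using T by (simp add: d_def)
      finally show ?thesis .
    qed
    ultimately show ?case by (fastforce simp: h_def)
  qed
qed

section \<open>Wick sums\<close>

text \<open>The moments are real while \<open>wick\<close> is complex-valued. For a real covariance
  the sum is real, so the real part loses nothing and derivatives can be taken over the
  reals.\<close>

definition wickr :: "('a \<Rightarrow> 'a \<Rightarrow> real) \<Rightarrow> 'a list \<Rightarrow> real" where
  "wickr C ks = Re (wick (\<lambda>a b. complex_of_real (C a b)) ks)"

lemma wick_of_real: "wick (\<lambda>a b. complex_of_real (C a b)) ks = complex_of_real (wickr C ks)"
proof -
  have "Im (wick (\<lambda>a b. complex_of_real (C a b)) ks) = 0"
  proof (induction "length ks" arbitrary: ks rule: less_induct)
    case less
    show ?case
    proof (cases ks)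
      case (Cons k ks')
      have "Im (complex_of_real (C k (ks' ! j)) * wick (\<lambda>a b. complex_of_real (C a b)) (take j ks' @ drop (Suc j) ks')) = 0"
        if "j < length ks'" for j
        using that Cons less[of "take j ks' @ drop (Suc j) ks'"] by simp
      then show ?thesis unfolding Cons wick.simps Im_sum by (intro sum.neutral) auto
    qed simp
  qed
  then show ?thesis by (simp add: wickr_def complex_eq_iff)
qed

lemma wickr_Nil [simp]: "wickr C [] = 1"
  by (simp add: wickr_def)

lemma wickr_Cons:
  "wickr C (k # ks) = (\<Sum>j<length ks. C k (ks ! j) * wickr C (take j ks @ drop (Suc j) ks))"
  unfolding wickr_def[of C "k # ks"] wick.simps(2) by (simp only: wick_of_real Re_sum) simp

lemma take_drop_remove1:
  assumes "distinct xs" "j < length xs"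
  shows "take j xs @ drop (Suc j) xs = remove1 (xs ! j) xs"
proof -
  have xs: "xs = take j xs @ xs ! j # drop (Suc j) xs" using assms(2) by (rule id_take_nth_drop)
  then have "xs ! j \<notin> set (take j xs)"
    using assms(1) by (metis disjoint_insert(1) distinct_append list.simps(15))
  then show ?thesis by (subst (3) xs) (simp add: remove1_append)
qed

text \<open>A list of orders may repeat an order, so its entries do not identify positions. Writing
  it as \<open>map \<kappa> xs\<close> with distinct indices \<open>xs\<close> separates identity
  from order and turns pairings into sums over sets.\<close>

lemma wickr_map_Cons:
  assumes "distinct xs"
  shows "wickr C (map \<kappa> (x # xs)) = (\<Sum>b\<in>set xs. C (\<kappa> x) (\<kappa> b) * wickr C (map \<kappa> (remove1 b xs)))"
proof -
  have "wickr C (map \<kappa> (x # xs)) = (\<Sum>j<length xs. C (\<kappa> x) (\<kappa> (xs ! j)) * wickr C (map \<kappa> (remove1 (xs ! j) xs)))"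
    unfolding list.map wickr_Cons
    by (auto simp: take_map drop_map simp flip: map_append simp add: take_drop_remove1[OF assms])
  also have "\<dots> = (\<Sum>b\<in>set xs. C (\<kappa> x) (\<kappa> b) * wickr C (map \<kappa> (remove1 b xs)))"
    by (rule sum.reindex_bij_betw[OF bij_betw_nth[OF assms refl refl],
        of "\<lambda>b. C (\<kappa> x) (\<kappa> b) * wickr C (map \<kappa> (remove1 b xs))"])
  finally show ?thesis .
qed

lemma sum_off_diagonal_swap:
  assumes "finite S"
  shows "(\<Sum>b\<in>S. \<Sum>a\<in>S - {b}. f a b) = (\<Sum>a\<in>S. \<Sum>b\<in>S - {a}. f a b)"
proof -
  have "(\<Sum>b\<in>S. \<Sum>a\<in>S - {b}. f a b) = (\<Sum>b\<in>S. \<Sum>a\<in>{a \<in> S. a \<noteq> b}. f a b)"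
    by (intro sum.cong) auto
  also have "\<dots> = (\<Sum>a\<in>S. \<Sum>b\<in>{b \<in> S. a \<noteq> b}. f a b)"
    using sum.swap_restrict[OF assms assms, of "\<lambda>b a. f a b" "\<lambda>b a. a \<noteq> b"] by simp
  also have "\<dots> = (\<Sum>a\<in>S. \<Sum>b\<in>S - {a}. f a b)"
    by (intro sum.cong) auto
  finally show ?thesis .
qed

text \<open>The covariance equation \<open>C' = A C + C A\<^sup>T + Q\<close> lifts to the Wick sums: the drift acts as a
  derivation on the labels and \<open>Q\<close> removes pairs.\<close>

lemma has_derivative_wickr:
  fixes C A Q :: "'a \<Rightarrow> 'a \<Rightarrow> real \<Rightarrow> real" and \<kappa> :: "'i \<Rightarrow> 'a"
  assumes C: "\<And>k l. k \<in> G \<Longrightarrow> l \<in> G \<Longrightarrow> ((\<lambda>s. C k l s) has_real_derivative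
      (\<Sum>j\<in>J k. A k j t * C j l t) + (\<Sum>j\<in>J l. A l j t * C k j t) + Q k l t) (at t)"
    and Q: "\<And>k l. Q k l t = Q l k t"
    and "distinct xs" "\<And>a. a \<in> set xs \<Longrightarrow> \<kappa> a \<in> G"
  shows "((\<lambda>s. wickr (\<lambda>k l. C k l s) (map \<kappa> xs)) has_real_derivative
     (\<Sum>a\<in>set xs. \<Sum>j\<in>J (\<kappa> a). A (\<kappa> a) j t * wickr (\<lambda>k l. C k l t) (map (\<kappa>(a := j)) xs)) +
     (\<Sum>a\<in>set xs. \<Sum>b\<in>set xs - {a}. Q (\<kappa> a) (\<kappa> b) t * wickr (\<lambda>k l. C k l t) (map \<kappa> (remove1 b (remove1 a xs)))) / 2) (at t)"
  using assms(3,4)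
proof (induction "length xs" arbitrary: xs rule: less_induct)
  case less
  show ?case
  proof (cases xs)
    case Nil
    then show ?thesis by simp
  next
    case (Cons x ys)
    let ?w = "\<lambda>zs. wickr (\<lambda>k l. C k l t) zs"
    let ?S = "set ys"
    have dys: "distinct ys" and xn: "x \<notin> ?S" and fin: "finite ?S"
      and sr: "\<And>b. set (remove1 b ys) = ?S - {b}"
      using less.prems Cons by auto
    let ?D1 = "\<lambda>zs. \<Sum>a\<in>set zs. \<Sum>j\<in>J (\<kappa> a). A (\<kappa> a) j t * ?w (map (\<kappa>(a := j)) zs)"
    let ?D2 = "\<lambda>zs. (\<Sum>a\<in>set zs. \<Sum>b\<in>set zs - {a}. Q (\<kappa> a) (\<kappa> b) t * ?w (map \<kappa> (remove1 b (remove1 a zs))))"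
    have "((\<lambda>s. wickr (\<lambda>k l. C k l s) (map \<kappa> (remove1 b ys))) has_real_derivative
      ?D1 (remove1 b ys) + ?D2 (remove1 b ys) / 2) (at t)" if "b \<in> ?S" for b
    proof (rule less.hyps)
      show "length (remove1 b ys) < length xs"
        using Cons by (simp add: length_remove1 less_Suc_eq_le)
      show "distinct (remove1 b ys)" using dys by simp
      show "\<kappa> a \<in> G" if "a \<in> set (remove1 b ys)" for a
        using that less.prems(2)[of a] Cons unfolding sr by simp
    qed
    then have "((\<lambda>s. \<Sum>b\<in>?S. C (\<kappa> x) (\<kappa> b) s * wickr (\<lambda>k l. C k l s) (map \<kappa> (remove1 b ys))) has_real_derivative
      (\<Sum>b\<in>?S. C (\<kappa> x) (\<kappa> b) t * (?D1 (remove1 b ys) + ?D2 (remove1 b ys) / 2) +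
        ((\<Sum>j\<in>J (\<kappa> x). A (\<kappa> x) j t * C j (\<kappa> b) t) + (\<Sum>j\<in>J (\<kappa> b). A (\<kappa> b) j t * C (\<kappa> x) j t) + Q (\<kappa> x) (\<kappa> b) t)
         * ?w (map \<kappa> (remove1 b ys)))) (at t)"
      using less.prems Cons by (intro DERIV_sum DERIV_mult' C) auto
    moreover have "?D1 xs + ?D2 xs / 2 = (\<Sum>b\<in>?S. C (\<kappa> x) (\<kappa> b) t * (?D1 (remove1 b ys) + ?D2 (remove1 b ys) / 2) +
        ((\<Sum>j\<in>J (\<kappa> x). A (\<kappa> x) j t * C j (\<kappa> b) t) + (\<Sum>j\<in>J (\<kappa> b). A (\<kappa> b) j t * C (\<kappa> x) j t) + Q (\<kappa> x) (\<kappa> b) t)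
         * ?w (map \<kappa> (remove1 b ys)))"
    proof -
      have W: "?w (map \<kappa>' (x # zs)) = (\<Sum>b\<in>set zs. C (\<kappa>' x) (\<kappa>' b) t * ?w (map \<kappa>' (remove1 b zs)))"
        if "distinct zs" for \<kappa>' zs
        by (rule wickr_map_Cons[OF that])
      have mapupd: "map (\<kappa>(a := j)) zs = map \<kappa> zs" if "a \<notin> set zs" for a j zs
        using that by (induction zs) auto
      have D1x: "(\<Sum>j\<in>J (\<kappa> x). A (\<kappa> x) j t * ?w (map (\<kappa>(x := j)) xs)) =
          (\<Sum>b\<in>?S. (\<Sum>j\<in>J (\<kappa> x). A (\<kappa> x) j t * C j (\<kappa> b) t) * ?w (map \<kappa> (remove1 b ys)))"
      proof -
        have "?w (map (\<kappa>(x := j)) xs) = (\<Sum>b\<in>?S. C j (\<kappa> b) t * ?w (map \<kappa> (remove1 b ys)))" for j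
          unfolding Cons W[OF dys]
        proof (rule sum.cong)
          fix b assume "b \<in> ?S"
          then show "C ((\<kappa>(x := j)) x) ((\<kappa>(x := j)) b) t * ?w (map (\<kappa>(x := j)) (remove1 b ys)) =
              C j (\<kappa> b) t * ?w (map \<kappa> (remove1 b ys))"
            using xn sr[of b] mapupd[of x "remove1 b ys" j] by auto
        qed simp
        then show ?thesis
          by (simp add: sum_distrib_left sum_distrib_right mult.assoc sum.swap[of _ ?S])
      qed
      \<comment> \<open>The drift relabels an index \<open>a\<close> of the tail. Either
        \<open>a\<close> is the partner of \<open>x\<close>, which gives the transposed drift term
        of the covariance, or it sits in the remaining list.\<close>
      have D1y: "(\<Sum>a\<in>?S. \<Sum>j\<in>J (\<kappa> a). A (\<kappa> a) j t * ?w (map (\<kappa>(a := j)) xs)) =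
         (\<Sum>b\<in>?S. (\<Sum>j\<in>J (\<kappa> b). A (\<kappa> b) j t * C (\<kappa> x) j t) * ?w (map \<kappa> (remove1 b ys)))
         + (\<Sum>b\<in>?S. C (\<kappa> x) (\<kappa> b) t * ?D1 (remove1 b ys))"
      proof -
        have "?w (map (\<kappa>(a := j)) xs) = C (\<kappa> x) j t * ?w (map \<kappa> (remove1 a ys))
           + (\<Sum>b\<in>?S - {a}. C (\<kappa> x) (\<kappa> b) t * ?w (map (\<kappa>(a := j)) (remove1 b ys)))" if a: "a \<in> ?S" for a j
        proof -
          have ax: "x \<noteq> a" using a xn by auto
          have "?w (map (\<kappa>(a := j)) xs) = (\<Sum>b\<in>?S. C ((\<kappa>(a := j)) x) ((\<kappa>(a := j)) b) t * ?w (map (\<kappa>(a := j)) (remove1 b ys)))"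
            unfolding Cons W[OF dys] ..
          also have "\<dots> = C (\<kappa> x) j t * ?w (map (\<kappa>(a := j)) (remove1 a ys)) +
             (\<Sum>b\<in>?S - {a}. C ((\<kappa>(a := j)) x) ((\<kappa>(a := j)) b) t * ?w (map (\<kappa>(a := j)) (remove1 b ys)))"
            using ax by (subst sum.remove[OF fin a]) simp
          also have "map (\<kappa>(a := j)) (remove1 a ys) = map \<kappa> (remove1 a ys)"
            by (rule mapupd) (simp add: sr)
          finally show ?thesis using ax by (simp add: fun_upd_def)
        qed
        then have "(\<Sum>a\<in>?S. \<Sum>j\<in>J (\<kappa> a). A (\<kappa> a) j t * ?w (map (\<kappa>(a := j)) xs)) =
          (\<Sum>a\<in>?S. (\<Sum>j\<in>J (\<kappa> a). A (\<kappa> a) j t * C (\<kappa> x) j t) * ?w (map \<kappa> (remove1 a ys))) +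
          (\<Sum>a\<in>?S. \<Sum>j\<in>J (\<kappa> a). \<Sum>b\<in>?S - {a}. A (\<kappa> a) j t * (C (\<kappa> x) (\<kappa> b) t * ?w (map (\<kappa>(a := j)) (remove1 b ys))))"
          by (simp add: distrib_left sum.distrib sum_distrib_left sum_distrib_right mult.assoc)
        also have "(\<Sum>a\<in>?S. \<Sum>j\<in>J (\<kappa> a). \<Sum>b\<in>?S - {a}. A (\<kappa> a) j t * (C (\<kappa> x) (\<kappa> b) t * ?w (map (\<kappa>(a := j)) (remove1 b ys)))) =
           (\<Sum>a\<in>?S. \<Sum>b\<in>?S - {a}. \<Sum>j\<in>J (\<kappa> a). A (\<kappa> a) j t * (C (\<kappa> x) (\<kappa> b) t * ?w (map (\<kappa>(a := j)) (remove1 b ys))))"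
          by (intro sum.cong sum.swap refl)
        also have "\<dots> = (\<Sum>b\<in>?S. \<Sum>a\<in>?S - {b}. \<Sum>j\<in>J (\<kappa> a). A (\<kappa> a) j t * (C (\<kappa> x) (\<kappa> b) t * ?w (map (\<kappa>(a := j)) (remove1 b ys))))"
          by (rule sum_off_diagonal_swap[OF fin, symmetric])
        also have "\<dots> = (\<Sum>b\<in>?S. C (\<kappa> x) (\<kappa> b) t * ?D1 (remove1 b ys))"
          unfolding set_remove1_eq[OF dys] by (simp add: sum_distrib_left mult_ac)
        finally show ?thesis .
      qed
      \<comment> \<open>The head occurs in the ordered pairs (x, b) and (b, x), equal by symmetry of
        \<open>Q\<close>; the factor 2 cancels the division by 2. In all other pairs
        \<open>x\<close> is matched with a third index \<open>c\<close>.\<close>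
      have D2: "?D2 xs = 2 * (\<Sum>b\<in>?S. Q (\<kappa> x) (\<kappa> b) t * ?w (map \<kappa> (remove1 b ys)))
          + (\<Sum>b\<in>?S. C (\<kappa> x) (\<kappa> b) t * ?D2 (remove1 b ys))"
      proof -
        have r: "(\<Sum>b\<in>insert x ?S - {a}. Q (\<kappa> a) (\<kappa> b) t * ?w (map \<kappa> (remove1 b (remove1 a (x # ys))))) =
            Q (\<kappa> x) (\<kappa> a) t * ?w (map \<kappa> (remove1 a ys)) +
            (\<Sum>b\<in>?S - {a}. \<Sum>c\<in>?S - {a} - {b}. Q (\<kappa> a) (\<kappa> b) t * (C (\<kappa> x) (\<kappa> c) t * ?w (map \<kappa> (remove1 c (remove1 b (remove1 a ys))))))"
          if a: "a \<in> ?S" for a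
        proof -
          have ax: "a \<noteq> x" using a xn by auto
          have s: "insert x ?S - {a} = insert x (?S - {a})" using ax by auto
          have d2: "distinct (remove1 b (remove1 a ys))" for b using dys by simp
          have i: "?w (map \<kappa> (remove1 b (x # remove1 a ys))) = (\<Sum>c\<in>?S - {a} - {b}. C (\<kappa> x) (\<kappa> c) t * ?w (map \<kappa> (remove1 c (remove1 b (remove1 a ys)))))"
            if "b \<in> ?S - {a}" for b
          proof -
            have "x \<noteq> b" using that xn by auto
            then have "remove1 b (x # remove1 a ys) = x # remove1 b (remove1 a ys)" by simp
            moreover have "set (remove1 b (remove1 a ys)) = ?S - {a} - {b}" using dys by simp
            ultimately show ?thesis using W[OF d2, of \<kappa> b] by simp
          qed
          show ?thesis
            unfolding s using ax xn fin i by (simp add: Q[of "\<kappa> a"] sum_distrib_left)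
        qed
        have "?D2 xs = (\<Sum>b\<in>?S. Q (\<kappa> x) (\<kappa> b) t * ?w (map \<kappa> (remove1 b ys))) +
           (\<Sum>a\<in>?S. (\<Sum>b\<in>insert x ?S - {a}. Q (\<kappa> a) (\<kappa> b) t * ?w (map \<kappa> (remove1 b (remove1 a (x # ys))))))"
        proof -
          have "insert x ?S - {x} = ?S" using xn by auto
          then show ?thesis using Cons xn fin by simp
        qed
        also have "\<dots> = 2 * (\<Sum>b\<in>?S. Q (\<kappa> x) (\<kappa> b) t * ?w (map \<kappa> (remove1 b ys))) +
           (\<Sum>a\<in>?S. \<Sum>b\<in>?S - {a}. \<Sum>c\<in>?S - {a} - {b}. Q (\<kappa> a) (\<kappa> b) t * (C (\<kappa> x) (\<kappa> c) t * ?w (map \<kappa> (remove1 c (remove1 b (remove1 a ys))))))"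
          using r by (simp add: sum.distrib)
        also have "(\<Sum>a\<in>?S. \<Sum>b\<in>?S - {a}. \<Sum>c\<in>?S - {a} - {b}. Q (\<kappa> a) (\<kappa> b) t * (C (\<kappa> x) (\<kappa> c) t * ?w (map \<kappa> (remove1 c (remove1 b (remove1 a ys)))))) =
           (\<Sum>a\<in>?S. \<Sum>c\<in>?S - {a}. \<Sum>b\<in>?S - {a} - {c}. Q (\<kappa> a) (\<kappa> b) t * (C (\<kappa> x) (\<kappa> c) t * ?w (map \<kappa> (remove1 c (remove1 b (remove1 a ys))))))"
          by (intro sum.cong refl sum_off_diagonal_swap) simp
        also have "\<dots> = (\<Sum>c\<in>?S. \<Sum>a\<in>?S - {c}. \<Sum>b\<in>?S - {a} - {c}. Q (\<kappa> a) (\<kappa> b) t * (C (\<kappa> x) (\<kappa> c) t * ?w (map \<kappa> (remove1 c (remove1 b (remove1 a ys))))))"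
          by (rule sum_off_diagonal_swap[OF fin, symmetric])
        also have "\<dots> = (\<Sum>c\<in>?S. C (\<kappa> x) (\<kappa> c) t * ?D2 (remove1 c ys))"
        proof (rule sum.cong)
          fix c assume "c \<in> ?S"
          have "?S - {a} - {c} = ?S - {c} - {a}" for a by auto
          moreover have "remove1 c (remove1 b (remove1 a ys)) = remove1 b (remove1 a (remove1 c ys))" for a b
            by (metis remove1_commute)
          ultimately show "(\<Sum>a\<in>?S - {c}. \<Sum>b\<in>?S - {a} - {c}. Q (\<kappa> a) (\<kappa> b) t * (C (\<kappa> x) (\<kappa> c) t * ?w (map \<kappa> (remove1 c (remove1 b (remove1 a ys)))))) =
             C (\<kappa> x) (\<kappa> c) t * ?D2 (remove1 c ys)"
            unfolding set_remove1_eq[OF dys] by (simp add: sum_distrib_left mult_ac)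
        qed simp
        finally show ?thesis .
      qed
      have collect: "(\<Sum>b\<in>?S. g b * w b) + ((\<Sum>b\<in>?S. h b * w b) + (\<Sum>b\<in>?S. c b * e b)) +
          (2 * (\<Sum>b\<in>?S. q b * w b) + (\<Sum>b\<in>?S. c b * f b)) / 2 =
          (\<Sum>b\<in>?S. c b * (e b + f b / 2) + (g b + h b + q b) * w b)" for c e f g h q w :: "'i \<Rightarrow> real"
      proof -
        have "(\<Sum>b\<in>?S. c b * f b) / 2 = (\<Sum>b\<in>?S. c b * (f b / 2))" by (simp add: sum_divide_distrib)
        then show ?thesis by (simp only: distrib_left distrib_right sum.distrib add_divide_distrib)
      qed
      have sx: "set xs = insert x ?S" using Cons by simp
      show ?thesis
        unfolding D2 unfolding sx sum.insert[OF fin xn] D1x D1y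
        by (rule collect)
    qed
    moreover have "wickr (\<lambda>k l. C k l s) (map \<kappa> xs) = (\<Sum>b\<in>?S. C (\<kappa> x) (\<kappa> b) s * wickr (\<lambda>k l. C k l s) (map \<kappa> (remove1 b ys)))" for s
      unfolding Cons by (rule wickr_map_Cons[OF dys])
    ultimately show ?thesis by simp
  qed
qed

section \<open>Expansion of a product under a small step\<close>

text \<open>The coefficients of h and h^2 in prod (A + h U), and in \<open>expand3\<close> the exact
  remainder divided by h^3, itself depending on h. The recursive form suits bounds by induction on
  the list; the closed sums below serve for the limits.\<close>

fun expand1 :: "('a \<Rightarrow> real) \<Rightarrow> ('a \<Rightarrow> real) \<Rightarrow> 'a list \<Rightarrow> real" where
  "expand1 A U [] = 0"
| "expand1 A U (x # xs) = A x * expand1 A U xs + U x * prod_list (map A xs)"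

fun expand2 :: "('a \<Rightarrow> real) \<Rightarrow> ('a \<Rightarrow> real) \<Rightarrow> 'a list \<Rightarrow> real" where
  "expand2 A U [] = 0"
| "expand2 A U (x # xs) = A x * expand2 A U xs + U x * expand1 A U xs"

fun expand3 :: "real \<Rightarrow> ('a \<Rightarrow> real) \<Rightarrow> ('a \<Rightarrow> real) \<Rightarrow> 'a list \<Rightarrow> real" where
  "expand3 h A U [] = 0"
| "expand3 h A U (x # xs) = A x * expand3 h A U xs + U x * expand2 A U xs + h * (U x * expand3 h A U xs)"

lemma prod_list_perturb:
  "prod_list (map (\<lambda>x. A x + h * U x) xs) =
     prod_list (map A xs) + h * expand1 A U xs + h\<^sup>2 * expand2 A U xs + h ^ 3 * expand3 h A U xs"
  by (induction xs) (simp_all add: algebra_simps power2_eq_square power3_eq_cube)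

lemma prod_list_map_distinct: "distinct xs \<Longrightarrow> prod_list (map A xs) = prod A (set xs)"
  by (induction xs) auto

lemma expand1_eq:
  "distinct xs \<Longrightarrow> expand1 A U xs = (\<Sum>a\<in>set xs. U a * prod_list (map A (remove1 a xs)))"
proof (induction xs)
  case (Cons x xs)
  have "(\<Sum>a\<in>set xs. U a * prod_list (map A (remove1 a (x # xs)))) = A x * (\<Sum>a\<in>set xs. U a * prod_list (map A (remove1 a xs)))"
    unfolding sum_distrib_left using Cons.prems by (intro sum.cong) auto
  then show ?case using Cons by simp
qed simp

text \<open>Ordered pairs count each unordered pair twice, hence the division by 2. This is the
  shape of the noise term in \<open>has_derivative_wickr\<close>.\<close>

lemma expand2_eq:
  "distinct xs \<Longrightarrow> expand2 A U xs =
    (\<Sum>a\<in>set xs. \<Sum>b\<in>set xs - {a}. U a * U b * prod_list (map A (remove1 b (remove1 a xs)))) / 2"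
proof (induction xs)
  case (Cons x xs)
  let ?S = "set xs"
  have xn: "x \<notin> ?S" and d: "distinct xs" using Cons.prems by auto
  have 1: "insert x ?S - {x} = ?S" using xn by auto
  have "(\<Sum>b\<in>insert x ?S - {a}. U a * U b * prod_list (map A (remove1 b (remove1 a (x # xs))))) =
      U x * (U a * prod_list (map A (remove1 a xs))) + A x * (\<Sum>b\<in>?S - {a}. U a * U b * prod_list (map A (remove1 b (remove1 a xs))))"
    if a: "a \<in> ?S" for a
  proof -
    have ax: "a \<noteq> x" using a xn by auto
    have s: "insert x ?S - {a} = insert x (?S - {a})" using ax by auto
    have "(\<Sum>b\<in>?S - {a}. U a * U b * prod_list (map A (remove1 b (x # remove1 a xs)))) =
       A x * (\<Sum>b\<in>?S - {a}. U a * U b * prod_list (map A (remove1 b (remove1 a xs))))"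
      unfolding sum_distrib_left using xn by (intro sum.cong) auto
    then show ?thesis unfolding s using ax xn by simp
  qed
  then have "(\<Sum>a\<in>set (x # xs). \<Sum>b\<in>set (x # xs) - {a}. U a * U b * prod_list (map A (remove1 b (remove1 a (x # xs))))) =
     2 * (U x * expand1 A U xs) + A x * (\<Sum>a\<in>?S. \<Sum>b\<in>?S - {a}. U a * U b * prod_list (map A (remove1 b (remove1 a xs))))"
    using xn by (simp add: 1 sum.distrib expand1_eq[OF d] sum_distrib_left mult.assoc)
  then show ?case using Cons by simp
qed simp

section \<open>Fluctuations of power sums\<close>

text \<open>The interface asks for linearity and indifference to values outside \<open>D\<close>, so
  boundedness always means boundedness of expectations of products, never a moment inequality. There
  are two instances: functions of the signature, and functions of the signature together with the
  moving particle.\<close>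

locale multiplier_class =
  fixes T :: real
    and E :: "nat \<Rightarrow> nat \<Rightarrow> ('s \<Rightarrow> real) \<Rightarrow> real"
    and v :: "nat \<Rightarrow> nat \<Rightarrow> nat \<Rightarrow> 's \<Rightarrow> real"
    and wt :: "nat \<Rightarrow> nat"
    and D :: "nat \<Rightarrow> 's set"
  assumes E_cong: "(\<And>s. s \<in> D N \<Longrightarrow> F s = G s) \<Longrightarrow> E N n F = E N n G"
    and E_add: "E N n (\<lambda>s. F s + G s) = E N n F + E N n G"
    and E_cmult: "E N n (\<lambda>s. c * F s) = c * E N n F"
begin

text \<open>Moments are controlled only up to total weight \<open>W\<close>.  A test function of weight \<open>w\<close> may still be multiplied
  by generators of total weight \<open>W - w\<close>; multiplication by a multiplier of weight \<open>w\<close> uses up \<open>w\<close>.  With this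
  semantic definition products of multipliers need no expansion into monomials.\<close>

definition tst :: "nat \<Rightarrow> nat \<Rightarrow> (nat \<Rightarrow> nat \<Rightarrow> 's \<Rightarrow> real) \<Rightarrow> bool" where
  "tst W w F \<longleftrightarrow> (\<forall>ks. sum_list (map wt ks) + w \<le> W \<longrightarrow>
     unif_bdd T (\<lambda>N n. E N n (\<lambda>s. F N n s * (\<Prod>k\<leftarrow>ks. v N n k s))))"

definition mlt :: "nat \<Rightarrow> nat \<Rightarrow> (nat \<Rightarrow> nat \<Rightarrow> 's \<Rightarrow> real) \<Rightarrow> bool" where
  "mlt W w F \<longleftrightarrow> (\<forall>u H. tst W u H \<longrightarrow> tst W (u + w) (\<lambda>N n s. F N n s * H N n s))"

lemma tst_mono: "tst W w F \<Longrightarrow> w \<le> w' \<Longrightarrow> tst W w' F"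
  unfolding tst_def by auto

lemma mlt_mono: "mlt W w F \<Longrightarrow> w \<le> w' \<Longrightarrow> mlt W w' F"
  unfolding mlt_def by (meson add_left_mono tst_mono)

lemma tst_cong:
  assumes "tst W w F" "\<And>N n s. N \<ge> 1 \<Longrightarrow> s \<in> D N \<Longrightarrow> F N n s = G N n s"
  shows "tst W w G"
  unfolding tst_def
proof (intro allI impI)
  fix ks assume "sum_list (map wt ks) + w \<le> W"
  then have "unif_bdd T (\<lambda>N n. E N n (\<lambda>s. F N n s * (\<Prod>k\<leftarrow>ks. v N n k s)))"
    using assms(1) by (auto simp: tst_def)
  then show "unif_bdd T (\<lambda>N n. E N n (\<lambda>s. G N n s * (\<Prod>k\<leftarrow>ks. v N n k s)))"
    by (rule Bdd_cong) (auto intro!: E_cong simp: assms(2))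
qed

lemma mlt_cong:
  assumes "mlt W w F" "\<And>N n s. N \<ge> 1 \<Longrightarrow> s \<in> D N \<Longrightarrow> F N n s = G N n s"
  shows "mlt W w G"
  unfolding mlt_def
proof (intro allI impI)
  fix u H assume "tst W u H"
  then have "tst W (u + w) (\<lambda>N n s. F N n s * H N n s)" using assms(1) by (auto simp: mlt_def)
  then show "tst W (u + w) (\<lambda>N n s. G N n s * H N n s)"
    by (rule tst_cong) (simp add: assms(2))
qed

lemma mlt_const:
  assumes "unif_bdd T f"
  shows "mlt W 0 (\<lambda>N n s. f N n)"
  unfolding mlt_def tst_def
proof (intro allI impI)
  fix u H ks
  assume H: "\<forall>ks. sum_list (map wt ks) + u \<le> W \<longrightarrow> unif_bdd T (\<lambda>N n. E N n (\<lambda>s. H N n s * (\<Prod>k\<leftarrow>ks. v N n k s)))"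
    and "sum_list (map wt ks) + (u + 0) \<le> W"
  then have "unif_bdd T (\<lambda>N n. E N n (\<lambda>s. H N n s * (\<Prod>k\<leftarrow>ks. v N n k s)))" by simp
  then show "unif_bdd T (\<lambda>N n. E N n (\<lambda>s. f N n * H N n s * (\<Prod>k\<leftarrow>ks. v N n k s)))"
    using Bdd_mult[OF assms] by (simp add: mult.assoc E_cmult)
qed

lemma mlt_generator: "mlt W (wt j) (\<lambda>N n s. v N n j s)"
  unfolding mlt_def tst_def
proof (intro allI impI)
  fix u H ks
  assume H: "\<forall>ks. sum_list (map wt ks) + u \<le> W \<longrightarrow> unif_bdd T (\<lambda>N n. E N n (\<lambda>s. H N n s * (\<Prod>k\<leftarrow>ks. v N n k s)))"
    and "sum_list (map wt ks) + (u + wt j) \<le> W"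
  then have "unif_bdd T (\<lambda>N n. E N n (\<lambda>s. H N n s * (\<Prod>k\<leftarrow>j # ks. v N n k s)))" by (intro H[rule_format]) simp
  then show "unif_bdd T (\<lambda>N n. E N n (\<lambda>s. v N n j s * H N n s * (\<Prod>k\<leftarrow>ks. v N n k s)))"
    by (simp add: mult_ac)
qed

lemma mlt_add:
  assumes "mlt W w F" "mlt W w G"
  shows "mlt W w (\<lambda>N n s. F N n s + G N n s)"
  unfolding mlt_def tst_def
proof (intro allI impI)
  fix u H ks
  assume H: "\<forall>ks. sum_list (map wt ks) + u \<le> W \<longrightarrow> unif_bdd T (\<lambda>N n. E N n (\<lambda>s. H N n s * (\<Prod>k\<leftarrow>ks. v N n k s)))"
    and ks: "sum_list (map wt ks) + (u + w) \<le> W"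
  have "tst W u H" using H by (simp add: tst_def)
  then have "tst W (u + w) (\<lambda>N n s. F N n s * H N n s)" "tst W (u + w) (\<lambda>N n s. G N n s * H N n s)"
    using assms by (auto simp: mlt_def)
  then have "unif_bdd T (\<lambda>N n. E N n (\<lambda>s. F N n s * H N n s * (\<Prod>k\<leftarrow>ks. v N n k s)) +
      E N n (\<lambda>s. G N n s * H N n s * (\<Prod>k\<leftarrow>ks. v N n k s)))"
    using ks by (intro Bdd_add) (auto simp: tst_def)
  then show "unif_bdd T (\<lambda>N n. E N n (\<lambda>s. (F N n s + G N n s) * H N n s * (\<Prod>k\<leftarrow>ks. v N n k s)))"
    by (simp add: distrib_right E_add)
qed

lemma mlt_mult:
  assumes "mlt W w F" "mlt W w' G"
  shows "mlt W (w + w') (\<lambda>N n s. F N n s * G N n s)"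
  unfolding mlt_def
proof (intro allI impI)
  fix u H assume "tst W u H"
  then have "tst W (u + w') (\<lambda>N n s. G N n s * H N n s)" using assms(2) by (auto simp: mlt_def)
  then have "tst W (u + w' + w) (\<lambda>N n s. F N n s * (G N n s * H N n s))"
    using assms(1) unfolding mlt_def by blast
  then show "tst W (u + (w + w')) (\<lambda>N n s. F N n s * G N n s * H N n s)"
    by (simp add: ac_simps)
qed

lemma mlt_zero: "mlt W w (\<lambda>N n s. 0)"
  by (rule mlt_mono[OF mlt_const]) simp_all

lemma mlt_sum: "(\<And>a. a \<in> A \<Longrightarrow> mlt W w (F a)) \<Longrightarrow> mlt W w (\<lambda>N n s. \<Sum>a\<in>A. F a N n s)"
  by (induction A rule: infinite_finite_induct) (auto intro: mlt_zero mlt_add)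

lemma mlt_scale: "unif_bdd T f \<Longrightarrow> mlt W w F \<Longrightarrow> mlt W w (\<lambda>N n s. f N n * F N n s)"
  using mlt_mult[OF mlt_const, of f W w F] by simp

lemma mlt_power: "mlt W w F \<Longrightarrow> mlt W (b * w) (\<lambda>N n s. F N n s ^ b)"
proof (induction b)
  case 0
  then show ?case using mlt_const[OF Bdd_const, of W 1] by simp
next
  case (Suc b)
  then show ?case using mlt_mult[of W w F "b * w" "\<lambda>N n s. F N n s ^ b"] by simp
qed

lemma mlt_bounded:
  assumes "tst W 0 (\<lambda>N n s. 1)" "mlt W w F" "sum_list (map wt ks) + w \<le> W"
  shows "unif_bdd T (\<lambda>N n. E N n (\<lambda>s. F N n s * (\<Prod>k\<leftarrow>ks. v N n k s)))"
proof -
  have "tst W (0 + w) (\<lambda>N n s. F N n s * 1)" using assms(1,2) unfolding mlt_def by blast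
  then show ?thesis using assms(3) by (simp add: tst_def)
qed

end

section \<open>Centred power sums and the joint law of signature and moving particle\<close>

text \<open>Centred by the mean at the same time n. The power sum has size N^(k+1), but its
  fluctuations are smaller by one power of N, hence the scale N^k.\<close>

definition fluct :: "nat \<Rightarrow> nat \<Rightarrow> nat \<Rightarrow> int list \<Rightarrow> real" where
  "fluct N n k l = (pk N k l - EE N n (pk N k)) / real N ^ k"

abbreviation fluct_prod :: "nat \<Rightarrow> nat \<Rightarrow> nat list \<Rightarrow> int list \<Rightarrow> real" where
  "fluct_prod N n ks l \<equiv> (\<Prod>k\<leftarrow>ks. fluct N n k l)"

definition mean_pk :: "nat \<Rightarrow> nat \<Rightarrow> nat \<Rightarrow> real" where
  "mean_pk k N n = EE N n (pk N k) / real N ^ Suc k"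

text \<open>For m >= 1 the moment of order m - 1 of the rescaled position of the moving particle;
  the index is shifted by one to match the Newton recursion.\<close>

definition rho_N :: "nat \<Rightarrow> nat \<Rightarrow> int list \<Rightarrow> real" where
  "rho_N N m l = shift_moment N l m / real N ^ m"

text \<open>The expectation over the signature at time n and the index of the particle that moves
  next.\<close>

definition EJ :: "nat \<Rightarrow> nat \<Rightarrow> (int list \<times> nat \<Rightarrow> real) \<Rightarrow> real" where
  "EJ N n g = EE N n (\<lambda>l. \<Sum>i<N. wgt N l i * g (l, i))"

lemma EE_const: "N \<ge> 1 \<Longrightarrow> EE N n (\<lambda>l. a) = a"
proof (induction n)
  case (Suc n)
  have "EE N (Suc n) (\<lambda>l. a) = EE N n (\<lambda>l. a)"
    unfolding EE.simps using Suc.prems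
    by (intro EE_cong) (simp add: sum_distrib_right[symmetric] sum_wgt)
  then show ?case using Suc by simp
qed simp

lemma EE_fluct: "N \<ge> 1 \<Longrightarrow> EE N n (fluct N n k) = 0"
  using EE_cmult[of N n "1 / real N ^ k" "\<lambda>l. pk N k l - EE N n (pk N k)"]
  by (simp add: fluct_def[abs_def] EE_diff EE_const)

lemma fluct_0: "N \<ge> 1 \<Longrightarrow> fluct N n 0 l = 0"
  by (simp add: fluct_def pk_pos[abs_def] EE_const)

lemma EJ_cong:
  assumes "\<And>s. s \<in> {(l, i). l \<in> GT N} \<Longrightarrow> F s = G s"
  shows "EJ N n F = EJ N n G"
  unfolding EJ_def using assms by (intro EE_cong sum.cong) auto

lemma EJ_add: "EJ N n (\<lambda>s. F s + G s) = EJ N n F + EJ N n G"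
  by (simp add: EJ_def distrib_left sum.distrib EE_add)

lemma EJ_cmult: "EJ N n (\<lambda>s. c * F s) = c * EJ N n F"
  by (simp add: EJ_def EE_cmult sum_distrib_left mult.left_commute flip: EE_cmult)

lemma EJ_sum: "EJ N n (\<lambda>s. \<Sum>a\<in>A. F a s) = (\<Sum>a\<in>A. EJ N n (F a))"
proof -
  have "(\<lambda>l. \<Sum>i<N. wgt N l i * (\<Sum>a\<in>A. F a (l, i))) = (\<lambda>l. \<Sum>a\<in>A. \<Sum>i<N. wgt N l i * F a (l, i))"
    by (simp add: sum_distrib_left sum.swap[of _ A])
  then show ?thesis by (simp add: EJ_def EE_sum)
qed

lemma EJ_function_of_list:
  assumes "N \<ge> 1"
  shows "EJ N n (\<lambda>(l, i). F l) = EE N n F"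
  unfolding EJ_def using assms by (intro EE_cong) (simp add: sum_distrib_right[symmetric] sum_wgt)

lemma sum_wgt_pos_power:
  assumes "N \<ge> 1"
  shows "(\<Sum>i<N. wgt N l i * (pos N l i / real N) ^ b) = rho_N N (Suc b) l"
  using assms by (simp add: rho_N_def shift_moment_def power_divide sum_divide_distrib)

text \<open>The generators of the site class: index \<open>0\<close> is free for the rescaled position of the
  moving particle because \<open>fluct N n 0 = 0\<close>.\<close>

definition site_gen :: "nat \<Rightarrow> nat \<Rightarrow> nat \<Rightarrow> int list \<times> nat \<Rightarrow> real" where
  "site_gen N n k s = (if k = 0 then pos N (fst s) (snd s) / real N else fluct N n k (fst s))"

text \<open>The equations that the limits must solve, which keeps the probabilistic argument
  independent of their explicit solution. \<open>rho_Newton\<close> is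
  \<open>shift_moment_Newton\<close> at leading order in N. The drift sums start at 1 because the
  zeroth power sum does not fluctuate, and the last term is k l times a covariance under the limit
  law of the moving particle.\<close>

locale fluctuation_limit =
  fixes T :: real
    and x rho :: "nat \<Rightarrow> real \<Rightarrow> real"
    and C :: "nat \<Rightarrow> nat \<Rightarrow> real \<Rightarrow> real"
  assumes T_pos: "T > 0"
    and rho_0: "rho 0 t = 1"
    and rho_Newton: "real m * rho m t = (\<Sum>a<m. real (Suc a) * x a t * rho (m - Suc a) t)"
    and x_deriv: "(x k has_real_derivative real k * rho k t) (at t)"
    and x_init: "x k 0 = 1 / real (Suc k)"
    and C_deriv: "k \<ge> 1 \<Longrightarrow> l \<ge> 1 \<Longrightarrow> (C k l has_real_derivative
        (\<Sum>j\<in>{1..<k}. real k * rho (k - 1 - j) t * C j l t) +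
        (\<Sum>j\<in>{1..<l}. real l * rho (l - 1 - j) t * C k j t) +
        real k * real l * (rho (k + l - 1) t - rho k t * rho l t)) (at t)"
    and C_init: "k \<ge> 1 \<Longrightarrow> l \<ge> 1 \<Longrightarrow> C k l 0 = 0"
begin

sublocale P: multiplier_class T EE fluct "\<lambda>k. k" GT
  by unfold_locales (auto intro: EE_cong simp: EE_add EE_cmult)

sublocale M: multiplier_class T EJ site_gen "max 1" "\<lambda>N. {(l, i). l \<in> GT N}"
  by unfold_locales (auto intro: EJ_cong simp: EJ_add EJ_cmult)

text \<open>First-order expansion in \<open>1/N\<close>: \<open>\<phi>\<^sub>0\<close> and \<open>\<phi> j\<close> are the limits of the leading coefficient and of the
  coefficient of the \<open>j\<close>-th fluctuation.\<close>

definition expn :: "nat \<Rightarrow> nat \<Rightarrow> (nat \<Rightarrow> nat \<Rightarrow> int list \<Rightarrow> real) \<Rightarrow> (real \<Rightarrow> real) \<Rightarrow> (nat \<Rightarrow> real \<Rightarrow> real) \<Rightarrow> bool" where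
  "expn W w F \<phi>\<^sub>0 \<phi> \<longleftrightarrow> (\<exists>f\<^sub>0 f Z. unif_conv T f\<^sub>0 \<phi>\<^sub>0 \<and> (\<forall>j. unif_conv T (f j) (\<phi> j)) \<and> (\<forall>j N n. j > w \<longrightarrow> f j N n = 0) \<and>
     P.mlt W w Z \<and> (\<forall>N n l. N \<ge> 1 \<longrightarrow> l \<in> GT N \<longrightarrow>
       F N n l = f\<^sub>0 N n + (\<Sum>j\<le>w. f j N n * fluct N n j l) / real N + Z N n l / (real N)\<^sup>2))"

lemma expnI:
  assumes "unif_conv T f\<^sub>0 \<phi>\<^sub>0" "\<And>j. unif_conv T (f j) (\<phi> j)" "\<And>j N n. j > w \<Longrightarrow> f j N n = 0" "P.mlt W w Z"
    "\<And>N n l. N \<ge> 1 \<Longrightarrow> l \<in> GT N \<Longrightarrow> F N n l = f\<^sub>0 N n + (\<Sum>j\<le>w. f j N n * fluct N n j l) / real N + Z N n l / (real N)\<^sup>2"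
  shows "expn W w F \<phi>\<^sub>0 \<phi>"
  unfolding expn_def using assms by (intro exI[of _ f\<^sub>0] exI[of _ f] exI[of _ Z]) auto

lemma expnE:
  assumes "expn W w F \<phi>\<^sub>0 \<phi>"
  obtains f\<^sub>0 f Z where "unif_conv T f\<^sub>0 \<phi>\<^sub>0" "\<And>j. unif_conv T (f j) (\<phi> j)" "\<And>j N n. j > w \<Longrightarrow> f j N n = 0" "P.mlt W w Z"
    "\<And>N n l. N \<ge> 1 \<Longrightarrow> l \<in> GT N \<Longrightarrow> F N n l = f\<^sub>0 N n + (\<Sum>j\<le>w. f j N n * fluct N n j l) / real N + Z N n l / (real N)\<^sup>2"
  using assms unfolding expn_def by blast

lemma expn_const: "unif_conv T f \<phi> \<Longrightarrow> expn W 0 (\<lambda>N n l. f N n) \<phi> (\<lambda>j t. 0)"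
  by (rule expnI[of f _ "\<lambda>j N n. 0" _ _ _ "\<lambda>N n l. 0"]) (auto intro: conv_const P.mlt_zero)

lemma expn_mono:
  assumes "expn W w F \<phi>\<^sub>0 \<phi>" "w \<le> w'"
  shows "expn W w' F \<phi>\<^sub>0 \<phi>"
proof -
  obtain f\<^sub>0 f Z where *: "unif_conv T f\<^sub>0 \<phi>\<^sub>0" "\<And>j. unif_conv T (f j) (\<phi> j)" "\<And>j N n. j > w \<Longrightarrow> f j N n = 0" "P.mlt W w Z"
    "\<And>N n l. N \<ge> 1 \<Longrightarrow> l \<in> GT N \<Longrightarrow> F N n l = f\<^sub>0 N n + (\<Sum>j\<le>w. f j N n * fluct N n j l) / real N + Z N n l / (real N)\<^sup>2"
    using assms(1) by (rule expnE) blast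
  have "(\<Sum>j\<le>w'. f j N n * fluct N n j l) = (\<Sum>j\<le>w. f j N n * fluct N n j l)" for N n l
    using assms(2) *(3) by (intro sum.mono_neutral_right) auto
  then show ?thesis
    using * assms(2) by (intro expnI[of f\<^sub>0 _ f _ _ _ Z]) (auto intro: P.mlt_mono)
qed

lemma expn_limit_cong:
  assumes "expn W w F \<phi>\<^sub>0 \<phi>" "\<And>t. \<phi>\<^sub>0 t = \<psi>\<^sub>0 t" "\<And>j t. \<phi> j t = \<psi> j t"
  shows "expn W w F \<psi>\<^sub>0 \<psi>"
proof -
  have "\<phi>\<^sub>0 = \<psi>\<^sub>0" "\<phi> = \<psi>" using assms(2,3) by (auto intro!: ext)
  then show ?thesis using assms(1) by simp
qed

lemma expn_cong:
  assumes "expn W w F \<phi>\<^sub>0 \<phi>" "\<And>N n l. N \<ge> 1 \<Longrightarrow> l \<in> GT N \<Longrightarrow> F N n l = G N n l"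
  shows "expn W w G \<phi>\<^sub>0 \<phi>"
  using assms(1)
proof (rule expnE)
  fix f\<^sub>0 f Z assume "unif_conv T f\<^sub>0 \<phi>\<^sub>0" "\<And>j. unif_conv T (f j) (\<phi> j)" "\<And>j N n. j > w \<Longrightarrow> f j N n = 0" "P.mlt W w Z"
    "\<And>N n l. N \<ge> 1 \<Longrightarrow> l \<in> GT N \<Longrightarrow> F N n l = f\<^sub>0 N n + (\<Sum>j\<le>w. f j N n * fluct N n j l) / real N + Z N n l / (real N)\<^sup>2"
  then show ?thesis using assms(2) by (intro expnI[of f\<^sub>0 _ f _ _ _ Z]) auto
qed

lemma expn_add:
  assumes "expn W w F \<phi>\<^sub>0 \<phi>" "expn W w G \<psi>\<^sub>0 \<psi>"
  shows "expn W w (\<lambda>N n l. F N n l + G N n l) (\<lambda>t. \<phi>\<^sub>0 t + \<psi>\<^sub>0 t) (\<lambda>j t. \<phi> j t + \<psi> j t)"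
proof -
  obtain f\<^sub>0 f Z where f: "unif_conv T f\<^sub>0 \<phi>\<^sub>0" "\<And>j. unif_conv T (f j) (\<phi> j)" "\<And>j N n. j > w \<Longrightarrow> f j N n = 0" "P.mlt W w Z"
    "\<And>N n l. N \<ge> 1 \<Longrightarrow> l \<in> GT N \<Longrightarrow> F N n l = f\<^sub>0 N n + (\<Sum>j\<le>w. f j N n * fluct N n j l) / real N + Z N n l / (real N)\<^sup>2"
    using assms(1) by (rule expnE) blast
  obtain g\<^sub>0 g X where g: "unif_conv T g\<^sub>0 \<psi>\<^sub>0" "\<And>j. unif_conv T (g j) (\<psi> j)" "\<And>j N n. j > w \<Longrightarrow> g j N n = 0" "P.mlt W w X"
    "\<And>N n l. N \<ge> 1 \<Longrightarrow> l \<in> GT N \<Longrightarrow> G N n l = g\<^sub>0 N n + (\<Sum>j\<le>w. g j N n * fluct N n j l) / real N + X N n l / (real N)\<^sup>2"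
    using assms(2) by (rule expnE) blast
  show ?thesis
  proof (rule expnI[of "\<lambda>N n. f\<^sub>0 N n + g\<^sub>0 N n" _ "\<lambda>j N n. f j N n + g j N n" _ _ _ "\<lambda>N n l. Z N n l + X N n l"])
    fix N n l assume "(1::nat) \<le> N" "l \<in> GT N"
    then show "F N n l + G N n l = f\<^sub>0 N n + g\<^sub>0 N n + (\<Sum>j\<le>w. (f j N n + g j N n) * fluct N n j l) / real N + (Z N n l + X N n l) / (real N)\<^sup>2"
      by (simp add: f(5) g(5) distrib_right sum.distrib add_divide_distrib)
  qed (auto intro!: conv_add P.mlt_add f g simp: f(3) g(3))
qed

lemma linear_part_mlt:
  assumes "\<And>j. unif_conv T (f j) (\<phi> j)"
  shows "P.mlt W w (\<lambda>N n l. \<Sum>j\<le>w. f j N n * fluct N n j l)"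
  by (intro P.mlt_sum P.mlt_scale conv_Bdd[OF assms] P.mlt_mono[OF P.mlt_generator]) auto

text \<open>The linear coefficients follow the product rule. The product of the two linear parts is
  of order 1/N^2 and has weight w + w', so it belongs to the remainder.\<close>

lemma expn_mult:
  assumes "expn W w F \<phi>\<^sub>0 \<phi>" "expn W w' G \<psi>\<^sub>0 \<psi>"
  shows "expn W (w + w') (\<lambda>N n l. F N n l * G N n l) (\<lambda>t. \<phi>\<^sub>0 t * \<psi>\<^sub>0 t) (\<lambda>j t. \<phi>\<^sub>0 t * \<psi> j t + \<psi>\<^sub>0 t * \<phi> j t)"
proof -
  obtain f\<^sub>0 f Z where f: "unif_conv T f\<^sub>0 \<phi>\<^sub>0" "\<And>j. unif_conv T (f j) (\<phi> j)" "\<And>j N n. j > w \<Longrightarrow> f j N n = 0" "P.mlt W w Z"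
    "\<And>N n l. N \<ge> 1 \<Longrightarrow> l \<in> GT N \<Longrightarrow> F N n l = f\<^sub>0 N n + (\<Sum>j\<le>w. f j N n * fluct N n j l) / real N + Z N n l / (real N)\<^sup>2"
    using assms(1) by (rule expnE) blast
  obtain g\<^sub>0 g X where g: "unif_conv T g\<^sub>0 \<psi>\<^sub>0" "\<And>j. unif_conv T (g j) (\<psi> j)" "\<And>j N n. j > w' \<Longrightarrow> g j N n = 0" "P.mlt W w' X"
    "\<And>N n l. N \<ge> 1 \<Longrightarrow> l \<in> GT N \<Longrightarrow> G N n l = g\<^sub>0 N n + (\<Sum>j\<le>w'. g j N n * fluct N n j l) / real N + X N n l / (real N)\<^sup>2"
    using assms(2) by (rule expnE) blast
  let ?L = "\<lambda>N n l. \<Sum>j\<le>w. f j N n * fluct N n j l" and ?K = "\<lambda>N n l. \<Sum>j\<le>w'. g j N n * fluct N n j l"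
  have L: "P.mlt W w ?L" "P.mlt W w' ?K" by (rule linear_part_mlt[OF f(2)], rule linear_part_mlt[OF g(2)])
  let ?R = "\<lambda>N n l. f\<^sub>0 N n * X N n l + (g\<^sub>0 N n * Z N n l + (?L N n l * ?K N n l +
     (1 / real N ^ 1 * (?L N n l * X N n l) + (1 / real N ^ 1 * (Z N n l * ?K N n l) + 1 / real N ^ 2 * (Z N n l * X N n l)))))"
  show ?thesis
  proof (rule expnI[of "\<lambda>N n. f\<^sub>0 N n * g\<^sub>0 N n" _ "\<lambda>j N n. f\<^sub>0 N n * g j N n + g\<^sub>0 N n * f j N n" _ _ _ ?R])
    show "P.mlt W (w + w') ?R"
      by (intro P.mlt_add P.mlt_scale P.mlt_mult Bdd_inverse_N conv_Bdd[OF f(1)] conv_Bdd[OF g(1)] f(4) g(4) L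
          P.mlt_mono[OF f(4)] P.mlt_mono[OF g(4)]) auto
    fix N n l assume N: "(1::nat) \<le> N" "l \<in> GT N"
    have L': "(\<Sum>j\<le>w + w'. f j N n * fluct N n j l) = ?L N n l" "(\<Sum>j\<le>w + w'. g j N n * fluct N n j l) = ?K N n l"
      by (rule sum.mono_neutral_right; auto simp: f(3) g(3))+
    have "(\<Sum>j\<le>w + w'. (f\<^sub>0 N n * g j N n + g\<^sub>0 N n * f j N n) * fluct N n j l) = f\<^sub>0 N n * ?K N n l + g\<^sub>0 N n * ?L N n l"
      unfolding L'[symmetric] by (simp add: distrib_right sum.distrib sum_distrib_left mult.assoc)
    moreover have "real N > 0" using N by simp
    ultimately show "F N n l * G N n l = f\<^sub>0 N n * g\<^sub>0 N n + (\<Sum>j\<le>w + w'. (f\<^sub>0 N n * g j N n + g\<^sub>0 N n * f j N n) * fluct N n j l) / real N + ?R N n l / (real N)\<^sup>2"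
      unfolding f(5)[OF N] g(5)[OF N] by (simp add: field_simps power2_eq_square)
  qed (auto intro!: conv_add conv_mult f g simp: f(3) g(3))
qed

lemma expn_sum:
  assumes "\<And>a. a \<in> A \<Longrightarrow> expn W w (F a) (\<phi>\<^sub>0 a) (\<phi> a)"
  shows "expn W w (\<lambda>N n l. \<Sum>a\<in>A. F a N n l) (\<lambda>t. \<Sum>a\<in>A. \<phi>\<^sub>0 a t) (\<lambda>j t. \<Sum>a\<in>A. \<phi> a j t)"
proof -
  have z: "expn W w (\<lambda>N n l. 0) (\<lambda>t. 0) (\<lambda>j t. 0)"
    by (rule expn_mono[OF expn_const[OF conv_const]]) simp
  show ?thesis
    using assms
  proof (induction A rule: infinite_finite_induct)
    case (insert a A)
    then have "expn W w (\<lambda>N n l. F a N n l + (\<Sum>a\<in>A. F a N n l)) (\<lambda>t. \<phi>\<^sub>0 a t + (\<Sum>a\<in>A. \<phi>\<^sub>0 a t)) (\<lambda>j t. \<phi> a j t + (\<Sum>a\<in>A. \<phi> a j t))"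
      by (intro expn_add) auto
    then show ?case using insert.hyps by simp
  qed (use z in simp_all)
qed

lemma expn_scale:
  assumes "unif_conv T f \<phi>" "expn W w G \<psi>\<^sub>0 \<psi>"
  shows "expn W w (\<lambda>N n l. f N n * G N n l) (\<lambda>t. \<phi> t * \<psi>\<^sub>0 t) (\<lambda>j t. \<phi> t * \<psi> j t)"
  by (rule expn_limit_cong[OF expn_mult[OF expn_const[OF assms(1)] assms(2), unfolded add_0]]) auto

lemma expn_mlt:
  assumes "expn W w F \<phi>\<^sub>0 \<phi>"
  shows "P.mlt W w F"
proof -
  obtain f\<^sub>0 f Z where f: "unif_conv T f\<^sub>0 \<phi>\<^sub>0" "\<And>j. unif_conv T (f j) (\<phi> j)" "P.mlt W w Z"
    "\<And>N n l. N \<ge> 1 \<Longrightarrow> l \<in> GT N \<Longrightarrow> F N n l = f\<^sub>0 N n + (\<Sum>j\<le>w. f j N n * fluct N n j l) / real N + Z N n l / (real N)\<^sup>2"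
    using assms by (rule expnE) blast
  have "P.mlt W w (\<lambda>N n l. f\<^sub>0 N n + (1 / real N ^ 1 * (\<Sum>j\<le>w. f j N n * fluct N n j l) + 1 / real N ^ 2 * Z N n l))"
    by (intro P.mlt_add P.mlt_scale Bdd_inverse_N linear_part_mlt[OF f(2)] f(3) P.mlt_mono[OF P.mlt_const[OF conv_Bdd[OF f(1)]]]) auto
  then show ?thesis by (rule P.mlt_cong) (simp add: f(4))
qed

end

lemma conv_const_div_pow: "unif_conv T (\<lambda>N n. a / real N ^ p) (\<lambda>t. if p = 0 then a else 0)"
  by (rule conv_cong[OF conv_cmult[OF conv_inverse_N_pow[of T p], of a]]) auto

section \<open>Expansions of the moving-particle moments in the fluctuations\<close>

context fluctuation_limit
begin

definition means_conv :: "nat \<Rightarrow> bool" where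
  "means_conv W \<longleftrightarrow> (\<forall>k\<le>W. unif_conv T (mean_pk k) (x k))"

definition moments_conv :: "nat \<Rightarrow> bool" where
  "moments_conv W \<longleftrightarrow> (\<forall>ks. (\<forall>k\<in>set ks. 1 \<le> k) \<longrightarrow> sum_list ks \<le> W \<longrightarrow>
     unif_conv T (\<lambda>N n. EE N n (fluct_prod N n ks)) (\<lambda>t. wickr (\<lambda>k l. C k l t) ks))"

text \<open>Starts the multiplier calculus: bounds come from the convergent moments of positive
  orders, and a list containing 0 contributes nothing because the zeroth fluctuation
  vanishes.\<close>

lemma P_test_one:
  assumes "moments_conv W"
  shows "P.tst W 0 (\<lambda>N n l. 1)"
  unfolding P.tst_def
proof (intro allI impI)
  fix ks :: "nat list" assume ks: "sum_list (map (\<lambda>k. k) ks) + 0 \<le> W"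
  show "unif_bdd T (\<lambda>N n. EE N n (\<lambda>l. 1 * fluct_prod N n ks l))"
  proof (cases "0 \<in> set ks")
    case True
    have "fluct_prod N n ks l = 0" if "N \<ge> 1" for N n l
      using True fluct_0[OF that, of n l] by (auto simp: prod_list_zero_iff)
    then have "EE N n (\<lambda>l. 1 * fluct_prod N n ks l) = 0" if "N \<ge> 1" for N n
      using that EE_0 by simp
    then show ?thesis by (intro Bdd_I[of _ 0]) simp
  next
    case False
    then have "\<forall>k\<in>set ks. 1 \<le> k" by (metis less_one not_le)
    then show ?thesis using assms ks conv_Bdd by (auto simp: moments_conv_def)
  qed
qed

lemma expn_moment:
  assumes "means_conv W" "k \<le> W"
  shows "expn W k (\<lambda>N n l. pk N k l / real N ^ Suc k) (x k) (\<lambda>j t. if j = k then 1 else 0)"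
proof (rule expnI[of "mean_pk k" _ "\<lambda>j N n. if j = k then 1 else 0" _ _ _ "\<lambda>N n l. 0"])
  show "unif_conv T (mean_pk k) (x k)" using assms by (simp add: means_conv_def)
  fix j show "unif_conv T (\<lambda>N n. if j = k then 1 else 0) (\<lambda>t. if j = k then 1 else 0)"
    by (rule conv_const)
  fix N n l assume N: "(1::nat) \<le> N"
  have "(\<Sum>j\<le>k. (if j = k then 1 else 0) * fluct N n j l) = fluct N n k l"
    by (simp add: if_distrib[of "\<lambda>a. a * _"] cong: if_cong)
  moreover have "pk N k l / real N ^ Suc k = mean_pk k N n + fluct N n k l / real N"
    using N by (simp add: mean_pk_def fluct_def field_simps)
  ultimately show "pk N k l / real N ^ Suc k = mean_pk k N n +
      (\<Sum>j\<le>k. (if j = k then 1 else 0) * fluct N n j l) / real N + 0 / (real N)\<^sup>2"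
    by simp
qed (auto intro: P.mlt_zero)

text \<open>Under the normalisation N^(m+1) the power sum p_b is suppressed by N^(m-b), so only b =
  m survives in the limit, with the binomial coefficient m + 1.\<close>

lemma expn_shift_sum:
  assumes "means_conv W" "m \<le> W"
  shows "expn W m (\<lambda>N n l. shift_sum N l (Suc m) / real N ^ Suc m) (\<lambda>t. real (Suc m) * x m t)
           (\<lambda>j t. if j = m then real (Suc m) else 0)"
proof -
  have "expn W m (\<lambda>N n l. \<Sum>b\<in>{..m}. (real (Suc m choose b) * (- 1) ^ (m - b)) / real N ^ (m - b) * (pk N b l / real N ^ Suc b))
     (\<lambda>t. \<Sum>b\<in>{..m}. (if m - b = 0 then real (Suc m choose b) * (- 1) ^ (m - b) else 0) * x b t)
     (\<lambda>j t. \<Sum>b\<in>{..m}. (if m - b = 0 then real (Suc m choose b) * (- 1) ^ (m - b) else 0) * (if j = b then 1 else 0))"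
  proof (intro expn_sum expn_scale)
    fix b assume "b \<in> {..m}"
    then show "expn W m (\<lambda>N n l. pk N b l / real N ^ Suc b) (x b) (\<lambda>j t. if j = b then 1 else 0)"
      using assms by (intro expn_mono[OF expn_moment]) auto
  qed (rule conv_const_div_pow)
  then have e1: "expn W m (\<lambda>N n l. shift_sum N l (Suc m) / real N ^ Suc m)
     (\<lambda>t. \<Sum>b\<in>{..m}. (if m - b = 0 then real (Suc m choose b) * (- 1) ^ (m - b) else 0) * x b t)
     (\<lambda>j t. \<Sum>b\<in>{..m}. (if m - b = 0 then real (Suc m choose b) * (- 1) ^ (m - b) else 0) * (if j = b then 1 else 0))"
  proof (rule expn_cong)
    fix N n l assume N: "(1::nat) \<le> N"
    have "(real (Suc m choose b) * (- 1) ^ (m - b)) / real N ^ (m - b) * (pk N b l / real N ^ Suc b)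
       = real (Suc m choose b) * (- 1) ^ (m - b) * pk N b l / real N ^ Suc m" if "b \<le> m" for b
    proof -
      have "real N ^ Suc m = real N ^ (m - b) * real N ^ Suc b"
        using that by (subst power_add[symmetric]) simp
      then show ?thesis by (simp only: times_divide_times_eq)
    qed
    then show "(\<Sum>b\<in>{..m}. (real (Suc m choose b) * (- 1) ^ (m - b)) / real N ^ (m - b) * (pk N b l / real N ^ Suc b)) =
       shift_sum N l (Suc m) / real N ^ Suc m"
      unfolding shift_sum_pk sum_divide_distrib by (intro sum.cong) auto
  qed
  have e2: "(\<Sum>b\<in>{..m}. (if m - b = 0 then real (Suc m choose b) * (- 1) ^ (m - b) else 0) * z b) = real (Suc m) * z m" for z
  proof -
    have "(\<Sum>b\<in>{..m}. (if m - b = 0 then real (Suc m choose b) * (- 1) ^ (m - b) else 0) * z b) =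
       (\<Sum>b\<in>{..m}. if b = m then real (Suc m) * z m else 0)"
      by (rule sum.cong) auto
    then show ?thesis by simp
  qed
  show ?thesis
  proof (rule expn_limit_cong[OF e1])
    show "(\<Sum>b\<in>{..m}. (if m - b = 0 then real (Suc m choose b) * (- 1) ^ (m - b) else 0) * x b t) = real (Suc m) * x m t" for t
      by (rule e2)
    show "(\<Sum>b\<in>{..m}. (if m - b = 0 then real (Suc m choose b) * (- 1) ^ (m - b) else 0) * (if j = b then 1 else 0)) =
        (if j = m then real (Suc m) else 0)" for j
      unfolding e2 by simp
  qed
qed

text \<open>The Newton recursion says that the series of the rho_m is the exponential of the sum of
  x_a z^(a+1). Differentiating in x_j multiplies it by z^(j+1), so the linear coefficient is
  rho_(m-1-j); the proof verifies this through the recursion.\<close>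

lemma expn_rho:
  assumes "means_conv W" "m \<le> Suc W"
  shows "expn W (m - 1) (\<lambda>N n l. rho_N N m l) (rho m) (\<lambda>j t. if j < m then rho (m - 1 - j) t else 0)"
  using assms(2)
proof (induction m rule: less_induct)
  case (less m)
  show ?case
  proof (cases "m = 0")
    case True
    have "expn W 0 (\<lambda>N n l. 1) (\<lambda>t. 1) (\<lambda>j t. 0)" by (rule expn_const[OF conv_const])
    then show ?thesis using True
      by (auto intro!: expn_limit_cong[OF expn_cong] simp: rho_N_def shift_moment_def rho_0)
  next
    case False
    let ?P = "\<lambda>a j t. if j < m - Suc a then rho (m - Suc a - 1 - j) t else 0"
    have "expn W (m - 1) (\<lambda>N n l. 1 / real m * (\<Sum>a\<in>{..<m}. (shift_sum N l (Suc a) / real N ^ Suc a) * rho_N N (m - Suc a) l))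
      (\<lambda>t. 1 / real m * (\<Sum>a\<in>{..<m}. real (Suc a) * x a t * rho (m - Suc a) t))
      (\<lambda>j t. 1 / real m * (\<Sum>a\<in>{..<m}. real (Suc a) * x a t * ?P a j t +
         rho (m - Suc a) t * (if j = a then real (Suc a) else 0)))"
    proof (intro expn_scale[OF conv_const] expn_sum)
      fix a assume a: "a \<in> {..<m}"
      have "expn W (a + (m - Suc a - 1)) (\<lambda>N n l. shift_sum N l (Suc a) / real N ^ Suc a * rho_N N (m - Suc a) l)
         (\<lambda>t. real (Suc a) * x a t * rho (m - Suc a) t)
         (\<lambda>j t. real (Suc a) * x a t * ?P a j t + rho (m - Suc a) t * (if j = a then real (Suc a) else 0))"
        using a less.prems by (intro expn_mult expn_shift_sum[OF assms(1)] less.IH) auto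
      then show "expn W (m - 1) (\<lambda>N n l. shift_sum N l (Suc a) / real N ^ Suc a * rho_N N (m - Suc a) l)
         (\<lambda>t. real (Suc a) * x a t * rho (m - Suc a) t)
         (\<lambda>j t. real (Suc a) * x a t * ?P a j t + rho (m - Suc a) t * (if j = a then real (Suc a) else 0))"
        by (rule expn_mono) (use a in auto)
    qed
    then have "expn W (m - 1) (\<lambda>N n l. rho_N N m l)
      (\<lambda>t. 1 / real m * (\<Sum>a\<in>{..<m}. real (Suc a) * x a t * rho (m - Suc a) t))
      (\<lambda>j t. 1 / real m * (\<Sum>a\<in>{..<m}. real (Suc a) * x a t * ?P a j t +
         rho (m - Suc a) t * (if j = a then real (Suc a) else 0)))"
    proof (rule expn_cong)
      fix N n l assume N: "(1::nat) \<le> N" "l \<in> GT N"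
      have "(shift_sum N l (Suc a) / real N ^ Suc a) * rho_N N (m - Suc a) l = shift_sum N l (Suc a) * shift_moment N l (m - Suc a) / real N ^ m"
        if "a < m" for a
      proof -
        have "real N ^ m = real N ^ Suc a * real N ^ (m - Suc a)" using that by (subst power_add[symmetric]) simp
        then show ?thesis by (simp only: rho_N_def times_divide_times_eq)
      qed
      then have "(\<Sum>a\<in>{..<m}. (shift_sum N l (Suc a) / real N ^ Suc a) * rho_N N (m - Suc a) l) =
          (\<Sum>a<m. shift_sum N l (Suc a) * shift_moment N l (m - Suc a)) / real N ^ m"
        unfolding sum_divide_distrib by (intro sum.cong) auto
      also have "\<dots> = real m * rho_N N m l"
        unfolding shift_moment_Newton[OF N(2,1), symmetric] by (simp add: rho_N_def)
      finally show "1 / real m * (\<Sum>a\<in>{..<m}. (shift_sum N l (Suc a) / real N ^ Suc a) * rho_N N (m - Suc a) l) = rho_N N m l"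
        using False by simp
    qed
    then show ?thesis
    proof (rule expn_limit_cong)
      fix t
      show "1 / real m * (\<Sum>a\<in>{..<m}. real (Suc a) * x a t * rho (m - Suc a) t) = rho m t"
        unfolding rho_Newton[symmetric] using False by simp
    next
      fix j t
      have 1: "(\<Sum>a\<in>{..<m}. real (Suc a) * x a t * ?P a j t) = real (m - 1 - j) * rho (m - 1 - j) t" if "j < m"
      proof -
        have "(\<Sum>a\<in>{..<m}. real (Suc a) * x a t * ?P a j t) =
           (\<Sum>a\<in>{..<m - 1 - j}. real (Suc a) * x a t * rho (m - 1 - j - Suc a) t)"
          using that by (intro sum.mono_neutral_cong_right) (auto intro!: arg_cong[of _ _ "\<lambda>i. rho i t"])
        then show ?thesis by (simp add: rho_Newton)
      qed
      have 2: "(\<Sum>a\<in>{..<m}. rho (m - Suc a) t * (if j = a then real (Suc a) else 0)) =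
          (if j < m then rho (m - Suc j) t * real (Suc j) else 0)"
      proof -
        have "(\<Sum>a\<in>{..<m}. rho (m - Suc a) t * (if j = a then real (Suc a) else 0)) =
          (\<Sum>a\<in>{..<m}. if a = j then rho (m - Suc j) t * real (Suc j) else 0)"
          by (rule sum.cong) auto
        then show ?thesis by simp
      qed
      show "1 / real m * (\<Sum>a\<in>{..<m}. real (Suc a) * x a t * ?P a j t + rho (m - Suc a) t * (if j = a then real (Suc a) else 0)) =
         (if j < m then rho (m - 1 - j) t else 0)"
      proof (cases "j < m")
        case True
        \<comment> \<open>The recursion for index m - 1 - j contributes the factor m - 1 - j and the
          derivative of (j + 1) x_j the factor j + 1; together they cancel the prefactor 1 /
          m.\<close>
        have "real (m - 1 - j) + real (Suc j) = real m" using True by (simp add: of_nat_diff)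
        then have "real (m - 1 - j) * rho (m - 1 - j) t + rho (m - 1 - j) t * real (Suc j) = real m * rho (m - 1 - j) t"
          by (metis distrib_right mult.commute)
        then show ?thesis using True False by (simp add: sum.distrib 1 2 del: of_nat_Suc)
      next
        case nj: False
        have "(\<Sum>a\<in>{..<m}. real (Suc a) * x a t * ?P a j t) = 0" using nj by (intro sum.neutral) auto
        then show ?thesis using nj by (simp add: sum.distrib 2)
      qed
    qed
  qed
qed

text \<open>The leading coefficient is deterministic and multiplies a convergent moment; for the
  linear part and the remainder boundedness suffices, since they carry powers of 1/N.\<close>

lemma conv_EE_expn:
  assumes mom: "moments_conv W" and F: "expn W w F \<phi>\<^sub>0 \<phi>"
    and ks: "\<forall>k\<in>set ks. 1 \<le> k" "sum_list ks + w \<le> W"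
  shows "unif_conv T (\<lambda>N n. EE N n (\<lambda>l. F N n l * fluct_prod N n ks l)) (\<lambda>t. \<phi>\<^sub>0 t * wickr (\<lambda>k l. C k l t) ks)"
proof -
  obtain f\<^sub>0 f Z where f: "unif_conv T f\<^sub>0 \<phi>\<^sub>0" "\<And>j. unif_conv T (f j) (\<phi> j)" "P.mlt W w Z"
    "\<And>N n l. N \<ge> 1 \<Longrightarrow> l \<in> GT N \<Longrightarrow> F N n l = f\<^sub>0 N n + (\<Sum>j\<le>w. f j N n * fluct N n j l) / real N + Z N n l / (real N)\<^sup>2"
    using F by (rule expnE) blast
  note bd = P.mlt_bounded[OF P_test_one[OF mom], simplified]
  have 1: "unif_conv T (\<lambda>N n. f\<^sub>0 N n * EE N n (fluct_prod N n ks)) (\<lambda>t. \<phi>\<^sub>0 t * wickr (\<lambda>k l. C k l t) ks)"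
    using mom ks by (intro conv_mult f) (auto simp: moments_conv_def)
  have 2: "unif_conv T (\<lambda>N n. EE N n (\<lambda>l. (\<Sum>j\<le>w. f j N n * fluct N n j l) * fluct_prod N n ks l) / real N) (\<lambda>t. 0)"
    by (intro conv_Bdd_div_N bd[OF linear_part_mlt[OF f(2)]]) (rule ks(2))
  have 3: "unif_conv T (\<lambda>N n. (EE N n (\<lambda>l. Z N n l * fluct_prod N n ks l) * (1 / real N ^ 1)) / real N) (\<lambda>t. 0)"
    by (intro conv_Bdd_div_N Bdd_mult Bdd_inverse_N bd[OF f(3)]) (rule ks(2))
  show ?thesis
  proof (rule conv_cong[OF conv_add[OF 1 conv_add[OF 2 3]]])
    fix N n assume N: "(1::nat) \<le> N"
    have "EE N n (\<lambda>l. F N n l * fluct_prod N n ks l) = EE N n (\<lambda>l. f\<^sub>0 N n * fluct_prod N n ks l +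
       (1 / real N * ((\<Sum>j\<le>w. f j N n * fluct N n j l) * fluct_prod N n ks l) + 1 / (real N)\<^sup>2 * (Z N n l * fluct_prod N n ks l)))"
      by (rule EE_cong) (simp add: f(4)[OF N] distrib_right)
    then show "f\<^sub>0 N n * EE N n (fluct_prod N n ks) + (EE N n (\<lambda>l. (\<Sum>j\<le>w. f j N n * fluct N n j l) * fluct_prod N n ks l) / real N +
       (EE N n (\<lambda>l. Z N n l * fluct_prod N n ks l) * (1 / real N ^ 1)) / real N) = EE N n (\<lambda>l. F N n l * fluct_prod N n ks l)"
      unfolding EE_add EE_cmult by (simp add: power2_eq_square)
  qed simp
qed

lemma EE_expn:
  assumes "moments_conv W" "expn W w F \<phi>\<^sub>0 \<phi>" "w \<le> W"
  shows "unif_conv T (\<lambda>N n. EE N n (F N n)) \<phi>\<^sub>0"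
  using conv_EE_expn[OF assms(1,2), of "[]"] assms(3) by simp

text \<open>The leading term cancels in the centred quantity and the linear one has mean zero, so the
  factor \<open>N\<close> exposes the linear part.\<close>

lemma conv_EE_centred_expn:
  assumes mom: "moments_conv W" and F: "expn W w F \<phi>\<^sub>0 \<phi>"
    and ks: "\<forall>k\<in>set ks. 1 \<le> k" "sum_list ks + w \<le> W"
    and ls: "\<And>j k. j \<in> {1..w} \<Longrightarrow> k \<in> set (ls j) \<Longrightarrow> 1 \<le> k" "\<And>j. j \<in> {1..w} \<Longrightarrow> sum_list (ls j) \<le> W"
      "\<And>j N n l. j \<in> {1..w} \<Longrightarrow> fluct_prod N n (ls j) l = fluct N n j l * fluct_prod N n ks l"
  shows "unif_conv T (\<lambda>N n. real N * EE N n (\<lambda>l. (F N n l - EE N n (F N n)) * fluct_prod N n ks l))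
     (\<lambda>t. \<Sum>j\<in>{1..w}. \<phi> j t * wickr (\<lambda>k l. C k l t) (ls j))"
proof -
  obtain f\<^sub>0 f Z where f: "unif_conv T f\<^sub>0 \<phi>\<^sub>0" "\<And>j. unif_conv T (f j) (\<phi> j)" "P.mlt W w Z"
    "\<And>N n l. N \<ge> 1 \<Longrightarrow> l \<in> GT N \<Longrightarrow> F N n l = f\<^sub>0 N n + (\<Sum>j\<le>w. f j N n * fluct N n j l) / real N + Z N n l / (real N)\<^sup>2"
    using F by (rule expnE) blast
  note bd = P.mlt_bounded[OF P_test_one[OF mom], simplified]
  have 1: "unif_conv T (\<lambda>N n. \<Sum>j\<in>{1..w}. f j N n * EE N n (fluct_prod N n (ls j))) (\<lambda>t. \<Sum>j\<in>{1..w}. \<phi> j t * wickr (\<lambda>k l. C k l t) (ls j))"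
    using mom ls(1,2) by (intro conv_sum conv_mult f) (auto simp: moments_conv_def)
  have 2: "unif_conv T (\<lambda>N n. (EE N n (\<lambda>l. Z N n l * fluct_prod N n ks l) + (- 1) * (EE N n (Z N n) * EE N n (fluct_prod N n ks))) / real N) (\<lambda>t. 0)"
  proof (intro conv_Bdd_div_N Bdd_add Bdd_mult Bdd_const)
    show "unif_bdd T (\<lambda>N n. EE N n (\<lambda>l. Z N n l * fluct_prod N n ks l))" by (rule bd[OF f(3) ks(2)])
    show "unif_bdd T (\<lambda>N n. EE N n (Z N n))" using bd[OF f(3), of "[]"] ks(2) by simp
    show "unif_bdd T (\<lambda>N n. EE N n (fluct_prod N n ks))" using mom ks conv_Bdd by (auto simp: moments_conv_def)
  qed
  show ?thesis
  proof (rule conv_cong[OF conv_add[OF 1 2]])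
    fix N n assume N: "(1::nat) \<le> N"
    have lin: "(\<Sum>j\<le>w. f j N n * fluct N n j l) = (\<Sum>j\<in>{1..w}. f j N n * fluct N n j l)" for l
      using fluct_0[OF N] by (intro sum.mono_neutral_right) (auto simp: not_less_eq_eq)
    have "EE N n (F N n) = EE N n (\<lambda>l. f\<^sub>0 N n + (1 / real N * (\<Sum>j\<in>{1..w}. f j N n * fluct N n j l) + 1 / (real N)\<^sup>2 * Z N n l))"
      by (rule EE_cong) (simp add: f(4)[OF N] lin)
    also have "\<dots> = f\<^sub>0 N n + 1 / (real N)\<^sup>2 * EE N n (Z N n)"
      unfolding EE_add EE_cmult EE_sum by (simp add: EE_fluct[OF N] EE_const[OF N])
    finally have m: "EE N n (F N n) = f\<^sub>0 N n + 1 / (real N)\<^sup>2 * EE N n (Z N n)" .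
    have "real N * EE N n (\<lambda>l. (F N n l - EE N n (F N n)) * fluct_prod N n ks l) =
        EE N n (\<lambda>l. real N * ((F N n l - EE N n (F N n)) * fluct_prod N n ks l))" by (simp only: EE_cmult)
    also have "\<dots> = EE N n (\<lambda>l. (\<Sum>j\<in>{1..w}. f j N n * fluct_prod N n (ls j) l) +
        (1 / real N * (Z N n l * fluct_prod N n ks l) + (- 1 / real N * EE N n (Z N n)) * fluct_prod N n ks l))"
    proof (rule EE_cong)
      fix l assume l: "l \<in> GT N"
      have "(\<Sum>j\<in>{1..w}. f j N n * fluct_prod N n (ls j) l) = (\<Sum>j\<in>{1..w}. f j N n * fluct N n j l) * fluct_prod N n ks l"
        unfolding sum_distrib_right by (intro sum.cong) (auto simp: ls(3))
      then show "real N * ((F N n l - EE N n (F N n)) * fluct_prod N n ks l) = (\<Sum>j\<in>{1..w}. f j N n * fluct_prod N n (ls j) l) +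
        (1 / real N * (Z N n l * fluct_prod N n ks l) + (- 1 / real N * EE N n (Z N n)) * fluct_prod N n ks l)"
        unfolding m f(4)[OF N l] lin using N by (simp add: field_simps power2_eq_square)
    qed
    finally show "(\<Sum>j\<in>{1..w}. f j N n * EE N n (fluct_prod N n (ls j))) +
       (EE N n (\<lambda>l. Z N n l * fluct_prod N n ks l) + (- 1) * (EE N n (Z N n) * EE N n (fluct_prod N n ks))) / real N =
       real N * EE N n (\<lambda>l. (F N n l - EE N n (F N n)) * fluct_prod N n ks l)"
      unfolding EE_add EE_cmult EE_sum by (simp add: add_divide_distrib diff_divide_distrib)
  qed simp
qed

end

section \<open>One step of the chain\<close>

text \<open>N times the change of p_k / N^k when the particle moves, as a polynomial of degree k - 1
  in the rescaled position; all but the top term carry powers of 1/N.\<close>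

definition incr :: "nat \<Rightarrow> nat \<Rightarrow> int list \<times> nat \<Rightarrow> real" where
  "incr N k s = (\<Sum>b<k. real (k choose b) / real N ^ (k - 1 - b) * (pos N (fst s) (snd s) / real N) ^ b)"

definition mean_incr :: "nat \<Rightarrow> nat \<Rightarrow> int list \<Rightarrow> real" where
  "mean_incr N k l = (\<Sum>b<k. real (k choose b) / real N ^ (k - 1 - b) * rho_N N (Suc b) l)"

text \<open>Centred by the overall mean, not by the conditional mean given the signature. Its
  conditional mean is therefore not zero but of order 1/N, and that is the source of the linear
  drift.\<close>

definition incr_dev :: "nat \<Rightarrow> nat \<Rightarrow> nat \<Rightarrow> int list \<times> nat \<Rightarrow> real" where
  "incr_dev N n k s = incr N k s - EE N n (mean_incr N k)"

lemma site_mean_incr: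
  assumes "N \<ge> 1"
  shows "(\<Sum>i<N. wgt N l i * incr N k (l, i)) = mean_incr N k l"
proof -
  have "(\<Sum>i<N. wgt N l i * incr N k (l, i)) =
      (\<Sum>b<k. real (k choose b) / real N ^ (k - 1 - b) * (\<Sum>i<N. wgt N l i * (pos N l i / real N) ^ b))"
    by (simp add: incr_def sum_distrib_left sum.swap[of _ "{..<k}"] mult.left_commute)
  then show ?thesis unfolding mean_incr_def sum_wgt_pos_power[OF assms] .
qed

lemma power_increment: "(p + 1) ^ k - p ^ k = (\<Sum>b<k. real (k choose b) * p ^ b)" for p :: real
proof -
  have "(p + 1) ^ k = (\<Sum>b\<le>k. real (k choose b) * p ^ b)" by (simp add: binomial_ring)
  then show ?thesis by (simp add: lessThan_Suc_atMost[symmetric])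
qed

lemma power_increment_incr:
  assumes "N \<ge> 1" "k \<ge> 1"
  shows "((pos N l i + 1) ^ k - pos N l i ^ k) / real N ^ k = 1 / real N * incr N k (l, i)"
proof -
  have "real (k choose b) * p ^ b / real N ^ k = 1 / real N * (real (k choose b) / real N ^ (k - 1 - b) * (p / real N) ^ b)"
    if "b < k" for b and p :: real
  proof -
    have "k = Suc (k - 1 - b + b)" using that by simp
    then have "real N ^ k = real N * (real N ^ (k - 1 - b) * real N ^ b)" by (metis power_Suc power_add)
    then show ?thesis by (simp only: power_divide times_divide_times_eq mult_1)
  qed
  then show ?thesis
    unfolding power_increment incr_def sum_divide_distrib sum_distrib_left fst_conv snd_conv by (intro sum.cong) auto
qed

lemma pk_add_box:
  assumes "l \<in> GT N" "i < N"
  shows "pk N k (add_box l i) = pk N k l + ((pos N l i + 1) ^ k - pos N l i ^ k)"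
proof -
  have p: "pos N (add_box l i) j = (if j = i then pos N l i + 1 else pos N l j)" if "j < N" for j
    using that assms by (auto simp: pos_def add_box_def GT_def)
  have "pk N k (add_box l i) = (pos N l i + 1) ^ k + (\<Sum>j\<in>{..<N} - {i}. pos N l j ^ k)"
    unfolding pk_pos using assms(2) p by (subst sum.remove[of _ i]) auto
  moreover have "pk N k l = pos N l i ^ k + (\<Sum>j\<in>{..<N} - {i}. pos N l j ^ k)"
    unfolding pk_pos using assms(2) by (subst sum.remove[of _ i]) auto
  ultimately show ?thesis by simp
qed

lemma EE_Suc_pk:
  assumes "N \<ge> 1" "k \<ge> 1"
  shows "EE N (Suc n) (pk N k) = EE N n (pk N k) + real N ^ k * (1 / real N * EE N n (mean_incr N k))"
proof -
  have "EE N (Suc n) (pk N k) = EE N n (\<lambda>l. pk N k l + real N ^ k * (1 / real N * mean_incr N k l))"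
    unfolding EE.simps
  proof (rule EE_cong)
    fix l assume l: "l \<in> GT N"
    have "(\<Sum>i<N. wgt N l i * pk N k (add_box l i)) =
        (\<Sum>i<N. wgt N l i * pk N k l + real N ^ k * (1 / real N * (wgt N l i * incr N k (l, i))))"
    proof (rule sum.cong)
      fix i assume "i \<in> {..<N}"
      then have "pk N k (add_box l i) = pk N k l + real N ^ k * (((pos N l i + 1) ^ k - pos N l i ^ k) / real N ^ k)"
        using pk_add_box[OF l, of i k] assms by simp
      then show "wgt N l i * pk N k (add_box l i) = wgt N l i * pk N k l + real N ^ k * (1 / real N * (wgt N l i * incr N k (l, i)))"
        unfolding power_increment_incr[OF assms] by (simp only: distrib_left mult_ac)
    qed simp
    also have "\<dots> = pk N k l + real N ^ k * (1 / real N * mean_incr N k l)"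
      unfolding sum.distrib sum_distrib_left[symmetric] sum_distrib_right[symmetric] site_mean_incr[OF assms(1)]
        sum_wgt[OF l assms(1)] by simp
    finally show "(\<Sum>i<N. wgt N l i * pk N k (add_box l i)) = pk N k l + real N ^ k * (1 / real N * mean_incr N k l)" .
  qed
  then show ?thesis by (simp only: EE_add EE_cmult)
qed

text \<open>The centring also moves from time n to n + 1; the mean increment it subtracts is exactly
  what turns \<open>incr\<close> into \<open>incr_dev\<close>.\<close>

lemma fluct_step:
  assumes "N \<ge> 1" "k \<ge> 1" "l \<in> GT N" "i < N"
  shows "fluct N (Suc n) k (add_box l i) = fluct N n k l + 1 / real N * incr_dev N n k (l, i)"
proof -
  have N: "real N ^ k \<noteq> 0" using assms by simp
  have "fluct N (Suc n) k (add_box l i) = fluct N n k l + ((pos N l i + 1) ^ k - pos N l i ^ k) / real N ^ k - 1 / real N * EE N n (mean_incr N k)"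
    unfolding fluct_def pk_add_box[OF assms(3,4)] EE_Suc_pk[OF assms(1,2)] using N
    by (simp add: diff_divide_distrib add_divide_distrib)
  then show ?thesis unfolding power_increment_incr[OF assms(1,2)] incr_dev_def by (simp only: right_diff_distrib)
qed

lemma EE_Suc_fluct_prod:
  assumes "N \<ge> 1" "\<forall>k\<in>set ks. 1 \<le> k"
  shows "EE N (Suc n) (fluct_prod N (Suc n) ks) = EJ N n (\<lambda>s. \<Prod>k\<leftarrow>ks. fluct N n k (fst s) + 1 / real N * incr_dev N n k s)"
  unfolding EE.simps EJ_def
proof (intro EE_cong sum.cong)
  fix l i assume "l \<in> GT N" "i \<in> {..<N}"
  then have "fluct_prod N (Suc n) ks (add_box l i) = (\<Prod>k\<leftarrow>ks. fluct N n k (fst (l, i)) + 1 / real N * incr_dev N n k (l, i))"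
    using assms by (intro arg_cong[of _ _ prod_list] map_cong) (auto simp: fluct_step)
  then show "wgt N l i * fluct_prod N (Suc n) ks (add_box l i) = wgt N l i * (\<Prod>k\<leftarrow>ks. fluct N n k (fst (l, i)) + 1 / real N * incr_dev N n k (l, i))"
    by simp
qed simp

text \<open>The expansion with h = 1/N, written as a multiple of the macroscopic time step 1/N^2:
  the first-order term gets a factor N, the second none, the third 1/N.\<close>

lemma EE_increment_fluct_prod:
  assumes "N \<ge> 1" "\<forall>k\<in>set ks. 1 \<le> k"
  shows "EE N (Suc n) (fluct_prod N (Suc n) ks) - EE N n (fluct_prod N n ks) =
    (real N * EJ N n (\<lambda>s. expand1 (\<lambda>k. fluct N n k (fst s)) (\<lambda>k. incr_dev N n k s) ks)
     + EJ N n (\<lambda>s. expand2 (\<lambda>k. fluct N n k (fst s)) (\<lambda>k. incr_dev N n k s) ks)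
     + EJ N n (\<lambda>s. expand3 (1 / real N) (\<lambda>k. fluct N n k (fst s)) (\<lambda>k. incr_dev N n k s) ks) / real N) / (real N)\<^sup>2"
proof -
  have N: "real N \<noteq> 0" using assms by simp
  have "EJ N n (\<lambda>s. fluct_prod N n ks (fst s)) = EE N n (fluct_prod N n ks)"
    using EJ_function_of_list[OF assms(1), of n "fluct_prod N n ks"] by (simp add: case_prod_unfold)
  then show ?thesis
    unfolding EE_Suc_fluct_prod[OF assms] prod_list_perturb EJ_add EJ_cmult
    using N by (simp add: field_simps power2_eq_square power3_eq_cube)
qed

text \<open>Telescoping of (a + 1)^(k+1) - a^(k+1), which lies between (k + 1) a^k and (k + 1) (a +
  1)^k. The sum is the power sum of the empty diagram, whose particles occupy 0, ..., N - 1.\<close>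

lemma power_sum_bounds:
  "(\<Sum>i<N. real i ^ k) \<le> real N ^ Suc k / real (Suc k)"
  "real N ^ Suc k / real (Suc k) \<le> (\<Sum>i<N. real i ^ k) + real N ^ k"
proof -
  have step: "real (Suc k) * a ^ k \<le> (a + 1) ^ Suc k - a ^ Suc k" "(a + 1) ^ Suc k - a ^ Suc k \<le> real (Suc k) * (a + 1) ^ k"
    if "a \<ge> 0" for a :: real
  proof -
    have e: "(a + 1) ^ Suc k - a ^ Suc k = (\<Sum>p<Suc k. (a + 1) ^ p * a ^ (k - p))"
      using power_diff_sumr2[of "a + 1" "Suc k" a]
      by (simp only: diff_Suc_Suc add_diff_cancel_left' mult_1 mult.commute)
    have "(\<Sum>p<Suc k. a ^ k) \<le> (\<Sum>p<Suc k. (a + 1) ^ p * a ^ (k - p))"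
    proof (rule sum_mono)
      fix p assume "p \<in> {..<Suc k}"
      then have "a ^ k = a ^ p * a ^ (k - p)" by (simp add: power_add[symmetric])
      also have "\<dots> \<le> (a + 1) ^ p * a ^ (k - p)" using that by (intro mult_right_mono power_mono) auto
      finally show "a ^ k \<le> (a + 1) ^ p * a ^ (k - p)" .
    qed
    then show "real (Suc k) * a ^ k \<le> (a + 1) ^ Suc k - a ^ Suc k" unfolding e by simp
    have "(\<Sum>p<Suc k. (a + 1) ^ p * a ^ (k - p)) \<le> (\<Sum>p<Suc k. (a + 1) ^ k)"
    proof (rule sum_mono)
      fix p assume p: "p \<in> {..<Suc k}"
      have "(a + 1) ^ p * a ^ (k - p) \<le> (a + 1) ^ p * (a + 1) ^ (k - p)" using that by (intro mult_left_mono power_mono) auto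
      also have "\<dots> = (a + 1) ^ k" using p by (simp add: power_add[symmetric])
      finally show "(a + 1) ^ p * a ^ (k - p) \<le> (a + 1) ^ k" .
    qed
    then show "(a + 1) ^ Suc k - a ^ Suc k \<le> real (Suc k) * (a + 1) ^ k" unfolding e by simp
  qed
  have "real (Suc k) * (\<Sum>i<N. real i ^ k) \<le> real N ^ Suc k"
  proof (induction N)
    case (Suc N)
    have "real (Suc k) * (\<Sum>i<Suc N. real i ^ k) = real (Suc k) * (\<Sum>i<N. real i ^ k) + real (Suc k) * real N ^ k"
      by (simp only: sum.lessThan_Suc distrib_left)
    also have "\<dots> \<le> real N ^ Suc k + (real (Suc N) ^ Suc k - real N ^ Suc k)"
      using Suc step(1)[of "real N"] by (intro add_mono) (auto simp: add.commute)
    finally show ?case by simp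
  qed simp
  then show "(\<Sum>i<N. real i ^ k) \<le> real N ^ Suc k / real (Suc k)"
    by (simp add: field_simps)
  have "real N ^ Suc k \<le> real (Suc k) * ((\<Sum>i<N. real i ^ k) + real N ^ k)"
  proof (induction N)
    case (Suc N)
    have "real (Suc N) ^ Suc k = real N ^ Suc k + (real (Suc N) ^ Suc k - real N ^ Suc k)" by simp
    also have "\<dots> \<le> real (Suc k) * ((\<Sum>i<N. real i ^ k) + real N ^ k) + real (Suc k) * real (Suc N) ^ k"
      using Suc step(2)[of "real N"] by (intro add_mono) (auto simp: add.commute)
    also have "\<dots> = real (Suc k) * ((\<Sum>i<Suc N. real i ^ k) + real (Suc N) ^ k)"
      by (simp only: sum.lessThan_Suc distrib_left)
    finally show ?case .
  qed simp
  then show "real N ^ Suc k / real (Suc k) \<le> (\<Sum>i<N. real i ^ k) + real N ^ k"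
    by (simp add: field_simps)
qed

lemma power_sum_limit: "(\<lambda>N. (\<Sum>i<N. real i ^ k) / real N ^ Suc k) \<longlonglongrightarrow> 1 / real (Suc k)"
proof (rule tendsto_sandwich)
  have "(\<lambda>N. 1 / real (Suc k) - 1 / real N) \<longlonglongrightarrow> 1 / real (Suc k) - 0"
    by (intro tendsto_intros lim_1_over_n)
  then show "(\<lambda>N. 1 / real (Suc k) - 1 / real N) \<longlonglongrightarrow> 1 / real (Suc k)" by simp
  show "\<forall>\<^sub>F N in sequentially. 1 / real (Suc k) - 1 / real N \<le> (\<Sum>i<N. real i ^ k) / real N ^ Suc k"
    using eventually_ge_at_top[of 1]
  proof eventually_elim
    case (elim N)
    have "real N ^ Suc k / real (Suc k) / real N ^ Suc k \<le> ((\<Sum>i<N. real i ^ k) + real N ^ k) / real N ^ Suc k"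
      using power_sum_bounds(2)[of N k] by (intro divide_right_mono) auto
    then show ?case using elim by (simp add: add_divide_distrib del: of_nat_Suc)
  qed
  show "\<forall>\<^sub>F N in sequentially. (\<Sum>i<N. real i ^ k) / real N ^ Suc k \<le> 1 / real (Suc k)"
    using eventually_ge_at_top[of 1]
  proof eventually_elim
    case (elim N)
    have "(\<Sum>i<N. real i ^ k) / real N ^ Suc k \<le> real N ^ Suc k / real (Suc k) / real N ^ Suc k"
      using power_sum_bounds(1)[of k N] by (intro divide_right_mono) auto
    then show ?case using elim by (simp del: of_nat_Suc)
  qed
qed simp

lemma mean_pk_init: "(\<lambda>N. mean_pk k N 0) \<longlonglongrightarrow> 1 / real (Suc k)"
proof -
  have "pk N k (replicate N 0) = (\<Sum>i<N. real i ^ k)" for N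
  proof -
    have "pk N k (replicate N 0) = (\<Sum>i<N. real (N - Suc i) ^ k)"
      unfolding pk_pos by (rule sum.cong) (auto simp: pos_def of_nat_diff)
    also have "\<dots> = (\<Sum>i<N. real i ^ k)" by (rule sum.nat_diff_reindex)
    finally show ?thesis .
  qed
  then have "mean_pk k N 0 = (\<Sum>i<N. real i ^ k) / real N ^ Suc k" for N by (simp only: mean_pk_def EE.simps)
  then show ?thesis using power_sum_limit[of k] by simp
qed

lemma mean_pk_step:
  assumes "N \<ge> 1" "k \<ge> 1"
  shows "mean_pk k N (Suc n) - mean_pk k N n = EE N n (mean_incr N k) / (real N)\<^sup>2"
  using assms unfolding mean_pk_def EE_Suc_pk[OF assms]
  by (simp add: field_simps power2_eq_square)

lemma expand_map:
  "expand1 A V (map \<kappa> xs) = expand1 (\<lambda>a. A (\<kappa> a)) (\<lambda>a. V (\<kappa> a)) xs"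
  "expand2 A V (map \<kappa> xs) = expand2 (\<lambda>a. A (\<kappa> a)) (\<lambda>a. V (\<kappa> a)) xs"
proof -
  show 1: "expand1 A V (map \<kappa> xs) = expand1 (\<lambda>a. A (\<kappa> a)) (\<lambda>a. V (\<kappa> a)) xs" for xs
    by (induction xs) (simp_all add: comp_def)
  show "expand2 A V (map \<kappa> xs) = expand2 (\<lambda>a. A (\<kappa> a)) (\<lambda>a. V (\<kappa> a)) xs"
    by (induction xs) (simp_all add: 1)
qed

lemma site_gen_prod:
  "(\<Prod>k\<leftarrow>ks. site_gen N n k s) = (pos N (fst s) (snd s) / real N) ^ length (filter (\<lambda>k. k = 0) ks)
     * fluct_prod N n (filter (\<lambda>k. k \<noteq> 0) ks) (fst s)"
  by (induction ks) (simp_all add: site_gen_def)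

lemma site_weight: "sum_list (map (max 1) ks) = length (filter (\<lambda>k. k = 0) ks) + sum_list (filter (\<lambda>k. k \<noteq> 0) ks)"
  for ks :: "nat list"
  by (induction ks) auto

section \<open>Drift, noise and weight of one step\<close>

context fluctuation_limit
begin

text \<open>Only the top term b = k - 1 survives, so the mean increment behaves like k times
  \<open>rho_N N k\<close>; its linear coefficients are the drift matrix of the covariance
  equation.\<close>

lemma expn_mean_incr:
  assumes "means_conv W" "1 \<le> k" "k \<le> Suc W"
  shows "expn W (k - 1) (\<lambda>N n. mean_incr N k) (\<lambda>t. real k * rho k t) (\<lambda>j t. if j < k then real k * rho (k - 1 - j) t else 0)"
proof -
  have e: "expn W (k - 1) (\<lambda>N n. mean_incr N k)
     (\<lambda>t. \<Sum>b\<in>{..<k}. (if k - 1 - b = 0 then real (k choose b) else 0) * rho (Suc b) t)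
     (\<lambda>j t. \<Sum>b\<in>{..<k}. (if k - 1 - b = 0 then real (k choose b) else 0) * (if j < Suc b then rho (Suc b - 1 - j) t else 0))"
    unfolding mean_incr_def
  proof (intro expn_sum expn_scale conv_const_div_pow)
    fix b assume b: "b \<in> {..<k}"
    have "expn W (Suc b - 1) (\<lambda>N n l. rho_N N (Suc b) l) (rho (Suc b)) (\<lambda>j t. if j < Suc b then rho (Suc b - 1 - j) t else 0)"
      using b assms by (intro expn_rho) auto
    then show "expn W (k - 1) (\<lambda>N n l. rho_N N (Suc b) l) (rho (Suc b)) (\<lambda>j t. if j < Suc b then rho (Suc b - 1 - j) t else 0)"
      by (rule expn_mono) (use b in auto)
  qed
  have s: "(\<Sum>b\<in>{..<k}. (if k - 1 - b = 0 then real (k choose b) else 0) * z b) = real k * z (k - 1)" for z :: "nat \<Rightarrow> real"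
  proof -
    obtain m where m: "k = Suc m" using assms(2) by (cases k) auto
    have "(\<Sum>b\<in>{..<k}. (if k - 1 - b = 0 then real (k choose b) else 0) * z b) = (\<Sum>b\<in>{..<k}. if b = m then real k * z m else 0)"
      using m by (intro sum.cong) auto
    then show ?thesis using m by simp
  qed
  show ?thesis
  proof (rule expn_limit_cong[OF e])
    show "(\<Sum>b\<in>{..<k}. (if k - 1 - b = 0 then real (k choose b) else 0) * rho (Suc b) t) = real k * rho k t" for t
      unfolding s using assms(2) by simp
    show "(\<Sum>b\<in>{..<k}. (if k - 1 - b = 0 then real (k choose b) else 0) * (if j < Suc b then rho (Suc b - 1 - j) t else 0)) =
        (if j < k then real k * rho (k - 1 - j) t else 0)" for j t
      unfolding s using assms(2) by simp
  qed
qed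

lemma conv_mean_incr:
  assumes "means_conv W" "moments_conv W" "1 \<le> k" "k \<le> Suc W"
  shows "unif_conv T (\<lambda>N n. EE N n (mean_incr N k)) (\<lambda>t. real k * rho k t)"
  by (rule EE_expn[OF assms(2) expn_mean_incr]) (use assms in auto)

text \<open>With y the rescaled position of the moving particle, the leading term is the limiting
  covariance of k y^(k-1) and l y^(l-1), where moments of y are values of \<open>rho\<close> with
  the index shifted by one. The linear coefficients matter only at order 1/N and are left
  existential.\<close>

lemma expn_incr_dev_pair:
  assumes mean: "means_conv W" and mom: "moments_conv W" and k: "1 \<le> k" and l: "1 \<le> l" and kl: "k + l \<le> Suc W"
  shows "\<exists>\<phi>. expn W (k + l - 2) (\<lambda>N n p. \<Sum>i<N. wgt N p i * (incr_dev N n k (p, i) * incr_dev N n l (p, i)))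
     (\<lambda>t. real k * real l * (rho (k + l - 1) t - rho k t * rho l t)) \<phi>"
proof -
  let ?c = "\<lambda>k b (N::nat) (n::nat). real (k choose b) / real N ^ (k - 1 - b)"
  let ?\<gamma> = "\<lambda>k b. if k - 1 - b = 0 then real (k choose b) else 0"
  have wk: "k - 1 \<le> k + l - 2" "l - 1 \<le> k + l - 2" using k l by auto
  have 1: "expn W (k + l - 2) (\<lambda>N n p. \<Sum>b\<in>{..<k}. ?c k b N n * (\<Sum>b'\<in>{..<l}. ?c l b' N n * rho_N N (Suc (b + b')) p))
     (\<lambda>t. \<Sum>b\<in>{..<k}. ?\<gamma> k b * (\<Sum>b'\<in>{..<l}. ?\<gamma> l b' * rho (Suc (b + b')) t))
     (\<lambda>j t. \<Sum>b\<in>{..<k}. ?\<gamma> k b * (\<Sum>b'\<in>{..<l}. ?\<gamma> l b' * (if j < Suc (b + b') then rho (Suc (b + b') - 1 - j) t else 0)))"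
  proof (intro expn_sum expn_scale conv_const_div_pow)
    fix b b' assume b: "b \<in> {..<k}" "b' \<in> {..<l}"
    have "expn W (Suc (b + b') - 1) (\<lambda>N n p. rho_N N (Suc (b + b')) p) (rho (Suc (b + b')))
        (\<lambda>j t. if j < Suc (b + b') then rho (Suc (b + b') - 1 - j) t else 0)"
      using b kl by (intro expn_rho[OF mean]) auto
    then show "expn W (k + l - 2) (\<lambda>N n p. rho_N N (Suc (b + b')) p) (rho (Suc (b + b')))
        (\<lambda>j t. if j < Suc (b + b') then rho (Suc (b + b') - 1 - j) t else 0)"
      by (rule expn_mono) (use b in auto)
  qed
  have ck: "unif_conv T (\<lambda>N n. EE N n (mean_incr N k)) (\<lambda>t. real k * rho k t)" and cl: "unif_conv T (\<lambda>N n. EE N n (mean_incr N l)) (\<lambda>t. real l * rho l t)"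
    using mean mom k l kl by (auto intro!: conv_mean_incr)
  note 2 = expn_mono[OF expn_scale[OF conv_cmult[OF ck, of "-1"] expn_mean_incr[OF mean, of l]] wk(2)]
  note 3 = expn_mono[OF expn_scale[OF conv_cmult[OF cl, of "-1"] expn_mean_incr[OF mean, of k]] wk(1)]
  note 4 = expn_mono[OF expn_const[OF conv_mult[OF ck cl]] le0]
  have lk: "1 \<le> l" "l \<le> Suc W" "1 \<le> k" "k \<le> Suc W" using k l kl by auto
  note e = expn_add[OF 1 expn_add[OF 2[OF lk(1,2)] expn_add[OF 3[OF lk(3,4)] 4]]]
  have s: "(\<Sum>b\<in>{..<k}. ?\<gamma> k b * z b) = real k * z (k - 1)" if k1: "1 \<le> k" for z :: "nat \<Rightarrow> real" and k
  proof -
    obtain m where m: "k = Suc m" using k1 by (cases k) auto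
    have "(\<Sum>b\<in>{..<k}. (if k - 1 - b = 0 then real (k choose b) else 0) * z b) = (\<Sum>b\<in>{..<k}. if b = m then real k * z m else 0)"
      using m by (intro sum.cong) auto
    then show ?thesis using m by simp
  qed
  show ?thesis
  proof (rule exI, rule expn_limit_cong[OF expn_cong[OF e] _ refl])
    fix N n p assume N: "(1::nat) \<le> N" "p \<in> GT N"
    let ?d = "EE N n (mean_incr N k)" and ?e = "EE N n (mean_incr N l)"
    have "(\<Sum>i<N. wgt N p i * (incr N k (p, i) * incr N l (p, i))) =
       (\<Sum>i<N. \<Sum>b<k. \<Sum>b'<l. ?c k b N n * (?c l b' N n * (wgt N p i * (pos N p i / real N) ^ (b + b'))))"
      unfolding incr_def sum_product fst_conv snd_conv unfolding sum_distrib_left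
      by (intro sum.cong refl) (simp add: power_add mult_ac)
    also have "\<dots> = (\<Sum>b<k. \<Sum>b'<l. \<Sum>i<N. ?c k b N n * (?c l b' N n * (wgt N p i * (pos N p i / real N) ^ (b + b'))))"
      by (subst sum.swap) (intro sum.cong refl sum.swap)
    also have "\<dots> = (\<Sum>b<k. ?c k b N n * (\<Sum>b'<l. ?c l b' N n * rho_N N (Suc (b + b')) p))"
      unfolding sum_wgt_pos_power[OF N(1), symmetric] by (simp add: sum_distrib_left)
    finally have nd: "(\<Sum>i<N. wgt N p i * (incr N k (p, i) * incr N l (p, i))) = \<dots>" .
    have "wgt N p i * (incr_dev N n k (p, i) * incr_dev N n l (p, i)) = wgt N p i * (incr N k (p, i) * incr N l (p, i)) +
       (- 1 * ?d * (wgt N p i * incr N l (p, i)) + (- 1 * ?e * (wgt N p i * incr N k (p, i)) + wgt N p i * (?d * ?e)))" for i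
      by (simp add: incr_dev_def algebra_simps)
    then have "(\<Sum>i<N. wgt N p i * (incr_dev N n k (p, i) * incr_dev N n l (p, i))) = (\<Sum>i<N. wgt N p i * (incr N k (p, i) * incr N l (p, i))) +
       (- 1 * ?d * mean_incr N l p + (- 1 * ?e * mean_incr N k p + ?d * ?e))"
      by (simp only: sum.distrib sum_distrib_left[symmetric] sum_distrib_right[symmetric] site_mean_incr[OF N(1)] sum_wgt[OF N(2,1)] mult_1_left)
    then show "(\<Sum>b\<in>{..<k}. ?c k b N n * (\<Sum>b'\<in>{..<l}. ?c l b' N n * rho_N N (Suc (b + b')) p)) +
       (- 1 * ?d * mean_incr N l p + (- 1 * ?e * mean_incr N k p + ?d * ?e)) = (\<Sum>i<N. wgt N p i * (incr_dev N n k (p, i) * incr_dev N n l (p, i)))"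
      by (simp only: nd)
  next
    fix t
    have kl1: "Suc (k - 1 + (l - 1)) = k + l - 1" using k l by simp
    show "(\<Sum>b\<in>{..<k}. ?\<gamma> k b * (\<Sum>b'\<in>{..<l}. ?\<gamma> l b' * rho (Suc (b + b')) t)) +
       (- 1 * (real k * rho k t) * (real l * rho l t) + (- 1 * (real l * rho l t) * (real k * rho k t) + real k * rho k t * (real l * rho l t))) =
       real k * real l * (rho (k + l - 1) t - rho k t * rho l t)"
      unfolding s[OF l] s[OF k] kl1 by (simp add: algebra_simps)
  qed
qed

text \<open>Averaging over the moving particle turns b factors of its rescaled position into
  \<open>rho_N\<close> of index b + 1, a multiplier of weight b on signatures; bounds for the joint
  law thus follow from those for signatures alone.\<close>

lemma M_test_one:
  assumes "means_conv W" "moments_conv W"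
  shows "M.tst W 0 (\<lambda>N n s. 1)"
  unfolding M.tst_def
proof (intro allI impI)
  fix ks :: "nat list" assume ks: "sum_list (map (max 1) ks) + 0 \<le> W"
  define b where "b = length (filter (\<lambda>k. k = 0) ks)"
  define js where "js = filter (\<lambda>k. k \<noteq> 0) ks"
  have w: "b + sum_list js \<le> W" using ks unfolding site_weight b_def js_def by simp
  have "expn W (Suc b - 1) (\<lambda>N n l. rho_N N (Suc b) l) (rho (Suc b)) (\<lambda>j t. if j < Suc b then rho (Suc b - 1 - j) t else 0)"
    using w by (intro expn_rho assms) auto
  then have "P.mlt W b (\<lambda>N n l. rho_N N (Suc b) l)" using expn_mlt by simp
  then have "unif_bdd T (\<lambda>N n. EE N n (\<lambda>l. rho_N N (Suc b) l * fluct_prod N n js l))"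
    using P.mlt_bounded[OF P_test_one[OF assms(2)], of b _ js] w by simp
  then show "unif_bdd T (\<lambda>N n. EJ N n (\<lambda>s. 1 * (\<Prod>k\<leftarrow>ks. site_gen N n k s)))"
  proof (rule Bdd_cong)
    fix N n assume N: "(1::nat) \<le> N"
    have "(\<Sum>i<N. wgt N l i * (1 * (\<Prod>k\<leftarrow>ks. site_gen N n k (l, i)))) = rho_N N (Suc b) l * fluct_prod N n js l" for l
      unfolding sum_wgt_pos_power[OF N, symmetric] site_gen_prod b_def[symmetric] js_def[symmetric] fst_conv snd_conv
      by (simp add: sum_distrib_right mult.assoc)
    then show "EE N n (\<lambda>l. rho_N N (Suc b) l * fluct_prod N n js l) = EJ N n (\<lambda>s. 1 * (\<Prod>k\<leftarrow>ks. site_gen N n k s))"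
      by (simp add: EJ_def)
  qed
qed

lemma M_fluct: "1 \<le> k \<Longrightarrow> M.mlt W k (\<lambda>N n s. fluct N n k (fst s))"
  using M.mlt_generator[of W k] by (simp add: site_gen_def)

text \<open>A polynomial of degree k - 1 in the rescaled position, which has weight one, minus a
  bounded number.\<close>

lemma M_incr_dev:
  assumes "means_conv W" "moments_conv W" "1 \<le> k" "k \<le> Suc W"
  shows "M.mlt W (k - 1) (\<lambda>N n s. incr_dev N n k s)"
proof -
  have xi: "M.mlt W 1 (\<lambda>N n s. pos N (fst s) (snd s) / real N)"
    using M.mlt_generator[of W 0] by (simp add: site_gen_def)
  have nd: "M.mlt W (k - 1) (\<lambda>N n s. incr N k s)"
    unfolding incr_def
  proof (intro M.mlt_sum M.mlt_scale conv_Bdd[OF conv_const_div_pow])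
    fix b assume "b \<in> {..<k}"
    then show "M.mlt W (k - 1) (\<lambda>N n s. (pos N (fst s) (snd s) / real N) ^ b)"
      using M.mlt_mono[OF M.mlt_power[OF xi, of b], of "k - 1"] by auto
  qed
  have "M.mlt W (k - 1) (\<lambda>N n s. - 1 * EE N n (mean_incr N k))"
    by (rule M.mlt_mono[OF M.mlt_const[OF conv_Bdd[OF conv_cmult[OF conv_mean_incr[OF assms]]]]]) simp
  from M.mlt_add[OF nd this] show ?thesis by (simp add: incr_dev_def)
qed

text \<open>Every term of the three expansions replaces at least one factor of weight k by one of
  weight k - 1. This loss of one lets moments of weight \<open>Suc W\<close> be treated with bounds
  up to \<open>W\<close>.\<close>

lemma M_expand:
  assumes "means_conv W" "moments_conv W" "\<forall>k\<in>set ks. 1 \<le> k \<and> k \<le> Suc W"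
  shows "M.mlt W (sum_list ks) (\<lambda>N n s. fluct_prod N n ks (fst s))"
    "M.mlt W (sum_list ks - 1) (\<lambda>N n s. expand1 (\<lambda>k. fluct N n k (fst s)) (\<lambda>k. incr_dev N n k s) ks)"
    "M.mlt W (sum_list ks - 1) (\<lambda>N n s. expand2 (\<lambda>k. fluct N n k (fst s)) (\<lambda>k. incr_dev N n k s) ks)"
    "M.mlt W (sum_list ks - 1) (\<lambda>N n s. expand3 (1 / real N) (\<lambda>k. fluct N n k (fst s)) (\<lambda>k. incr_dev N n k s) ks)"
  using assms(3)
proof (induction ks)
  case Nil
  {
    case 1 show ?case using M.mlt_const[OF Bdd_const, of W 1] by simp
  next
    case 2 show ?case using M.mlt_zero by simp
  next
    case 3 show ?case using M.mlt_zero by simp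
  next
    case 4 show ?case using M.mlt_zero by simp
  }
next
  case (Cons k ks)
  have pre: "\<forall>k\<in>set ks. 1 \<le> k \<and> k \<le> Suc W" if "\<forall>j\<in>set (k # ks). 1 \<le> j \<and> j \<le> Suc W" using that by simp
  have AU: "M.mlt W k (\<lambda>N n s. fluct N n k (fst s))" "M.mlt W (k - 1) (\<lambda>N n s. incr_dev N n k s)" "1 \<le> k"
    if "\<forall>j\<in>set (k # ks). 1 \<le> j \<and> j \<le> Suc W"
  proof -
    show k: "1 \<le> k" using that by simp
    show "M.mlt W k (\<lambda>N n s. fluct N n k (fst s))" by (rule M_fluct[OF k])
    show "M.mlt W (k - 1) (\<lambda>N n s. incr_dev N n k s)" using that by (intro M_incr_dev assms k) simp
  qed
  \<comment> \<open>Natural subtraction: for empty \<open>ks\<close> the term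
    \<open>sum_list ks - 1\<close> is 0 instead of -1, and the weight count is rescued by the
    expansions of the empty product being zero.\<close>
  have A: "M.mlt W (sum_list (k # ks) - 1) (\<lambda>N n s. fluct N n k (fst s) * F N n s)"
    if "M.mlt W (sum_list ks - 1) F" "ks = [] \<Longrightarrow> F = (\<lambda>N n s. 0)" "\<forall>j\<in>set (k # ks). 1 \<le> j \<and> j \<le> Suc W" for F
  proof (cases "ks = []")
    case True
    then show ?thesis using that(2) M.mlt_zero by simp
  next
    case False
    then have "1 \<le> sum_list ks" using that(3) by (cases ks) auto
    then show ?thesis using M.mlt_mono[OF M.mlt_mult[OF AU(1)[OF that(3)] that(1)], of "sum_list (k # ks) - 1"] by simp
  qed
  have B: "M.mlt W (sum_list (k # ks) - 1) (\<lambda>N n s. incr_dev N n k s * F N n s)"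
    if "M.mlt W (sum_list ks) F" "\<forall>j\<in>set (k # ks). 1 \<le> j \<and> j \<le> Suc W" for F
    using M.mlt_mono[OF M.mlt_mult[OF AU(2)[OF that(2)] that(1)], of "sum_list (k # ks) - 1"] AU(3)[OF that(2)] by simp
  {
    case 1 then show ?case using M.mlt_mult[OF AU(1)[OF 1] Cons.IH(1)[OF pre[OF 1]]] by simp
  next
    case 2 show ?case unfolding expand1.simps
      by (intro M.mlt_add A B Cons.IH(1,2) pre 2) auto
  next
    case 3 show ?case unfolding expand2.simps
      by (intro M.mlt_add A B M.mlt_mono[OF Cons.IH(2), of "sum_list ks"] Cons.IH(3) pre 3) auto
  next
    case 4 show ?case unfolding expand3.simps
    proof (intro M.mlt_add A)
      show "M.mlt W (sum_list (k # ks) - 1) (\<lambda>N n s. incr_dev N n k s * expand2 (\<lambda>k. fluct N n k (fst s)) (\<lambda>k. incr_dev N n k s) ks)"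
        by (intro B M.mlt_mono[OF Cons.IH(3), of "sum_list ks"] pre 4) auto
      have "M.mlt W (sum_list (k # ks) - 1) (\<lambda>N n s. 1 / real N ^ 1 * (incr_dev N n k s * expand3 (1 / real N) (\<lambda>k. fluct N n k (fst s)) (\<lambda>k. incr_dev N n k s) ks))"
        by (intro M.mlt_scale Bdd_inverse_N B M.mlt_mono[OF Cons.IH(4), of "sum_list ks"] pre 4) auto
      then show "M.mlt W (sum_list (k # ks) - 1) (\<lambda>N n s. 1 / real N * (incr_dev N n k s * expand3 (1 / real N) (\<lambda>k. fluct N n k (fst s)) (\<lambda>k. incr_dev N n k s) ks))"
        by simp
    qed (use Cons.IH(4) pre 4 in auto)
  }
qed

end

section \<open>Induction on the weight\<close>

context fluctuation_limit
begin

lemma means_conv_Suc: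
  assumes "means_conv W" "moments_conv W"
  shows "means_conv (Suc W)"
proof -
  have "unif_conv T (mean_pk (Suc W)) (x (Suc W))"
  proof (rule conv_from_increments[OF conv_mean_incr[OF assms, of "Suc W"]])
    show "mean_pk (Suc W) N (Suc n) - mean_pk (Suc W) N n = EE N n (mean_incr N (Suc W)) / (real N)\<^sup>2" if "1 \<le> N" for N n
      using that by (intro mean_pk_step) auto
    show "(\<lambda>N. mean_pk (Suc W) N 0) \<longlonglongrightarrow> x (Suc W) 0"
      using mean_pk_init[of "Suc W"] by (simp only: x_init)
  qed (auto intro: x_deriv T_pos simp del: of_nat_Suc)
  then show ?thesis using assms(1) by (auto simp: means_conv_def le_Suc_eq)
qed

text \<open>Only lists of weight exactly \<open>Suc W\<close> are new. In their increments the
  centred expansion gives the drift from the first-order term, the leading part of the pair average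
  gives the noise from the second, and the third is bounded. All three involve only moments of
  weight at most \<open>W\<close>, so the right-hand side of the Euler scheme is already known to
  converge.\<close>

lemma moments_conv_Suc:
  assumes mean: "means_conv W" and mom: "moments_conv W"
  shows "moments_conv (Suc W)"
  unfolding moments_conv_def
proof (intro allI impI)
  fix ks :: "nat list" assume pos: "\<forall>k\<in>set ks. 1 \<le> k" and le: "sum_list ks \<le> Suc W"
  show "unif_conv T (\<lambda>N n. EE N n (fluct_prod N n ks)) (\<lambda>t. wickr (\<lambda>k l. C k l t) ks)"
  proof (cases "sum_list ks \<le> W")
    case True
    then show ?thesis using mom pos by (simp add: moments_conv_def)
  next
    case False
    then have sum: "sum_list ks = Suc W" using le by simp
    define xs where "xs = [0..<length ks]"
    define \<kappa> where "\<kappa> = nth ks"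
    have ks: "ks = map \<kappa> xs" by (simp add: xs_def \<kappa>_def map_nth)
    have dxs: "distinct xs" by (simp add: xs_def)
    have \<kappa>1: "1 \<le> \<kappa> a" if "a \<in> set xs" for a using pos that ks by auto
    have le1: "k \<le> Suc W" if "k \<in> set ks" for k using member_le_sum_list[OF that] sum by simp
    have sum1: "\<kappa> a + sum_list (map \<kappa> (remove1 a xs)) = Suc W" if "a \<in> set xs" for a
      using sum_list_map_remove1[OF that, of \<kappa>] sum ks by simp
    have sum2: "\<kappa> a + \<kappa> b + sum_list (map \<kappa> (remove1 b (remove1 a xs))) = Suc W" if "a \<in> set xs" "b \<in> set xs - {a}" for a b
      using sum1[OF that(1)] sum_list_map_remove1[of b "remove1 a xs" \<kappa>] that dxs by simp
    let ?w = "\<lambda>t zs. wickr (\<lambda>k l. C k l t) zs"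
    let ?g1 = "\<lambda>N n. EJ N n (\<lambda>s. expand1 (\<lambda>k. fluct N n k (fst s)) (\<lambda>k. incr_dev N n k s) ks)"
    let ?g2 = "\<lambda>N n. EJ N n (\<lambda>s. expand2 (\<lambda>k. fluct N n k (fst s)) (\<lambda>k. incr_dev N n k s) ks)"
    let ?g3 = "\<lambda>N n. EJ N n (\<lambda>s. expand3 (1 / real N) (\<lambda>k. fluct N n k (fst s)) (\<lambda>k. incr_dev N n k s) ks)"
    let ?A = "\<lambda>k j t. real k * rho (k - 1 - j) t"
    let ?Q = "\<lambda>k l t. real k * real l * (rho (k + l - 1) t - rho k t * rho l t)"
    let ?\<phi>1 = "\<lambda>t. \<Sum>a\<in>set xs. \<Sum>j\<in>{1..<\<kappa> a}. ?A (\<kappa> a) j t * ?w t (map (\<kappa>(a := j)) xs)"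
    let ?\<phi>2 = "\<lambda>t. (\<Sum>a\<in>set xs. \<Sum>b\<in>set xs - {a}. ?Q (\<kappa> a) (\<kappa> b) t * ?w t (map \<kappa> (remove1 b (remove1 a xs)))) / 2"

    have g1: "unif_conv T (\<lambda>N n. real N * ?g1 N n) ?\<phi>1"
    proof -
      let ?h = "\<lambda>a N n. real N * EE N n (\<lambda>l. (mean_incr N (\<kappa> a) l - EE N n (mean_incr N (\<kappa> a))) * fluct_prod N n (map \<kappa> (remove1 a xs)) l)"
      have "unif_conv T (?h a) (\<lambda>t. \<Sum>j\<in>{1..<\<kappa> a}. ?A (\<kappa> a) j t * ?w t (map (\<kappa>(a := j)) xs))" if a: "a \<in> set xs" for a
      proof -
        have k: "1 \<le> \<kappa> a" "\<kappa> a \<le> Suc W" using a \<kappa>1 ks le1 by auto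
        have r: "\<forall>k\<in>set (map \<kappa> (remove1 a xs)). 1 \<le> k" "sum_list (map \<kappa> (remove1 a xs)) + (\<kappa> a - 1) \<le> W"
          using \<kappa>1 sum1[OF a] k notin_set_remove1 by (force, simp)
        have c: "unif_conv T (?h a) (\<lambda>t. \<Sum>j\<in>{1..\<kappa> a - 1}. (if j < \<kappa> a then real (\<kappa> a) * rho (\<kappa> a - 1 - j) t else 0) * ?w t (map (\<kappa>(a := j)) xs))"
        proof (rule conv_EE_centred_expn[OF mom expn_mean_incr[OF mean k] r])
          fix j assume j: "j \<in> {1..\<kappa> a - 1}"
          show "1 \<le> k" if "k \<in> set (map (\<kappa>(a := j)) xs)" for k
            using that j \<kappa>1 by (auto split: if_splits)
          have rem: "map (\<kappa>(a := j)) (remove1 a xs) = map \<kappa> (remove1 a xs)" using dxs by auto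
          show "sum_list (map (\<kappa>(a := j)) xs) \<le> W"
            using sum_list_map_remove1[OF a, of "\<kappa>(a := j)"] r(2) j unfolding rem by auto
          fix N n l
          have "fluct_prod N n (map (\<kappa>(a := j)) xs) l = (\<Prod>b\<in>set xs. fluct N n ((\<kappa>(a := j)) b) l)"
            unfolding map_map comp_def by (rule prod_list_map_distinct[OF dxs])
          also have "\<dots> = fluct N n j l * (\<Prod>b\<in>set xs - {a}. fluct N n (\<kappa> b) l)"
            using a by (subst prod.remove[of _ a]) auto
          also have "(\<Prod>b\<in>set xs - {a}. fluct N n (\<kappa> b) l) = fluct_prod N n (map \<kappa> (remove1 a xs)) l"
            unfolding map_map comp_def using prod_list_map_distinct[of "remove1 a xs" "\<lambda>b. fluct N n (\<kappa> b) l"] dxs by simp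
          finally show "fluct_prod N n (map (\<kappa>(a := j)) xs) l = fluct N n j l * fluct_prod N n (map \<kappa> (remove1 a xs)) l" .
        qed
        show ?thesis by (rule conv_cong[OF c]) (use k in \<open>auto intro!: sum.cong\<close>)
      qed
      then have "unif_conv T (\<lambda>N n. \<Sum>a\<in>set xs. ?h a N n) ?\<phi>1" by (intro conv_sum)
      then show ?thesis
      proof (rule conv_cong)
        fix N n assume N: "(1::nat) \<le> N"
        have site: "EJ N n (\<lambda>s. incr_dev N n k s * F (fst s)) = EE N n (\<lambda>l. (mean_incr N k l - EE N n (mean_incr N k)) * F l)" for k F
          unfolding EJ_def
        proof (rule EE_cong)
          fix l assume l: "l \<in> GT N"
          have "wgt N l i * (incr_dev N n k (l, i) * F (fst (l, i))) = (wgt N l i * incr N k (l, i) - wgt N l i * EE N n (mean_incr N k)) * F l" for i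
            by (simp add: incr_dev_def algebra_simps)
          then show "(\<Sum>i<N. wgt N l i * (incr_dev N n k (l, i) * F (fst (l, i)))) = (mean_incr N k l - EE N n (mean_incr N k)) * F l"
            by (simp only: sum_distrib_right[symmetric] sum_subtractf site_mean_incr[OF N] sum_wgt[OF l N] mult_1_left)
        qed
        have "?g1 N n = (\<Sum>a\<in>set xs. EE N n (\<lambda>l. (mean_incr N (\<kappa> a) l - EE N n (mean_incr N (\<kappa> a))) * fluct_prod N n (map \<kappa> (remove1 a xs)) l))"
          unfolding ks expand_map(1) expand1_eq[OF dxs] EJ_sum
        proof (rule sum.cong)
          fix a
          show "EJ N n (\<lambda>s. incr_dev N n (\<kappa> a) s * (\<Prod>b\<leftarrow>remove1 a xs. fluct N n (\<kappa> b) (fst s))) =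
              EE N n (\<lambda>l. (mean_incr N (\<kappa> a) l - EE N n (mean_incr N (\<kappa> a))) * fluct_prod N n (map \<kappa> (remove1 a xs)) l)"
            using site[of "\<kappa> a" "fluct_prod N n (map \<kappa> (remove1 a xs))"] by (simp add: comp_def)
        qed simp
        then show "(\<Sum>a\<in>set xs. ?h a N n) = real N * ?g1 N n" by (simp add: sum_distrib_left)
      qed simp
    qed

    have g2: "unif_conv T ?g2 ?\<phi>2"
    proof -
      let ?h = "\<lambda>a b N n. EE N n (\<lambda>l. (\<Sum>i<N. wgt N l i * (incr_dev N n (\<kappa> a) (l, i) * incr_dev N n (\<kappa> b) (l, i))) * fluct_prod N n (map \<kappa> (remove1 b (remove1 a xs))) l)"
      have "unif_conv T (?h a b) (\<lambda>t. ?Q (\<kappa> a) (\<kappa> b) t * ?w t (map \<kappa> (remove1 b (remove1 a xs))))"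
        if ab: "a \<in> set xs" "b \<in> set xs - {a}" for a b
      proof -
        have k: "1 \<le> \<kappa> a" "1 \<le> \<kappa> b" "\<kappa> a + \<kappa> b \<le> Suc W" using ab \<kappa>1 sum2[OF ab] by auto
        obtain \<phi> where "expn W (\<kappa> a + \<kappa> b - 2) (\<lambda>N n p. \<Sum>i<N. wgt N p i * (incr_dev N n (\<kappa> a) (p, i) * incr_dev N n (\<kappa> b) (p, i)))
           (?Q (\<kappa> a) (\<kappa> b)) \<phi>" using expn_incr_dev_pair[OF mean mom k] by blast
        then show ?thesis
        proof (rule conv_EE_expn[OF mom])
          show "\<forall>k\<in>set (map \<kappa> (remove1 b (remove1 a xs))). 1 \<le> k" using \<kappa>1 notin_set_remove1 by force
          show "sum_list (map \<kappa> (remove1 b (remove1 a xs))) + (\<kappa> a + \<kappa> b - 2) \<le> W"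
            using sum2[OF ab] k by simp
        qed
      qed
      then have "unif_conv T (\<lambda>N n. 1 / 2 * (\<Sum>a\<in>set xs. \<Sum>b\<in>set xs - {a}. ?h a b N n))
         (\<lambda>t. 1 / 2 * (\<Sum>a\<in>set xs. \<Sum>b\<in>set xs - {a}. ?Q (\<kappa> a) (\<kappa> b) t * ?w t (map \<kappa> (remove1 b (remove1 a xs)))))"
        by (intro conv_cmult conv_sum)
      then show ?thesis
      proof (rule conv_cong)
        fix N n assume N: "(1::nat) \<le> N"
        have site: "EJ N n (\<lambda>s. incr_dev N n k s * incr_dev N n k' s * F (fst s)) = EE N n (\<lambda>l. (\<Sum>i<N. wgt N l i * (incr_dev N n k (l, i) * incr_dev N n k' (l, i))) * F l)" for k k' F
          unfolding EJ_def by (simp add: sum_distrib_right mult.assoc)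
        have "?g2 N n = EJ N n (\<lambda>s. 1 / 2 * (\<Sum>a\<in>set xs. \<Sum>b\<in>set xs - {a}. incr_dev N n (\<kappa> a) s * incr_dev N n (\<kappa> b) s * fluct_prod N n (map \<kappa> (remove1 b (remove1 a xs))) (fst s)))"
          unfolding ks expand_map(2) expand2_eq[OF dxs] by (simp add: comp_def)
        then show "1 / 2 * (\<Sum>a\<in>set xs. \<Sum>b\<in>set xs - {a}. ?h a b N n) = ?g2 N n"
          unfolding EJ_cmult EJ_sum
            site[of "\<kappa> a" "\<kappa> b" "fluct_prod N n (map \<kappa> (remove1 b (remove1 a xs)))" for a b] by (rule sym)
      qed simp
    qed

    have g3: "unif_conv T (\<lambda>N n. ?g3 N n / real N) (\<lambda>t. 0)"
    proof (rule conv_Bdd_div_N)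
      have "M.mlt W (sum_list ks - 1) (\<lambda>N n s. expand3 (1 / real N) (\<lambda>k. fluct N n k (fst s)) (\<lambda>k. incr_dev N n k s) ks)"
        using M_expand(4)[OF mean mom] pos le1 by blast
      then show "unif_bdd T ?g3"
        using M.mlt_bounded[OF M_test_one[OF mean mom], of "sum_list ks - 1" _ "[]"] sum by simp
    qed

    let ?g = "\<lambda>N n. real N * ?g1 N n + ?g2 N n + ?g3 N n / real N"
    let ?\<phi> = "\<lambda>t. ?\<phi>1 t + ?\<phi>2 t"
    have g: "unif_conv T ?g ?\<phi>" by (rule conv_cong[OF conv_add[OF conv_add[OF g1 g2] g3]]) simp_all
    show ?thesis
    proof (rule conv_from_increments[OF g])
      show "EE N (Suc n) (fluct_prod N (Suc n) ks) - EE N n (fluct_prod N n ks) = ?g N n / (real N)\<^sup>2" if "1 \<le> N" for N n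
        by (rule EE_increment_fluct_prod[OF that pos])
      show "((\<lambda>t. ?w t ks) has_real_derivative ?\<phi> t) (at t)" for t
        unfolding ks
      proof (rule has_derivative_wickr[where G = "{1..}" and J = "\<lambda>k. {1..<k}"])
        show "(C k l has_real_derivative (\<Sum>j\<in>{1..<k}. ?A k j t * C j l t) + (\<Sum>j\<in>{1..<l}. ?A l j t * C k j t) + ?Q k l t) (at t)"
          if "k \<in> {1..}" "l \<in> {1..}" for k l using that by (intro C_deriv) auto
        show "?Q k l t = ?Q l k t" for k l by (simp add: mult_ac add.commute)
      qed (use dxs \<kappa>1 in auto)
      \<comment> \<open>The chain starts from a fixed signature, so all fluctuations vanish at time
        0, and so does every Wick sum of a nonempty list because \<open>C\<close> starts at
        0.\<close>
      obtain k js where kj: "ks = k # js" using sum by (cases ks) auto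
      have "fluct_prod N 0 ks (replicate N 0) = 0" for N using kj by (simp add: fluct_def)
      moreover have "?w 0 ks = 0"
        unfolding kj wickr_Cons using pos kj by (intro sum.neutral) (auto simp: C_init)
      ultimately show "(\<lambda>N. EE N 0 (fluct_prod N 0 ks)) \<longlonglongrightarrow> ?w 0 ks" by simp
    qed (rule T_pos)
  qed
qed

theorem moments_converge:
  assumes "\<forall>k\<in>set ks. 1 \<le> k"
  shows "unif_conv T (\<lambda>N n. EE N n (fluct_prod N n ks)) (\<lambda>t. wickr (\<lambda>k l. C k l t) ks)"
proof -
  have "means_conv W \<and> moments_conv W" for W
  proof (induction W)
    case 0
    have 1: "mean_pk 0 N n = 1" if "N \<ge> 1" for N n
      using that by (simp add: mean_pk_def pk_pos[abs_def] EE_const)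
    have x0: "x 0 t = 1" for t
    proof -
      have "\<forall>t. (x 0 has_real_derivative 0) (at t)" using x_deriv[of 0] by simp
      then have "x 0 t = x 0 0" by (rule DERIV_isconst_all)
      then show ?thesis by (simp add: x_init)
    qed
    have "unif_conv T (mean_pk 0) (x 0)" by (rule conv_cong[OF conv_const[of T 1]]) (simp_all add: 1 x0)
    moreover have "unif_conv T (\<lambda>N n. EE N n (fluct_prod N n ks)) (\<lambda>t. wickr (\<lambda>k l. C k l t) ks)"
      if "\<forall>k\<in>set ks. 1 \<le> k" "sum_list ks \<le> 0" for ks
    proof -
      have "ks = []" using that by (cases ks) auto
      then show ?thesis by (intro conv_cong[OF conv_const[of T 1]]) (simp_all add: EE_const)
    qed
    ultimately show ?case by (auto simp: means_conv_def moments_conv_def)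
  next
    case (Suc W)
    then show ?case using means_conv_Suc moments_conv_Suc by blast
  qed
  then show ?thesis using assms by (auto simp: moments_conv_def)
qed

end

section \<open>The limit shape and the limiting covariance\<close>

text \<open>This is u f(u) for the function f of the covariance formula, since f(u) = (1 + u) (1 + c
  u) / u. Laurent coefficients of f^k become coefficients of the power series
  \<open>symb c ^ k\<close>.\<close>

definition symb :: "real \<Rightarrow> real fps" where
  "symb c = (1 + fps_X) * (1 + fps_const c * fps_X)"

text \<open>\<open>usymb c\<close> is the power series \<open>u / ((1 + u) (1 + c u))\<close>, the reciprocal of the function
  \<open>f(u) = 1/u + 1 + c + c u\<close> of the covariance formula.\<close>

definition usymb :: "real \<Rightarrow> real fps" where
  "usymb c = fps_X * inverse (symb c)"

lemma symb_0 [simp]: "symb c $ 0 = 1"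
  by (simp add: symb_def)

lemma usymb_0 [simp]: "usymb c $ 0 = 0"
  by (simp add: usymb_def)

lemma usymb_1 [simp]: "usymb c $ Suc 0 = 1"
  by (simp add: usymb_def)

lemma symb_usymb: "symb c * usymb c = fps_X"
  by (simp add: usymb_def mult.left_commute mult.commute[of "symb c"] inverse_mult_eq_1)

lemma symb_power_usymb_power:
  "symb c ^ k * usymb c ^ m = (if m \<le> k then fps_X ^ m * symb c ^ (k - m) else fps_X ^ k * usymb c ^ (m - k))"
proof (cases "m \<le> k")
  case True
  then obtain d where d: "k = m + d" using le_Suc_ex by blast
  have "symb c ^ k * usymb c ^ m = (symb c * usymb c) ^ m * symb c ^ d"
    unfolding d power_add power_mult_distrib by (simp only: mult_ac)
  then show ?thesis using True d by (simp add: symb_usymb)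
next
  case False
  then obtain d where d: "m = k + d" using le_Suc_ex nat_le_linear by blast
  have "symb c ^ k * usymb c ^ m = (symb c * usymb c) ^ k * usymb c ^ d"
    unfolding d power_add power_mult_distrib by (simp only: mult_ac)
  then show ?thesis using False d by (simp add: symb_usymb)
qed

lemma usymb_power_nth_low:
  assumes "n < m"
  shows "(usymb c ^ m * S) $ n = 0"
proof -
  have "usymb c ^ m * S = fps_X ^ m * (inverse (symb c) ^ m * S)"
    by (simp add: usymb_def power_mult_distrib mult_ac)
  then show ?thesis using assms by (simp only: fps_X_power_mult_nth) simp
qed

text \<open>Lagrange inversion in residue form: reading off a coefficient of \<open>B\<close> from \<open>B \<circ> (1/f)\<close>.\<close>

lemma lagrange_power: "(symb c ^ Suc n * usymb c ^ m * fps_deriv (usymb c)) $ n = (if m = n then 1 else 0)"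
proof (cases "m \<le> n")
  case False
  then have "(usymb c ^ m * (symb c ^ Suc n * fps_deriv (usymb c))) $ n = 0" by (intro usymb_power_nth_low) simp
  then show ?thesis using False by (simp only: mult_ac) simp
next
  case True
  define p where "p = n - m"
  have np: "n = m + p" using True by (simp add: p_def)
  have "symb c ^ Suc n * usymb c ^ m = fps_X ^ m * symb c ^ Suc p"
    unfolding symb_power_usymb_power using True by (simp add: p_def Suc_diff_le)
  then have e: "(symb c ^ Suc n * usymb c ^ m * fps_deriv (usymb c)) $ n = (symb c ^ Suc p * fps_deriv (usymb c)) $ p"
    by (simp only: mult.assoc fps_X_power_mult_nth) (simp add: np)
  have "fps_deriv (symb c * usymb c) = 1" by (simp add: symb_usymb)
  then have d: "symb c * fps_deriv (usymb c) + fps_deriv (symb c) * usymb c = 1" by simp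
  show ?thesis
  proof (cases "p = 0")
    case True
    then show ?thesis unfolding e by (simp add: np)
  next
    case False
    \<comment> \<open>For p > 0 the coefficient is the residue of f^(p+1) (1/f)' = - f^(p-1) f', an
      exact derivative, hence 0. The computation below is this remark in terms of u f(u).\<close>
    have "symb c ^ Suc p * fps_deriv (usymb c) = symb c ^ p * (symb c * fps_deriv (usymb c))" by simp
    also have "symb c * fps_deriv (usymb c) = 1 - fps_deriv (symb c) * usymb c"
      using d by (simp add: algebra_simps)
    also have "symb c ^ p * (1 - fps_deriv (symb c) * usymb c) = symb c ^ p - symb c ^ p * fps_deriv (symb c) * usymb c"
      by (simp only: right_diff_distrib mult_1_right mult.assoc)
    also have "symb c ^ p * fps_deriv (symb c) * usymb c = symb c ^ (p - 1) * fps_deriv (symb c) * (symb c * usymb c)"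
      using False by (cases p) (simp_all add: mult_ac)
    finally have s: "symb c ^ Suc p * fps_deriv (usymb c) = symb c ^ p - fps_X * (symb c ^ (p - 1) * fps_deriv (symb c))"
      unfolding symb_usymb by (simp add: mult_ac)
    have "fps_deriv (symb c ^ p) = of_nat p * (symb c ^ (p - 1) * fps_deriv (symb c))"
      by (simp add: fps_deriv_power mult_ac fps_of_nat)
    then have "fps_deriv (symb c ^ p) $ (p - 1) = real p * (symb c ^ (p - 1) * fps_deriv (symb c)) $ (p - 1)"
      by (simp add: fps_of_nat[symmetric] del: fps_of_nat)
    then have "(symb c ^ p) $ p = (symb c ^ (p - 1) * fps_deriv (symb c)) $ (p - 1)"
      using False by simp
    then show ?thesis unfolding e s using False np by (simp add: fps_X_mult_nth)
  qed
qed

lemma lagrange_inversion: "(symb c ^ Suc n * (fps_compose B (usymb c) * fps_deriv (usymb c))) $ n = B $ n"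
proof -
  have split: "B = (\<Sum>m\<le>n. fps_const (B $ m) * fps_X ^ m) + fps_X ^ Suc n * fps_shift (Suc n) B"
  proof (rule fps_ext)
    fix i
    have "(\<Sum>m\<le>n. fps_const (B $ m) * fps_X ^ m) $ i = (if i \<le> n then B $ i else 0)"
      by (simp add: fps_sum_nth if_distrib cong: if_cong)
    then show "B $ i = ((\<Sum>m\<le>n. fps_const (B $ m) * fps_X ^ m) + fps_X ^ Suc n * fps_shift (Suc n) B) $ i"
      by (simp add: fps_X_power_mult_nth del: power_Suc)
  qed
  have "fps_compose B (usymb c) = (\<Sum>m\<le>n. fps_const (B $ m) * usymb c ^ m) + usymb c ^ Suc n * fps_compose (fps_shift (Suc n) B) (usymb c)"
    by (subst split) (simp add: fps_compose_add_distrib fps_compose_sum_distrib fps_compose_mult_distrib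
        fps_compose_power[symmetric] del: power_Suc)
  then have "symb c ^ Suc n * (fps_compose B (usymb c) * fps_deriv (usymb c)) =
     (\<Sum>m\<le>n. fps_const (B $ m) * (symb c ^ Suc n * usymb c ^ m * fps_deriv (usymb c))) +
     usymb c ^ Suc n * (fps_compose (fps_shift (Suc n) B) (usymb c) * (symb c ^ Suc n * fps_deriv (usymb c)))"
    by (simp add: distrib_left distrib_right sum_distrib_left sum_distrib_right mult_ac del: power_Suc)
  then have "(symb c ^ Suc n * (fps_compose B (usymb c) * fps_deriv (usymb c))) $ n =
     (\<Sum>m\<le>n. B $ m * (symb c ^ Suc n * usymb c ^ m * fps_deriv (usymb c)) $ n) + 0"
    using usymb_power_nth_low[of n "Suc n" c] by (simp add: fps_sum_nth del: power_Suc)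
  also have "\<dots> = B $ n" unfolding lagrange_power by (simp add: if_distrib cong: if_cong)
  finally show ?thesis .
qed

text \<open>The residue of f^k divided by k; by Lagrange inversion, the coefficient of v^k when 1 +
  u is expanded in v = 1/f(u).\<close>

definition lim_rho :: "nat \<Rightarrow> real \<Rightarrow> real" where
  "lim_rho k c = (if k = 0 then 1 else (symb c ^ k) $ (k - 1) / real k)"

text \<open>The residue of f^(k+1) / (1 + u) divided by k + 1, with the factor 1 + u cancelled. It
  is the limit of the mean of p_k / N^(k+1).\<close>

definition lim_x :: "nat \<Rightarrow> real \<Rightarrow> real" where
  "lim_x k c = ((1 + fps_X) ^ k * (1 + fps_const c * fps_X) ^ Suc k) $ k / real (Suc k)"

definition rho_fps :: "real \<Rightarrow> real fps" where
  "rho_fps c = fps_compose (1 + fps_X) (fps_inv (usymb c))"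

lemma rho_fps_compose: "fps_compose (rho_fps c) (usymb c) = 1 + fps_X"
proof -
  have "fps_compose (fps_inv (usymb c)) (usymb c) = fps_X" by (rule fps_inv) simp_all
  moreover have "rho_fps c = 1 + fps_inv (usymb c)"
    by (simp add: rho_fps_def fps_compose_add_distrib fps_X_fps_compose_startby0 fps_inv_def)
  ultimately show ?thesis by (simp add: fps_compose_add_distrib)
qed

lemma rho_fps_0: "rho_fps c $ 0 = 1"
proof -
  have "fps_compose (rho_fps c) (usymb c) $ 0 = 1" by (simp add: rho_fps_compose)
  then show ?thesis by simp
qed

lemma rho_fps_deriv: "fps_compose (fps_deriv (rho_fps c)) (usymb c) * fps_deriv (usymb c) = 1"
proof -
  have "fps_deriv (fps_compose (rho_fps c) (usymb c)) = 1" by (simp add: rho_fps_compose)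
  then show ?thesis by (simp add: fps_compose_deriv)
qed

lemma rho_fps_nth: "rho_fps c $ m = lim_rho m c"
proof (cases m)
  case 0
  then show ?thesis by (simp add: lim_rho_def rho_fps_0)
next
  case (Suc n)
  have "(symb c ^ Suc n) $ n = fps_deriv (rho_fps c) $ n"
    using lagrange_inversion[of c n "fps_deriv (rho_fps c)"] unfolding rho_fps_deriv by simp
  then show ?thesis using Suc by (simp add: lim_rho_def)
qed

text \<open>The logarithmic derivative of the series of the rho_m. In the variable v = 1/f that
  series is 1 + u, so Lagrange inversion turns its coefficients into residues of f^(n+1) / (1 +
  u).\<close>

lemma lim_x_nth: "(fps_deriv (rho_fps c) * inverse (rho_fps c)) $ n = real (Suc n) * lim_x n c"
proof -
  have "fps_compose (fps_deriv (rho_fps c) * inverse (rho_fps c)) (usymb c) * fps_deriv (usymb c) =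
    fps_compose (inverse (rho_fps c)) (usymb c) * (fps_compose (fps_deriv (rho_fps c)) (usymb c) * fps_deriv (usymb c))"
    by (simp add: fps_compose_mult_distrib mult_ac)
  also have "\<dots> = inverse (1 + fps_X)"
    unfolding rho_fps_deriv using fps_inverse_compose[of "usymb c" "rho_fps c"] by (simp add: rho_fps_0 rho_fps_compose)
  finally have "(fps_deriv (rho_fps c) * inverse (rho_fps c)) $ n = (symb c ^ Suc n * inverse (1 + fps_X)) $ n"
    using lagrange_inversion[of c n "fps_deriv (rho_fps c) * inverse (rho_fps c)"] by simp
  also have "symb c ^ Suc n * inverse (1 + fps_X) = (1 + fps_X) ^ n * (1 + fps_const c * fps_X) ^ Suc n * ((1 + fps_X) * inverse (1 + fps_X))"
    unfolding symb_def power_mult_distrib power_Suc[of "1 + fps_X"] by (simp only: mult_ac)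
  also have "(1 + fps_X) * inverse (1 + fps_X) = (1 :: real fps)"
    by (rule inverse_mult_eq_1') simp
  finally show ?thesis by (simp add: lim_x_def)
qed

lemma lim_rho_Newton: "real m * lim_rho m c = (\<Sum>a<m. real (Suc a) * lim_x a c * lim_rho (m - Suc a) c)"
proof (cases m)
  case (Suc n)
  have "fps_deriv (rho_fps c) = (fps_deriv (rho_fps c) * inverse (rho_fps c)) * rho_fps c"
    using inverse_mult_eq_1[of "rho_fps c"] by (simp add: rho_fps_0 mult.assoc)
  then have "fps_deriv (rho_fps c) $ n = ((fps_deriv (rho_fps c) * inverse (rho_fps c)) * rho_fps c) $ n"
    by (rule arg_cong[where f = "\<lambda>F. F $ n"])
  then have "real (Suc n) * lim_rho (Suc n) c = (\<Sum>a=0..n. real (Suc a) * lim_x a c * lim_rho (n - a) c)"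
    unfolding fps_mult_nth[of _ "rho_fps c"] lim_x_nth rho_fps_nth by (simp add: rho_fps_nth)
  then show ?thesis unfolding Suc by (simp add: lessThan_Suc_atMost atLeast0AtMost del: of_nat_Suc)
qed simp

section \<open>Dependence of the limits on the macroscopic time\<close>

definition coeff_deriv :: "(real \<Rightarrow> real fps) \<Rightarrow> real fps \<Rightarrow> real \<Rightarrow> bool" where
  "coeff_deriv F F' t \<longleftrightarrow> (\<forall>n. ((\<lambda>s. F s $ n) has_real_derivative F' $ n) (at t))"

lemma coeff_deriv_const: "coeff_deriv (\<lambda>s. F) 0 t"
  by (simp add: coeff_deriv_def)

lemma coeff_deriv_linear: "coeff_deriv (\<lambda>s. 1 + fps_const s * fps_X) fps_X t"
  unfolding coeff_deriv_def
proof
  fix n show "((\<lambda>s. (1 + fps_const s * fps_X) $ n) has_real_derivative fps_X $ n) (at t)"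
    by (cases "n = 1") (auto intro!: derivative_eq_intros)
qed

lemma coeff_deriv_mult:
  assumes "coeff_deriv F F' t" "coeff_deriv G G' t"
  shows "coeff_deriv (\<lambda>s. F s * G s) (F' * G t + F t * G') t"
  unfolding coeff_deriv_def
proof
  fix n
  have "((\<lambda>s. \<Sum>i=0..n. F s $ i * G s $ (n - i)) has_real_derivative
      (\<Sum>i=0..n. F t $ i * G' $ (n - i) + F' $ i * G t $ (n - i))) (at t)"
    using assms by (intro DERIV_sum DERIV_mult') (auto simp: coeff_deriv_def)
  then show "((\<lambda>s. (F s * G s) $ n) has_real_derivative (F' * G t + F t * G') $ n) (at t)"
    by (simp add: fps_mult_nth sum.distrib add.commute)
qed

lemma coeff_deriv_power:
  assumes "coeff_deriv F F' t"
  shows "coeff_deriv (\<lambda>s. F s ^ k) (of_nat k * F t ^ (k - 1) * F') t"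
proof (induction k)
  case (Suc k)
  have "F' * F t ^ k + F t * (of_nat k * F t ^ (k - 1) * F') = of_nat (Suc k) * F t ^ (Suc k - 1) * F'"
    by (cases k) (simp_all add: algebra_simps)
  then show ?case using coeff_deriv_mult[OF assms Suc] by simp
qed (simp add: coeff_deriv_const)

lemma coeff_deriv_symb: "coeff_deriv symb ((1 + fps_X) * fps_X) t"
  unfolding symb_def[abs_def] using coeff_deriv_mult[OF coeff_deriv_const coeff_deriv_linear, of "1 + fps_X" t]
  by simp

lemma of_nat_mult_nth: "(of_nat k * F) $ n = real k * F $ n" for F :: "real fps"
  by (simp flip: fps_of_nat)

text \<open>Differentiating (1 + c u)^(k+1) in c produces (k + 1) u (1 + c u)^k, which completes a
  k-th power of u f(u) and turns the coefficient into the residue of f^k.\<close>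

lemma lim_x_deriv: "(lim_x k has_real_derivative real k * lim_rho k c) (at c)"
proof -
  have "coeff_deriv (\<lambda>s. (1 + fps_X) ^ k * (1 + fps_const s * fps_X) ^ Suc k)
     (0 * (1 + fps_const c * fps_X) ^ Suc k + (1 + fps_X) ^ k * (of_nat (Suc k) * (1 + fps_const c * fps_X) ^ (Suc k - 1) * fps_X)) c"
    by (rule coeff_deriv_mult[OF coeff_deriv_const coeff_deriv_power[OF coeff_deriv_linear]])
  also have "0 * (1 + fps_const c * fps_X) ^ Suc k + (1 + fps_X) ^ k * (of_nat (Suc k) * (1 + fps_const c * fps_X) ^ (Suc k - 1) * fps_X)
     = of_nat (Suc k) * (fps_X * symb c ^ k)"
    by (simp only: mult_zero_left add_0 symb_def power_mult_distrib diff_Suc_1 mult_ac)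
  finally have "((\<lambda>s. ((1 + fps_X) ^ k * (1 + fps_const s * fps_X) ^ Suc k) $ k) has_real_derivative
     real (Suc k) * (fps_X * symb c ^ k) $ k) (at c)"
    unfolding coeff_deriv_def of_nat_mult_nth by blast
  then have "((\<lambda>s. ((1 + fps_X) ^ k * (1 + fps_const s * fps_X) ^ Suc k) $ k / real (Suc k)) has_real_derivative
     real (Suc k) * (fps_X * symb c ^ k) $ k / real (Suc k)) (at c)"
    by (rule DERIV_cdivide)
  moreover have "real (Suc k) * (fps_X * symb c ^ k) $ k / real (Suc k) = real k * lim_rho k c"
    by (cases k) (simp_all add: lim_rho_def del: of_nat_Suc)
  ultimately show ?thesis unfolding lim_x_def by simp
qed

lemma lim_x_init: "lim_x k 0 = 1 / real (Suc k)"
proof -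
  have "((1 + fps_X) ^ k :: real fps) = fps_of_poly ([:1, 1:] ^ k)"
    by (simp add: fps_of_poly_power fps_of_poly_pCons)
  then have "((1 + fps_X) ^ k :: real fps) $ k = coeff ([:1, 1:] ^ k) k"
    by (simp only: fps_of_poly_nth)
  also have "\<dots> = 1" using lead_coeff_power[of "[:1, 1 :: real:]" k] by (simp add: degree_power_eq)
  finally show ?thesis by (simp add: lim_x_def)
qed

text \<open>\<open>laurent k S q\<close> is the coefficient of \<open>u^q\<close> in the Laurent series \<open>S / u^k\<close>.\<close>

definition laurent :: "nat \<Rightarrow> real fps \<Rightarrow> int \<Rightarrow> real" where
  "laurent k S q = (if int k + q < 0 then 0 else S $ nat (int k + q))"

lemma laurent_add: "laurent k (S + R) q = laurent k S q + laurent k R q"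
  by (simp add: laurent_def)

lemma laurent_cmult: "laurent k (fps_const a * S) q = a * laurent k S q"
  by (simp add: laurent_def)

lemma laurent_sum: "laurent k (\<Sum>i\<in>A. S i) q = (\<Sum>i\<in>A. laurent k (S i) q)"
  by (simp add: laurent_def fps_sum_nth)

lemma laurent_fps_X_power: "m \<le> k \<Longrightarrow> laurent k (fps_X ^ m * S) q = laurent (k - m) S q"
  by (auto simp: laurent_def fps_X_power_mult_nth nat_diff_distrib' of_nat_diff
      intro!: arg_cong[of _ _ "\<lambda>i. S $ i"])

definition apow :: "real \<Rightarrow> nat \<Rightarrow> int \<Rightarrow> real" where
  "apow c k q = laurent k (symb c ^ k) q"

text \<open>The double contour integral after expanding 1/(z - w)^2 as the sum of q z^(q-1) w^(-q-1)
  for |z| < |w|; \<open>apow c k q\<close> is the coefficient of u^q in f^k. The sum stops at k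
  because f^k has no term below u^(-k).\<close>

definition lim_cov :: "nat \<Rightarrow> nat \<Rightarrow> real \<Rightarrow> real" where
  "lim_cov k l c = - c * apow c k (- 1) * apow c l (- 1) + (\<Sum>q=1..k. real q * apow c k (- int q) * apow c l (int q))"

text \<open>The coefficient of u^q in (1 + u) f^(k-1). Here 1 + u is the derivative of f in
  c.\<close>

definition dpow :: "real \<Rightarrow> nat \<Rightarrow> int \<Rightarrow> real" where
  "dpow c k q = laurent (k - 1) ((1 + fps_X) * symb c ^ (k - 1)) q"

lemma apow_residue: "apow c k (- 1) = real k * lim_rho k c"
  by (cases k) (simp_all add: apow_def laurent_def lim_rho_def)

lemma apow_low: "q < - int k \<Longrightarrow> apow c k q = 0"
  by (simp add: apow_def laurent_def)

lemma apow_0: "q \<noteq> 0 \<Longrightarrow> apow c 0 q = 0"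
  by (auto simp: apow_def laurent_def)

lemma apow_deriv: "((\<lambda>s. apow s k q) has_real_derivative real k * dpow c k q) (at c)"
proof (cases "int k + q < 0 \<or> k = 0")
  case True
  then have "(\<lambda>s. apow s k q) = (\<lambda>s. apow 0 k q)" "real k * dpow c k q = 0"
    by (auto simp: apow_def dpow_def laurent_def)
  then show ?thesis by (simp only: DERIV_const)
next
  case False
  then obtain j where k: "k = Suc j" by (cases k) auto
  let ?n = "nat (int k + q)"
  have "coeff_deriv (\<lambda>s. symb s ^ k) (of_nat k * symb c ^ (k - 1) * ((1 + fps_X) * fps_X)) c"
    by (rule coeff_deriv_power[OF coeff_deriv_symb])
  then have "((\<lambda>s. (symb s ^ k) $ ?n) has_real_derivative (of_nat k * (fps_X * ((1 + fps_X) * symb c ^ (k - 1)))) $ ?n) (at c)"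
    unfolding coeff_deriv_def by (simp only: mult_ac)
  moreover have "(of_nat k * (fps_X * ((1 + fps_X) * symb c ^ (k - 1)))) $ ?n = real k * dpow c k q"
  proof (cases "?n = 0")
    case True
    then have "int (k - 1) + q < 0" using k by linarith
    then show ?thesis using True unfolding of_nat_mult_nth dpow_def laurent_def by simp
  next
    case n0: False
    then have "int (k - 1) + q \<ge> 0" "?n - 1 = nat (int (k - 1) + q)" using k False by linarith+
    then show ?thesis using n0 unfolding of_nat_mult_nth dpow_def laurent_def by (simp add: fps_X_mult_nth)
  qed
  ultimately show ?thesis using False by (simp add: apow_def laurent_def)
qed

text \<open>\<open>1 + u = \<Sum>\<^sub>m \<rho>\<^sub>m f\<^sup>-\<^sup>m\<close> splits \<open>(1 + u) f\<^sup>k\<^sup>-\<^sup>1\<close> into its polynomial part in \<open>f\<close> and a remainder in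
  positive powers of \<open>1/f\<close>.\<close>

lemma one_plus_X_expansion:
  "\<exists>R. 1 + fps_X = (\<Sum>m<M. fps_const (lim_rho m c) * usymb c ^ m) + usymb c ^ M * R"
proof -
  have split: "rho_fps c = (\<Sum>m<M. fps_const (lim_rho m c) * fps_X ^ m) + fps_X ^ M * fps_shift M (rho_fps c)"
  proof (rule fps_ext)
    fix i
    have "(\<Sum>m<M. fps_const (lim_rho m c) * fps_X ^ m) $ i = (if i < M then lim_rho i c else 0)"
      by (simp add: fps_sum_nth if_distrib cong: if_cong)
    then show "rho_fps c $ i = ((\<Sum>m<M. fps_const (lim_rho m c) * fps_X ^ m) + fps_X ^ M * fps_shift M (rho_fps c)) $ i"
      by (simp add: fps_X_power_mult_nth rho_fps_nth)
  qed
  have "1 + fps_X = fps_compose (rho_fps c) (usymb c)" by (simp add: rho_fps_compose)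
  also have "\<dots> = (\<Sum>m<M. fps_const (lim_rho m c) * usymb c ^ m) + usymb c ^ M * fps_compose (fps_shift M (rho_fps c)) (usymb c)"
    by (subst split) (simp add: fps_compose_add_distrib fps_compose_sum_distrib fps_compose_mult_distrib fps_compose_power[symmetric])
  finally show ?thesis by blast
qed

lemma sum_split_at:
  fixes k M :: nat
  assumes "k \<le> M"
  shows "(\<Sum>m<M. F m) = (\<Sum>j<k. F (k - 1 - j)) + (\<Sum>m=k..<M. F m :: real)"
proof -
  have "(\<Sum>m<M. F m) = (\<Sum>m<k. F m) + (\<Sum>m=k..<M. F m)"
    using sum.atLeastLessThan_concat[of 0 k M F] assms by (simp add: atLeast0LessThan)
  also have "(\<Sum>m<k. F m) = (\<Sum>j<k. F (k - 1 - j))"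
    using sum.nat_diff_reindex[of F k] by simp
  finally show ?thesis .
qed

lemma dpow_expansion:
  assumes k: "k \<ge> 1" and M: "k \<le> M"
  shows "\<exists>R. \<forall>q. dpow c k q = (\<Sum>j<k. lim_rho (k - 1 - j) c * apow c j q) +
     (\<Sum>m=k..<M. lim_rho m c * laurent 0 (usymb c ^ (m - k + 1)) q) + laurent 0 (usymb c ^ (M - k + 1) * R) q"
proof -
  obtain R where R: "1 + fps_X = (\<Sum>m<M. fps_const (lim_rho m c) * usymb c ^ m) + usymb c ^ M * R"
    using one_plus_X_expansion by blast
  have low: "laurent (k - 1) (symb c ^ (k - 1) * usymb c ^ m) q = apow c (k - 1 - m) q" if "m \<le> k - 1" for m q
    using that by (simp add: symb_power_usymb_power laurent_fps_X_power apow_def)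
  have high: "laurent (k - 1) (symb c ^ (k - 1) * usymb c ^ m * S) q = laurent 0 (usymb c ^ (m - k + 1) * S) q"
    if "k \<le> m" for m q S
  proof -
    have "symb c ^ (k - 1) * usymb c ^ m * S = fps_X ^ (k - 1) * (usymb c ^ (m - k + 1) * S)"
    proof -
      have "\<not> m \<le> k - 1" "m - (k - 1) = m - k + 1" using that k by auto
      then show ?thesis unfolding symb_power_usymb_power by (simp only: if_False mult.assoc)
    qed
    then show ?thesis by (simp only: laurent_fps_X_power order.refl diff_self_eq_0)
  qed
  have "dpow c k q = (\<Sum>j<k. lim_rho (k - 1 - j) c * apow c j q) +
     (\<Sum>m=k..<M. lim_rho m c * laurent 0 (usymb c ^ (m - k + 1)) q) + laurent 0 (usymb c ^ (M - k + 1) * R) q" for q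
  proof -
    have "(1 + fps_X) * symb c ^ (k - 1) = (\<Sum>m<M. fps_const (lim_rho m c) * (symb c ^ (k - 1) * usymb c ^ m)) +
        symb c ^ (k - 1) * usymb c ^ M * R"
      unfolding R by (simp add: distrib_left distrib_right sum_distrib_left sum_distrib_right mult_ac)
    then have "dpow c k q = (\<Sum>m<M. lim_rho m c * laurent (k - 1) (symb c ^ (k - 1) * usymb c ^ m) q) +
        laurent (k - 1) (symb c ^ (k - 1) * usymb c ^ M * R) q"
      by (simp only: dpow_def laurent_add laurent_sum laurent_cmult)
    also have "(\<Sum>m<M. lim_rho m c * laurent (k - 1) (symb c ^ (k - 1) * usymb c ^ m) q) =
       (\<Sum>j<k. lim_rho (k - 1 - j) c * laurent (k - 1) (symb c ^ (k - 1) * usymb c ^ (k - 1 - j)) q) +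
       (\<Sum>m=k..<M. lim_rho m c * laurent (k - 1) (symb c ^ (k - 1) * usymb c ^ m) q)"
      by (rule sum_split_at[OF M])
    also have "(\<Sum>j<k. lim_rho (k - 1 - j) c * laurent (k - 1) (symb c ^ (k - 1) * usymb c ^ (k - 1 - j)) q) =
       (\<Sum>j<k. lim_rho (k - 1 - j) c * apow c j q)"
      using low by (intro sum.cong) auto
    also have "(\<Sum>m=k..<M. lim_rho m c * laurent (k - 1) (symb c ^ (k - 1) * usymb c ^ m) q) =
       (\<Sum>m=k..<M. lim_rho m c * laurent 0 (usymb c ^ (m - k + 1)) q)"
      using high[of _ 1] by (intro sum.cong) auto
    also have "laurent (k - 1) (symb c ^ (k - 1) * usymb c ^ M * R) q = laurent 0 (usymb c ^ (M - k + 1) * R) q"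
      by (rule high[OF M])
    finally show ?thesis .
  qed
  then show ?thesis by blast
qed

lemma laurent_usymb_low: "q < int p \<Longrightarrow> laurent 0 (usymb c ^ p * R) q = 0"
  using usymb_power_nth_low[of "nat q" p c R] by (auto simp: laurent_def)

text \<open>The positive powers of 1/f in the expansion start at u^1, so coefficients of order at
  most 0 see only the polynomial part in f.\<close>

lemma dpow_nonpos:
  assumes "k \<ge> 1" "q \<le> 0"
  shows "dpow c k q = (\<Sum>j<k. lim_rho (k - 1 - j) c * apow c j q)"
proof -
  obtain R where "\<forall>q. dpow c k q = (\<Sum>j<k. lim_rho (k - 1 - j) c * apow c j q) +
     (\<Sum>m=k..<k. lim_rho m c * laurent 0 (usymb c ^ (m - k + 1)) q) + laurent 0 (usymb c ^ (k - k + 1) * R) q"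
    using dpow_expansion[OF assms(1) order.refl] by blast
  then show ?thesis using laurent_usymb_low[of q "k - k + 1" c R] assms(2) by simp
qed

text \<open>The double-pole term of the kernel sends \<open>(f\<^sup>k, f\<^sup>-\<^sup>p)\<close> to the residue of \<open>f\<^sup>k (f\<^sup>-\<^sup>p)'\<close>.\<close>

lemma residue_pairing:
  assumes "k \<ge> 1" "p \<ge> 1"
  shows "(\<Sum>q=1..k. real q * apow c k (- int q) * laurent 0 (usymb c ^ p) (int q)) = (if p = k then real k else 0)"
proof -
  obtain j where k: "k = Suc j" using assms(1) by (cases k) auto
  have "(\<Sum>q=1..k. real q * apow c k (- int q) * laurent 0 (usymb c ^ p) (int q)) =
      (\<Sum>q=1..k. (fps_X * fps_deriv (usymb c ^ p)) $ q * (symb c ^ k) $ (k - q))"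
  proof (rule sum.cong)
    fix q assume q: "q \<in> {1..k}"
    have "nat (int k - int q) = k - q" by simp
    moreover have "(fps_X * fps_deriv (usymb c ^ p)) $ q = real q * (usymb c ^ p) $ q"
      using q by (cases q) simp_all
    ultimately show "real q * apow c k (- int q) * laurent 0 (usymb c ^ p) (int q) =
        (fps_X * fps_deriv (usymb c ^ p)) $ q * (symb c ^ k) $ (k - q)"
      using q by (simp add: apow_def laurent_def)
  qed simp
  also have "\<dots> = (\<Sum>q=0..k. (fps_X * fps_deriv (usymb c ^ p)) $ q * (symb c ^ k) $ (k - q))"
    by (rule sum.mono_neutral_left) (auto simp: not_less_eq_eq)
  also have "\<dots> = (fps_X * (fps_deriv (usymb c ^ p) * symb c ^ k)) $ k"
    by (simp only: fps_mult_nth mult.assoc[symmetric])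
  also have "\<dots> = (of_nat p * (symb c ^ Suc j * usymb c ^ (p - 1) * fps_deriv (usymb c))) $ j"
    unfolding k by (simp add: fps_deriv_power fps_of_nat mult_ac)
  also have "\<dots> = real p * (if p - 1 = j then 1 else 0)"
    unfolding of_nat_mult_nth lagrange_power ..
  also have "\<dots> = (if p = k then real k else 0)" using assms k by auto
  finally show ?thesis .
qed

lemma bilinear_sum:
  fixes b :: real
  shows "(\<Sum>j\<in>J. r j * (b * A j + (\<Sum>q\<in>Q. F q * D j q))) = b * (\<Sum>j\<in>J. r j * A j) + (\<Sum>q\<in>Q. F q * (\<Sum>j\<in>J. r j * D j q))"
proof -
  have "(\<Sum>j\<in>J. r j * (\<Sum>q\<in>Q. F q * D j q)) = (\<Sum>q\<in>Q. F q * (\<Sum>j\<in>J. r j * D j q))"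
    unfolding sum_distrib_left by (subst sum.swap) (simp add: mult.left_commute)
  moreover have "(\<Sum>j\<in>J. r j * (b * A j)) = b * (\<Sum>j\<in>J. r j * A j)"
    unfolding sum_distrib_left by (simp add: mult.left_commute)
  ultimately show ?thesis by (simp add: distrib_left sum.distrib)
qed

lemma lim_cov_0: "k = 0 \<or> l = 0 \<Longrightarrow> lim_cov k l c = 0"
  by (auto simp: lim_cov_def apow_0 intro!: sum.neutral)

text \<open>Coefficients of f^k below order -k vanish, so covariances with different first orders
  can share one range of summation.\<close>

lemma lim_cov_upper:
  assumes "k \<le> n"
  shows "lim_cov k l c = - c * apow c k (- 1) * apow c l (- 1) + (\<Sum>q=1..n. real q * apow c k (- int q) * apow c l (int q))"
proof -
  have "(\<Sum>q=1..k. real q * apow c k (- int q) * apow c l (int q)) = (\<Sum>q=1..n. real q * apow c k (- int q) * apow c l (int q))"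
    using assms by (intro sum.mono_neutral_left) (auto simp: apow_low)
  then show ?thesis by (simp add: lim_cov_def)
qed

text \<open>At c = 0 the function is f = 1/u + 1, whose powers have no positive exponents.\<close>

lemma lim_cov_init:
  assumes "k \<ge> 1" "l \<ge> 1"
  shows "lim_cov k l 0 = 0"
proof -
  have "apow 0 l (int q) = 0" if "q \<ge> 1" for q
  proof -
    have "symb 0 ^ l = fps_of_poly ([:1, 1:] ^ l)"
      by (simp add: symb_def fps_of_poly_power fps_of_poly_pCons)
    then have "(symb 0 ^ l) $ (l + q) = coeff ([:1, 1:] ^ l) (l + q)"
      by (simp only: fps_of_poly_nth)
    also have "\<dots> = 0" using that by (intro coeff_eq_0) (simp add: degree_power_eq)
    finally show ?thesis by (simp add: apow_def laurent_def nat_add_distrib)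
  qed
  then show ?thesis by (simp add: lim_cov_def)
qed

text \<open>Differentiation in c replaces f^k by k (1 + u) f^(k-1). In the first argument only
  negative coefficients enter, and these give the drift. In the second, positive coefficients enter
  as well, so the tail in powers of 1/f contributes; by \<open>residue_pairing\<close> only f^(-k)
  pairs with f^k, which yields k l rho_(k+l-1). The explicit factor -c yields minus the product of
  the residues k rho_k and l rho_l.\<close>

lemma lim_cov_deriv:
  assumes k: "k \<ge> 1" and l: "l \<ge> 1"
  shows "(lim_cov k l has_real_derivative
        (\<Sum>j\<in>{1..<k}. real k * lim_rho (k - 1 - j) c * lim_cov j l c) +
        (\<Sum>j\<in>{1..<l}. real l * lim_rho (l - 1 - j) c * lim_cov k j c) +
        real k * real l * (lim_rho (k + l - 1) c - lim_rho k c * lim_rho l c)) (at c)"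
proof -
  let ?a = "apow c" and ?d = "dpow c"
  have d0: "(lim_cov k l has_real_derivative
     - c * ?a k (- 1) * (real l * ?d l (- 1)) + (- c * (real k * ?d k (- 1)) + - 1 * ?a k (- 1)) * ?a l (- 1) +
     (\<Sum>q=1..k. real q * ?a k (- int q) * (real l * ?d l (int q)) + real q * (real k * ?d k (- int q)) * ?a l (int q))) (at c)"
    unfolding lim_cov_def
    by (intro DERIV_add DERIV_sum DERIV_mult' DERIV_cmult apow_deriv DERIV_minus DERIV_ident)
  have s1: "- c * ?a k (- 1) * (real l * ?d l (- 1)) + (- c * (real k * ?d k (- 1)) + - 1 * ?a k (- 1)) * ?a l (- 1) +
     (\<Sum>q=1..k. real q * ?a k (- int q) * (real l * ?d l (int q)) + real q * (real k * ?d k (- int q)) * ?a l (int q)) =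
     real k * (- c * ?d k (- 1) * ?a l (- 1) + (\<Sum>q=1..k. real q * ?d k (- int q) * ?a l (int q))) +
     real l * (- c * ?a k (- 1) * ?d l (- 1) + (\<Sum>q=1..k. real q * ?a k (- int q) * ?d l (int q))) - ?a k (- 1) * ?a l (- 1)"
    by (simp add: algebra_simps sum.distrib sum_distrib_left)
  have s2: "- c * ?d k (- 1) * ?a l (- 1) + (\<Sum>q=1..k. real q * ?d k (- int q) * ?a l (int q)) =
      (\<Sum>j<k. lim_rho (k - 1 - j) c * lim_cov j l c)"
  proof -
    have "(\<Sum>j<k. lim_rho (k - 1 - j) c * lim_cov j l c) = (\<Sum>j<k. lim_rho (k - 1 - j) c *
       (- c * ?a l (- 1) * ?a j (- 1) + (\<Sum>q=1..k. real q * ?a l (int q) * ?a j (- int q))))"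
    proof (rule sum.cong)
      fix j assume "j \<in> {..<k}"
      then show "lim_rho (k - 1 - j) c * lim_cov j l c = lim_rho (k - 1 - j) c *
         (- c * ?a l (- 1) * ?a j (- 1) + (\<Sum>q=1..k. real q * ?a l (int q) * ?a j (- int q)))"
        using lim_cov_upper[of j k l c] by (simp add: mult_ac)
    qed simp
    also have "\<dots> = - c * ?a l (- 1) * (\<Sum>j<k. lim_rho (k - 1 - j) c * ?a j (- 1)) +
       (\<Sum>q=1..k. real q * ?a l (int q) * (\<Sum>j<k. lim_rho (k - 1 - j) c * ?a j (- int q)))"
      by (rule bilinear_sum)
    also have "\<dots> = - c * ?d k (- 1) * ?a l (- 1) + (\<Sum>q=1..k. real q * ?d k (- int q) * ?a l (int q))"
      unfolding dpow_nonpos[OF k, of "- 1", simplified] by (simp add: dpow_nonpos[OF k] mult_ac)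
    finally show ?thesis by simp
  qed
  have s3: "- c * ?a k (- 1) * ?d l (- 1) + (\<Sum>q=1..k. real q * ?a k (- int q) * ?d l (int q)) =
      (\<Sum>j<l. lim_rho (l - 1 - j) c * lim_cov k j c) + real k * lim_rho (k + l - 1) c"
  proof -
    \<comment> \<open>Truncation at k + l leaves a remainder of order at least k + 1, outside the
      range q <= k, and keeps the index k + l - 1 that matters.\<close>
    obtain R where R: "\<And>q. ?d l q = (\<Sum>j<l. lim_rho (l - 1 - j) c * ?a j q) +
     (\<Sum>m=l..<k + l. lim_rho m c * laurent 0 (usymb c ^ (m - l + 1)) q) + laurent 0 (usymb c ^ (k + l - l + 1) * R) q"
      using dpow_expansion[OF l, of "k + l" c] by auto
    have R0: "laurent 0 (usymb c ^ (k + l - l + 1) * R) (int q) = 0" if "q \<in> {1..k}" for q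
      using that by (intro laurent_usymb_low) simp
    have "(\<Sum>q=1..k. real q * ?a k (- int q) * ?d l (int q)) =
       (\<Sum>q=1..k. real q * ?a k (- int q) * (\<Sum>j<l. lim_rho (l - 1 - j) c * ?a j (int q))) +
       (\<Sum>q=1..k. real q * ?a k (- int q) * (\<Sum>m=l..<k + l. lim_rho m c * laurent 0 (usymb c ^ (m - l + 1)) (int q)))"
      unfolding sum.distrib[symmetric] distrib_left[symmetric]
      by (intro sum.cong refl) (simp only: R R0 add_0_right)
    also have "(\<Sum>q=1..k. real q * ?a k (- int q) * (\<Sum>m=l..<k + l. lim_rho m c * laurent 0 (usymb c ^ (m - l + 1)) (int q))) =
       (\<Sum>m=l..<k + l. lim_rho m c * (\<Sum>q=1..k. real q * ?a k (- int q) * laurent 0 (usymb c ^ (m - l + 1)) (int q)))"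
      by (simp add: sum_distrib_left mult_ac sum.swap[of _ "{l..<k+l}"])
    also have "\<dots> = (\<Sum>m=l..<k + l. lim_rho m c * (if m - l + 1 = k then real k else 0))"
      using k by (simp only: residue_pairing le_add2)
    also have "\<dots> = (\<Sum>m=l..<k + l. if m = k + l - 1 then lim_rho m c * real k else 0)"
      using k by (intro sum.cong) auto
    also have "\<dots> = real k * lim_rho (k + l - 1) c" using k by simp
    finally have e: "(\<Sum>q=1..k. real q * ?a k (- int q) * ?d l (int q)) =
       (\<Sum>q=1..k. real q * ?a k (- int q) * (\<Sum>j<l. lim_rho (l - 1 - j) c * ?a j (int q))) + real k * lim_rho (k + l - 1) c" .
    have "(\<Sum>j<l. lim_rho (l - 1 - j) c * lim_cov k j c) = - c * ?a k (- 1) * (\<Sum>j<l. lim_rho (l - 1 - j) c * ?a j (- 1)) +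
       (\<Sum>q=1..k. real q * ?a k (- int q) * (\<Sum>j<l. lim_rho (l - 1 - j) c * ?a j (int q)))"
      unfolding lim_cov_def by (rule bilinear_sum)
    then show ?thesis unfolding e by (simp add: dpow_nonpos[OF l])
  qed
  have s4: "(\<Sum>j<k. lim_rho (k - 1 - j) c * lim_cov j l c) = (\<Sum>j\<in>{1..<k}. lim_rho (k - 1 - j) c * lim_cov j l c)"
    by (rule sum.mono_neutral_right) (auto simp: lim_cov_0 not_less_eq_eq)
  have s5: "(\<Sum>j<l. lim_rho (l - 1 - j) c * lim_cov k j c) = (\<Sum>j\<in>{1..<l}. lim_rho (l - 1 - j) c * lim_cov k j c)"
    by (rule sum.mono_neutral_right) (auto simp: lim_cov_0 not_less_eq_eq)
  show ?thesis
    by (rule DERIV_cong[OF d0]) (rule trans[OF s1], unfold s2 s3 s4 s5, unfold apow_residue, simp add: sum_distrib_left algebra_simps)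
qed

section \<open>The contour integral\<close>

lemma circle_integral_eq:
  assumes "(f has_contour_integral I) (circlepath 0 r)"
  shows "circle_integral r f = I"
proof -
  have "((\<lambda>t. f (0 + of_real r * cis t) * of_real r * \<i> * cis t) has_integral I) {0..2 * pi}"
    using assms unfolding circlepath_def by (subst (asm) has_contour_integral_part_circlepath_iff) simp_all
  then have "((\<lambda>t. f (of_real r * exp (\<i> * of_real t)) * (\<i> * of_real r * exp (\<i> * of_real t))) has_integral I) {0..2 * pi}"
    by (simp add: cis_conv_exp mult_ac)
  then show ?thesis unfolding circle_integral_def by (rule integral_unique)
qed

lemma circlepath_powi:
  assumes "r > 0"
  shows "((\<lambda>z. z powi n) has_contour_integral (if n = - 1 then 2 * of_real pi * \<i> else 0)) (circlepath 0 r)"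
proof (cases "n = - 1")
  case True
  have "((\<lambda>u. 1 / (u - 0)) has_contour_integral 2 * of_real pi * \<i> * 1) (circlepath 0 r)"
    using assms by (intro Cauchy_integral_circlepath_simple) (auto intro: holomorphic_intros)
  then show ?thesis using True by (simp add: power_int_minus divide_inverse)
next
  case False
  have n0: "of_int (n + 1) \<noteq> (0 :: complex)" using False by (metis of_int_eq_0_iff add_eq_0_iff2)
  have "((\<lambda>z. z powi n) has_contour_integral 0) (circlepath 0 r)"
  proof (rule Cauchy_theorem_primitive[where S = "- {0}" and f = "\<lambda>z. z powi (n + 1) / of_int (n + 1)"])
    fix z :: complex assume "z \<in> - {0}"
    then have "((\<lambda>z. z powi (n + 1) / of_int (n + 1)) has_field_derivative (of_int (n + 1) * z powi (n + 1 - 1) * 1) / of_int (n + 1)) (at z within - {0})"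
      by (intro DERIV_cdivide DERIV_power_int DERIV_ident) simp
    then show "((\<lambda>z. z powi (n + 1) / of_int (n + 1)) has_field_derivative z powi n) (at z within - {0})"
      using n0 by (simp del: of_int_add)
  qed (use assms in auto)
  then show ?thesis using False by simp
qed

lemma powi_minus_Suc: "z \<noteq> 0 \<Longrightarrow> z powi (- int (Suc q)) = z powi (- int q) / z" for z :: complex
  by (simp add: power_int_minus divide_inverse del: of_nat_Suc)

text \<open>Since w lies outside the circle, q = 0 is Cauchy's theorem; the step uses z^(-q-1) / (z
  - w) = (z^(-q) / (z - w) - z^(-q-1)) / w.\<close>

lemma circlepath_powi_div:
  assumes r: "r > 0" and w: "norm w > r"
  shows "((\<lambda>z. z powi (- int q) / (z - w)) has_contour_integral (if q = 0 then 0 else - (2 * of_real pi * \<i> * w powi (- int q)))) (circlepath 0 r)"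
proof (induction q)
  case 0
  have "((\<lambda>z. 1 / (z - w)) has_contour_integral 0) (circlepath 0 r)"
  proof (rule Cauchy_theorem_convex_simple[of _ "ball 0 (norm w)"])
    show "(\<lambda>z. 1 / (z - w)) holomorphic_on ball 0 (norm w)" by (intro holomorphic_intros) auto
  qed (use assms in auto)
  then show ?case by simp
next
  case (Suc q)
  have w0: "w \<noteq> 0" using assms by auto
  have "((\<lambda>z. 1 / w * (z powi (- int q) / (z - w) - z powi (- int (Suc q)))) has_contour_integral
     1 / w * ((if q = 0 then 0 else - (2 * of_real pi * \<i> * w powi (- int q))) - (if - int (Suc q) = - 1 then 2 * of_real pi * \<i> else 0))) (circlepath 0 r)"
    by (intro has_contour_integral_lmul has_contour_integral_diff Suc circlepath_powi r)
  moreover have "1 / w * ((if q = 0 then 0 else - (2 * of_real pi * \<i> * w powi (- int q))) - (if - int (Suc q) = - 1 then 2 * of_real pi * \<i> else 0))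
     = - (2 * of_real pi * \<i> * w powi (- int (Suc q)))"
  proof -
    show ?thesis unfolding powi_minus_Suc[OF w0] by (cases "q = 0") simp_all
  qed
  ultimately have "((\<lambda>z. 1 / w * (z powi (- int q) / (z - w) - z powi (- int (Suc q)))) has_contour_integral
      - (2 * of_real pi * \<i> * w powi (- int (Suc q)))) (circlepath 0 r)" by simp
  then have "((\<lambda>z. z powi (- int (Suc q)) / (z - w)) has_contour_integral
      - (2 * of_real pi * \<i> * w powi (- int (Suc q)))) (circlepath 0 r)"
  proof (rule has_contour_integral_eq)
    fix z assume "z \<in> path_image (circlepath 0 r)"
    then have "z \<noteq> 0" "z - w \<noteq> 0" using assms by auto
    then have "1 / w * (V / (z - w) - V / z) = V / z / (z - w)" for V
      using w0 by (simp add: divide_simps) (simp add: algebra_simps)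
    then show "1 / w * (z powi (- int q) / (z - w) - z powi (- int (Suc q))) = z powi (- int (Suc q)) / (z - w)"
      unfolding powi_minus_Suc[OF \<open>z \<noteq> 0\<close>] .
  qed
  then show ?case by simp
qed

text \<open>For n >= 0 the integrand is holomorphic in the disc. For n < 0 the same division step
  lowers the pole order at 0 and leaves an integral of \<open>circlepath_powi_div\<close>.\<close>

lemma circlepath_powi_div_square:
  assumes r: "r > 0" and w: "norm w > r"
  shows "((\<lambda>z. z powi n * (1 / (z - w)\<^sup>2)) has_contour_integral (if n < 0 then 2 * of_real pi * \<i> * (- of_int n * w powi (n - 1)) else 0)) (circlepath 0 r)"
proof (cases "n < 0")
  case False
  have "((\<lambda>z. z powi n * (1 / (z - w)\<^sup>2)) has_contour_integral 0) (circlepath 0 r)"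
  proof (rule Cauchy_theorem_convex_simple[of _ "ball 0 (norm w)"])
    show "(\<lambda>z. z powi n * (1 / (z - w)\<^sup>2)) holomorphic_on ball 0 (norm w)"
      using False by (intro holomorphic_intros) auto
  qed (use assms in auto)
  then show ?thesis using False by simp
next
  case True
  have w0: "w \<noteq> 0" using assms by auto
  have "((\<lambda>z. z powi (- int q) / (z - w)\<^sup>2) has_contour_integral 2 * of_real pi * \<i> * (of_nat q * w powi (- int q - 1))) (circlepath 0 r)" for q
  proof (induction q)
    case 0
    have "((\<lambda>z. 1 / (z - w)\<^sup>2) has_contour_integral 0) (circlepath 0 r)"
    proof (rule Cauchy_theorem_convex_simple[of _ "ball 0 (norm w)"])
      show "(\<lambda>z. 1 / (z - w)\<^sup>2) holomorphic_on ball 0 (norm w)" by (intro holomorphic_intros) auto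
    qed (use assms in auto)
    then show ?case by simp
  next
    case (Suc q)
    have "((\<lambda>z. 1 / w * (z powi (- int q) / (z - w)\<^sup>2 - z powi (- int (Suc q)) / (z - w))) has_contour_integral
      1 / w * (2 * of_real pi * \<i> * (of_nat q * w powi (- int q - 1)) - (if Suc q = 0 then 0 else - (2 * of_real pi * \<i> * w powi (- int (Suc q)))))) (circlepath 0 r)"
      by (intro has_contour_integral_lmul has_contour_integral_diff Suc circlepath_powi_div r w)
    moreover have "1 / w * (2 * of_real pi * \<i> * (of_nat q * w powi (- int q - 1)) - (if Suc q = 0 then 0 else - (2 * of_real pi * \<i> * w powi (- int (Suc q))))) =
       2 * of_real pi * \<i> * (of_nat (Suc q) * w powi (- int (Suc q) - 1))"
    proof -
      have p: "- int (Suc q) = - int q - 1" by simp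
      have "w powi (- int q - 1 - 1) = w powi (- int q - 1) / w"
        using w0 power_int_diff[of w "- int q - 1" 1] by simp
      moreover have "1 / w * (2 * of_real pi * \<i> * (of_nat q * V) - (if Suc q = 0 then 0 else - (2 * of_real pi * \<i> * V))) =
          2 * of_real pi * \<i> * (of_nat (Suc q) * (V / w))" for V
        using w0 by (simp add: field_simps)
      ultimately show ?thesis unfolding p by simp
    qed
    ultimately have "((\<lambda>z. 1 / w * (z powi (- int q) / (z - w)\<^sup>2 - z powi (- int (Suc q)) / (z - w))) has_contour_integral
        2 * of_real pi * \<i> * (of_nat (Suc q) * w powi (- int (Suc q) - 1))) (circlepath 0 r)" by simp
    then show ?case
    proof (rule has_contour_integral_eq)
      fix z assume "z \<in> path_image (circlepath 0 r)"
      then have "z \<noteq> 0" "z - w \<noteq> 0" using assms by auto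
      then have "1 / w * (V / (z - w)\<^sup>2 - V / z / (z - w)) = V / z / (z - w)\<^sup>2" for V
        using w0 by (simp add: divide_simps power2_eq_square) (simp add: algebra_simps)
      then show "1 / w * (z powi (- int q) / (z - w)\<^sup>2 - z powi (- int (Suc q)) / (z - w)) = z powi (- int (Suc q)) / (z - w)\<^sup>2"
        unfolding powi_minus_Suc[OF \<open>z \<noteq> 0\<close>] .
    qed
  qed
  from this[of "nat (- n)"] show ?thesis using True by simp
qed

lemma symb_fps_of_poly: "symb c = fps_of_poly [:1, 1 + c, c:]"
proof -
  have "[:1, 1 + c, c:] = [:1, 1:] * [:1, c:]" by simp
  then show ?thesis by (simp only: fps_of_poly_mult) (simp add: symb_def fps_of_poly_pCons mult.commute)
qed

lemma symb_power_nth: "(symb c ^ k) $ n = coeff ([:1, 1 + c, c:] ^ k) n"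
  unfolding symb_fps_of_poly by (simp only: fps_of_poly_power[symmetric] fps_of_poly_nth)

lemma symb_power_nth_high: "2 * k < n \<Longrightarrow> (symb c ^ k) $ n = 0"
  unfolding symb_power_nth
  by (intro coeff_eq_0 le_less_trans[OF degree_power_le])
    (auto intro!: le_less_trans[OF mult_le_mono1[of "degree [:1, 1 + c, c:]" 2 k]])

lemma symbol_power_expansion:
  fixes z :: complex
  assumes "z \<noteq> 0"
  shows "(1 / z + 1 + of_real c + of_real c * z) ^ k = (\<Sum>n\<le>2 * k. of_real ((symb c ^ k) $ n) * z powi (int n - int k))"
proof -
  let ?p = "[:1, 1 + complex_of_real c, complex_of_real c:]"
  have co: "coeff (?p ^ k) n = of_real (coeff ([:1, 1 + c, c:] ^ k) n)" for n
  proof (induction k arbitrary: n)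
    case (Suc k)
    have "coeff ?p i = of_real (coeff [:1, 1 + c, c:] i)" for i
      by (auto simp: coeff_pCons split: nat.splits)
    then show ?case using Suc by (simp only: power_Suc coeff_mult of_real_sum of_real_mult)
  qed auto
  have deg: "degree (?p ^ k) \<le> 2 * k"
    by (rule order.trans[OF degree_power_le]) (auto intro!: order.trans[OF mult_le_mono1[of "degree ?p" 2 k]])
  have "z * (1 / z + 1 + of_real c + of_real c * z) = poly ?p z"
    using assms by (simp add: field_simps)
  then have "z ^ k * (1 / z + 1 + of_real c + of_real c * z) ^ k = poly (?p ^ k) z"
    by (simp only: power_mult_distrib[symmetric] poly_power)
  also have "\<dots> = (\<Sum>n\<le>2 * k. of_real ((symb c ^ k) $ n) * z ^ n)"
  proof -
    have "poly (?p ^ k) z = (\<Sum>n\<le>2 * k. coeff (?p ^ k) n * z ^ n)"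
      unfolding poly_altdef using deg by (intro sum.mono_neutral_left) (auto simp: coeff_eq_0)
    then show ?thesis unfolding co symb_power_nth .
  qed
  also have "\<dots> = z ^ k * (\<Sum>n\<le>2 * k. of_real ((symb c ^ k) $ n) * z powi (int n - int k))"
    using assms by (simp add: sum_distrib_left power_int_diff mult.left_commute)
  finally show ?thesis using assms by simp
qed

text \<open>Only the negative exponents of the Laurent polynomial f^k contribute; \<open>B\<close>
  stands for the factor that depends on w alone.\<close>

lemma inner_circle_integral:
  assumes r: "r > 0" and w: "norm w > r"
  shows "circle_integral r (\<lambda>z. (1 / z + 1 + of_real c + of_real c * z) ^ k * B * (- of_real c + 1 / (z - w)\<^sup>2)) =
    2 * of_real pi * \<i> * (B * (- of_real c * of_real (apow c k (- 1)) +
      (\<Sum>q=1..k. of_nat q * of_real (apow c k (- int q)) * w powi (- int q - 1))))"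
proof -
  let ?a = "\<lambda>n. complex_of_real ((symb c ^ k) $ n)" and ?m = "\<lambda>n. int n - int k"
  let ?I = "\<lambda>m. - of_real c * (if m = - 1 then 2 * of_real pi * \<i> else 0) +
        (if m < 0 then 2 * of_real pi * \<i> * (- of_int m * w powi (m - 1)) else 0)"
  have "((\<lambda>z. \<Sum>n\<in>{..2 * k}. (B * ?a n) * (- of_real c * z powi ?m n + z powi ?m n * (1 / (z - w)\<^sup>2))) has_contour_integral
     (\<Sum>n\<in>{..2 * k}. (B * ?a n) * ?I (?m n))) (circlepath 0 r)"
    by (intro has_contour_integral_sum has_contour_integral_lmul has_contour_integral_add circlepath_powi circlepath_powi_div_square r w) simp
  then have "((\<lambda>z. (1 / z + 1 + of_real c + of_real c * z) ^ k * B * (- of_real c + 1 / (z - w)\<^sup>2)) has_contour_integral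
     (\<Sum>n\<in>{..2 * k}. (B * ?a n) * ?I (?m n))) (circlepath 0 r)"
  proof (rule has_contour_integral_eq)
    fix z assume "z \<in> path_image (circlepath 0 r)"
    then have "z \<noteq> 0" using r by auto
    then show "(\<Sum>n\<in>{..2 * k}. (B * ?a n) * (- of_real c * z powi ?m n + z powi ?m n * (1 / (z - w)\<^sup>2))) =
       (1 / z + 1 + of_real c + of_real c * z) ^ k * B * (- of_real c + 1 / (z - w)\<^sup>2)"
      unfolding symbol_power_expansion[OF \<open>z \<noteq> 0\<close>] sum_distrib_right by (intro sum.cong) (simp_all only: distrib_left distrib_right mult_ac)
  qed
  then have "circle_integral r (\<lambda>z. (1 / z + 1 + of_real c + of_real c * z) ^ k * B * (- of_real c + 1 / (z - w)\<^sup>2)) =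
     (\<Sum>n\<in>{..2 * k}. (B * ?a n) * ?I (?m n))" by (rule circle_integral_eq)
  also have "\<dots> = (\<Sum>n\<in>{..<k}. (B * ?a n) * ?I (?m n))"
    by (rule sum.mono_neutral_right) auto
  also have "\<dots> = (\<Sum>q\<in>{1..k}. (B * ?a (k - q)) * ?I (?m (k - q)))"
    by (rule sum.reindex_bij_witness[of _ "\<lambda>q. k - q" "\<lambda>n. k - n"]) auto
  also have "\<dots> = (\<Sum>q\<in>{1..k}. 2 * of_real pi * \<i> * (B * (of_nat q * of_real (apow c k (- int q)) * w powi (- int q - 1))) +
      2 * of_real pi * \<i> * (B * (if q = 1 then - of_real c * of_real (apow c k (- 1)) else 0)))"
  proof (rule sum.cong)
    fix q assume q: "q \<in> {1..k}"
    then have m: "?m (k - q) = - int q" by auto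
    have a: "?a (k - q) = of_real (apow c k (- int q))"
      using q by (simp add: apow_def laurent_def nat_diff_distrib')
    show "(B * ?a (k - q)) * ?I (?m (k - q)) = 2 * of_real pi * \<i> * (B * (of_nat q * of_real (apow c k (- int q)) * w powi (- int q - 1))) +
      2 * of_real pi * \<i> * (B * (if q = 1 then - of_real c * of_real (apow c k (- 1)) else 0))"
      unfolding m a using q by (auto simp: algebra_simps)
  qed simp
  also have "\<dots> = 2 * of_real pi * \<i> * (B * (- of_real c * of_real (apow c k (- 1)) +
      (\<Sum>q=1..k. of_nat q * of_real (apow c k (- int q)) * w powi (- int q - 1))))"
  proof (cases "k = 0")
    case True
    then show ?thesis by (simp add: apow_0)
  next
    case False
    then have "(\<Sum>q\<in>{1..k}. if q = 1 then - complex_of_real c * of_real (apow c k (- 1)) else 0) = - of_real c * of_real (apow c k (- 1))"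
      by simp
    then show ?thesis by (simp only: sum.distrib sum_distrib_left[symmetric]) (simp only: distrib_left add.commute)
  qed
  finally show ?thesis .
qed

text \<open>The outer integral extracts the exponent of w that matches each q. The radii enter only
  through |z| < |w|, so the value is the same for every positive \<epsilon>.\<close>

lemma limit_cov_eq:
  assumes e: "\<epsilon> > 0"
  shows "limit_cov c \<epsilon> k l = of_real (lim_cov k l c)"
proof -
  let ?b = "\<lambda>n. complex_of_real ((symb c ^ l) $ n)" and ?m = "\<lambda>n. int n - int l"
  let ?A = "\<lambda>q. complex_of_real (apow c k q)"
  let ?P = "2 * complex_of_real pi * \<i>"
  define F where "F = (\<lambda>w. circle_integral \<epsilon> (\<lambda>z. (1 / z + 1 + of_real c + of_real c * z) ^ k *
        (1 / w + 1 + of_real c + of_real c * w) ^ l * (- of_real c + 1 / (z - w)\<^sup>2)))"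
  have e2: "2 * \<epsilon> > 0" using e by simp
  have "((\<lambda>w. ?P * (\<Sum>n\<in>{..2 * l}. ?b n * ((- of_real c * ?A (- 1)) * w powi ?m n + (\<Sum>q\<in>{1..k}. (of_nat q * ?A (- int q)) * w powi (?m n - int q - 1))))) has_contour_integral
      ?P * (\<Sum>n\<in>{..2 * l}. ?b n * ((- of_real c * ?A (- 1)) * (if ?m n = - 1 then ?P else 0) +
        (\<Sum>q\<in>{1..k}. (of_nat q * ?A (- int q)) * (if ?m n - int q - 1 = - 1 then ?P else 0))))) (circlepath 0 (2 * \<epsilon>))"
    by (intro has_contour_integral_sum has_contour_integral_lmul has_contour_integral_add circlepath_powi e2) simp_all
  then have "(F has_contour_integral
      ?P * (\<Sum>n\<in>{..2 * l}. ?b n * ((- of_real c * ?A (- 1)) * (if ?m n = - 1 then ?P else 0) +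
        (\<Sum>q\<in>{1..k}. (of_nat q * ?A (- int q)) * (if ?m n - int q - 1 = - 1 then ?P else 0))))) (circlepath 0 (2 * \<epsilon>))"
  proof (rule has_contour_integral_eq)
    fix w assume "w \<in> path_image (circlepath 0 (2 * \<epsilon>))"
    then have nw: "norm w = 2 * \<epsilon>" using e by auto
    then have w: "w \<noteq> 0" "norm w > \<epsilon>" using e by auto
    have pw: "w powi (?m n - int q - 1) = w powi ?m n * w powi (- int q - 1)" for n q
      using w(1) by (simp add: power_int_add[symmetric] algebra_simps)
    have "(\<Sum>n\<in>{..2 * l}. ?b n * ((- of_real c * ?A (- 1)) * w powi ?m n + (\<Sum>q\<in>{1..k}. (of_nat q * ?A (- int q)) * w powi (?m n - int q - 1)))) =
      (\<Sum>n\<in>{..2 * l}. ?b n * w powi ?m n * (- of_real c * ?A (- 1) + (\<Sum>q\<in>{1..k}. of_nat q * ?A (- int q) * w powi (- int q - 1))))"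
      by (intro sum.cong refl) (simp only: pw distrib_left sum_distrib_left mult_ac)
    then show "?P * (\<Sum>n\<in>{..2 * l}. ?b n * ((- of_real c * ?A (- 1)) * w powi ?m n + (\<Sum>q\<in>{1..k}. (of_nat q * ?A (- int q)) * w powi (?m n - int q - 1)))) = F w"
      unfolding F_def inner_circle_integral[OF e w(2)] symbol_power_expansion[OF w(1), of c l] by (simp only: sum_distrib_right)
  qed
  then have "circle_integral (2 * \<epsilon>) F = ?P * (\<Sum>n\<in>{..2 * l}. ?b n * ((- of_real c * ?A (- 1)) * (if ?m n = - 1 then ?P else 0) +
        (\<Sum>q\<in>{1..k}. (of_nat q * ?A (- int q)) * (if ?m n - int q - 1 = - 1 then ?P else 0))))"
    by (rule circle_integral_eq)
  also have "\<dots> = ?P * (?P * of_real (lim_cov k l c))"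
  proof -
    have pick: "(\<Sum>n\<in>{..2 * l}. ?b n * (if ?m n = q then ?P else 0)) = ?P * of_real (apow c l q)" for q
    proof (cases "0 \<le> int l + q \<and> nat (int l + q) \<le> 2 * l")
      case True
      have "(\<Sum>n\<in>{..2 * l}. ?b n * (if ?m n = q then ?P else 0)) = (\<Sum>n\<in>{..2 * l}. if n = nat (int l + q) then ?P * ?b (nat (int l + q)) else 0)"
        using True by (intro sum.cong) auto
      also have "\<dots> = ?P * ?b (nat (int l + q))" using True by simp
      finally show ?thesis using True by (simp add: apow_def laurent_def)
    next
      case False
      then have "apow c l q = 0" using symb_power_nth_high[of l "nat (int l + q)" c] by (auto simp: apow_def laurent_def)
      moreover have "(\<Sum>n\<in>{..2 * l}. ?b n * (if ?m n = q then ?P else 0)) = 0" using False by (intro sum.neutral) auto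
      ultimately show ?thesis by simp
    qed
    have "(\<Sum>n\<in>{..2 * l}. ?b n * ((- of_real c * ?A (- 1)) * (if ?m n = - 1 then ?P else 0) +
        (\<Sum>q\<in>{1..k}. (of_nat q * ?A (- int q)) * (if ?m n - int q - 1 = - 1 then ?P else 0)))) =
       (- of_real c * ?A (- 1)) * (\<Sum>n\<in>{..2 * l}. ?b n * (if ?m n = - 1 then ?P else 0)) +
       (\<Sum>q\<in>{1..k}. (of_nat q * ?A (- int q)) * (\<Sum>n\<in>{..2 * l}. ?b n * (if ?m n = int q then ?P else 0)))"
    proof -
      have "(?m n - int q - 1 = - 1) = (?m n = int q)" for n q by auto
      then show ?thesis
        by (simp only: distrib_left sum.distrib sum_distrib_left mult.left_commute sum.swap[of _ "{1..k}" "{..2 * l}"])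
    qed
    moreover have "y * (P * b) + (\<Sum>q\<in>{1..k}. d q * (P * e q)) = P * (y * b + (\<Sum>q\<in>{1..k}. d q * e q))"
      for y P b :: complex and d e
      by (simp add: distrib_left sum_distrib_left mult_ac)
    moreover have "complex_of_real (lim_cov k l c) = - of_real c * ?A (- 1) * of_real (apow c l (- 1)) +
        (\<Sum>q\<in>{1..k}. of_nat q * ?A (- int q) * of_real (apow c l (int q)))"
      by (simp add: lim_cov_def)
    ultimately show ?thesis
      unfolding pick by (simp only:)
  qed
  finally show ?thesis
    unfolding limit_cov_def F_def by (simp add: power2_eq_square)
qed

section \<open>Tableaux and alternants\<close>

definition row_cells :: "nat \<Rightarrow> (nat \<Rightarrow> nat) \<Rightarrow> (nat \<times> nat) set" where
  "row_cells N r = {(i, j). i < N \<and> j < r i}"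

text \<open>The bound \<open>a\<close> on the entries is decoupled from the number \<open>N\<close>
  of rows, so that variables can be removed one at a time.\<close>

definition tab :: "nat \<Rightarrow> nat \<Rightarrow> (nat \<Rightarrow> nat) \<Rightarrow> (nat \<times> nat \<Rightarrow> nat) set" where
  "tab N a r = {T. T \<in> row_cells N r \<rightarrow>\<^sub>E {..<a} \<and>
     (\<forall>i j. (i, j) \<in> row_cells N r \<and> (i, Suc j) \<in> row_cells N r \<longrightarrow> T (i, j) \<le> T (i, Suc j)) \<and>
     (\<forall>i j. (i, j) \<in> row_cells N r \<and> (Suc i, j) \<in> row_cells N r \<longrightarrow> T (i, j) < T (Suc i, j))}"

definition tabsum :: "nat \<Rightarrow> nat \<Rightarrow> (nat \<Rightarrow> nat) \<Rightarrow> (nat \<Rightarrow> real) \<Rightarrow> real" where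
  "tabsum N a r x = (\<Sum>T\<in>tab N a r. \<Prod>c\<in>row_cells N r. x (T c))"

text \<open>The shapes s for which r / s is a horizontal strip.\<close>

definition strips :: "(nat \<Rightarrow> nat) \<Rightarrow> (nat \<Rightarrow> nat) set" where
  "strips r = {s. \<forall>i. r (Suc i) \<le> s i \<and> s i \<le> r i}"

lemma finite_row_cells [simp]: "finite (row_cells N r)"
proof -
  have "row_cells N r = (SIGMA i:{..<N}. {..<r i})" by (auto simp: row_cells_def)
  then show ?thesis by simp
qed

lemma finite_tab [simp]: "finite (tab N a r)"
  by (rule finite_subset[of _ "row_cells N r \<rightarrow>\<^sub>E {..<a}"]) (auto simp: tab_def finite_PiE)

lemma tab_row_mono:
  assumes "T \<in> tab N a r" "i < N" "j \<le> j'" "j' < r i"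
  shows "T (i, j) \<le> T (i, j')"
  using assms(3,4)
proof (induction j' rule: dec_induct)
  case (step n)
  then have "T (i, n) \<le> T (i, Suc n)" using assms(1,2) by (auto simp: tab_def row_cells_def)
  then show ?case using step by simp
qed simp

definition inner_shape :: "nat \<Rightarrow> nat \<Rightarrow> (nat \<Rightarrow> nat) \<Rightarrow> (nat \<times> nat \<Rightarrow> nat) \<Rightarrow> nat \<Rightarrow> nat" where
  "inner_shape N a r T i = (if i < N then card {j. j < r i \<and> T (i, j) < a} else 0)"

lemma inner_shape_iff:
  assumes T: "T \<in> tab N b r" and i: "i < N" and j: "j < r i"
  shows "T (i, j) < a \<longleftrightarrow> j < inner_shape N a r T i"
proof -
  let ?S = "{j. j < r i \<and> T (i, j) < a}"
  have down: "j' \<in> ?S" if "j \<in> ?S" "j' \<le> j" for j j'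
    using tab_row_mono[OF T i that(2)] that by auto
  have fin: "finite ?S" by simp
  have "?S = {..<card ?S}"
  proof (cases "?S = {}")
    case False
    have "?S = {..Max ?S}" using down Max_in[OF fin False] Max_ge[OF fin] by blast
    then show ?thesis by (metis card_atMost lessThan_Suc_atMost)
  next
    case True
    then show ?thesis unfolding True by simp
  qed
  then show ?thesis using i j by (auto simp: inner_shape_def)
qed

text \<open>A cell holding the largest entry \<open>a\<close> has no cell below it, because columns
  increase strictly.\<close>

lemma inner_shape_strip:
  assumes T: "T \<in> tab N (Suc a) r" and r: "\<And>i. r (Suc i) \<le> r i" "\<And>i. i \<ge> N \<Longrightarrow> r i = 0"
  shows "inner_shape N a r T \<in> strips r"
  unfolding strips_def
proof (intro CollectI allI conjI)
  fix i
  show "inner_shape N a r T i \<le> r i"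
    using card_mono[of "{..<r i}" "{j. j < r i \<and> T (i, j) < a}"] by (auto simp: inner_shape_def)
  show "r (Suc i) \<le> inner_shape N a r T i"
  proof (rule ccontr)
    assume "\<not> ?thesis"
    then have lt: "inner_shape N a r T i < r (Suc i)" by simp
    let ?j = "inner_shape N a r T i"
    have iN: "Suc i < N" using r(2)[of "Suc i"] lt by (cases "Suc i < N") auto
    have c: "(i, ?j) \<in> row_cells N r" "(Suc i, ?j) \<in> row_cells N r"
      using lt iN r(1)[of i] by (auto simp: row_cells_def)
    then have "T (i, ?j) < T (Suc i, ?j)" "T (Suc i, ?j) < Suc a" using T by (auto simp: tab_def)
    then have "T (i, ?j) < a" by simp
    then show False using inner_shape_iff[OF T, of i ?j a] c by (simp add: row_cells_def)
  qed
qed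

lemma strip_cells: "s \<in> strips r \<Longrightarrow> row_cells N s \<subseteq> row_cells N r"
  unfolding strips_def row_cells_def by (auto intro: less_le_trans)

lemma restrict_tab:
  assumes T: "T \<in> tab N (Suc a) r" and r: "\<And>i. r (Suc i) \<le> r i" "\<And>i. i \<ge> N \<Longrightarrow> r i = 0"
  shows "restrict T (row_cells N (inner_shape N a r T)) \<in> tab N a (inner_shape N a r T)"
proof -
  let ?s = "inner_shape N a r T"
  have sub: "row_cells N ?s \<subseteq> row_cells N r" by (rule strip_cells[OF inner_shape_strip[OF assms]])
  have "T (i, j) < a" if "(i, j) \<in> row_cells N ?s" for i j
    using that sub inner_shape_iff[OF T, of i j a] by (auto simp: row_cells_def)
  moreover have "T (i, j) \<le> T (i, Suc j)" if "(i, j) \<in> row_cells N ?s" "(i, Suc j) \<in> row_cells N ?s" for i j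
    using T subsetD[OF sub that(1)] subsetD[OF sub that(2)] unfolding tab_def by blast
  moreover have "T (i, j) < T (Suc i, j)" if "(i, j) \<in> row_cells N ?s" "(Suc i, j) \<in> row_cells N ?s" for i j
    using T subsetD[OF sub that(1)] subsetD[OF sub that(2)] unfolding tab_def by blast
  ultimately show ?thesis unfolding tab_def by auto
qed

definition extend_tab :: "nat \<Rightarrow> nat \<Rightarrow> (nat \<Rightarrow> nat) \<Rightarrow> (nat \<Rightarrow> nat) \<Rightarrow> (nat \<times> nat \<Rightarrow> nat) \<Rightarrow> nat \<times> nat \<Rightarrow> nat" where
  "extend_tab N a r s T = (\<lambda>c. if c \<in> row_cells N s then T c else if c \<in> row_cells N r then a else undefined)"

lemma extend_tab_in:
  assumes s: "s \<in> strips r" and T: "T \<in> tab N a s"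
  shows "extend_tab N a r s T \<in> tab N (Suc a) r"
proof -
  let ?E = "extend_tab N a r s T"
  have sub: "row_cells N s \<subseteq> row_cells N r" by (rule strip_cells[OF s])
  have Ta: "T c < a" if "c \<in> row_cells N s" for c using T that by (auto simp: tab_def)
  have Ein: "?E c = T c" if "c \<in> row_cells N s" for c using that by (simp add: extend_tab_def)
  have Eout: "?E c = a" if "c \<in> row_cells N r" "c \<notin> row_cells N s" for c using that by (simp add: extend_tab_def)
  have le: "?E c \<le> a" if "c \<in> row_cells N r" for c
    using Ta[of c] Ein[of c] Eout[OF that] by (cases "c \<in> row_cells N s") auto
  have 1: "?E \<in> row_cells N r \<rightarrow>\<^sub>E {..<Suc a}"
  proof (rule PiE_I)
    fix c assume "c \<in> row_cells N r"
    then show "?E c \<in> {..<Suc a}" using le by (simp add: less_Suc_eq_le)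
  next
    fix c assume "c \<notin> row_cells N r"
    then show "?E c = undefined" using sub by (auto simp: extend_tab_def)
  qed
  have 2: "?E (i, j) \<le> ?E (i, Suc j)" if c: "(i, j) \<in> row_cells N r" "(i, Suc j) \<in> row_cells N r" for i j
  proof (cases "(i, Suc j) \<in> row_cells N s")
    case True
    then have "(i, j) \<in> row_cells N s" by (auto simp: row_cells_def)
    then show ?thesis using T True by (auto simp: Ein tab_def)
  next
    case False
    then show ?thesis using le[OF c(1)] Eout[OF c(2)] by simp
  qed
  have 3: "?E (i, j) < ?E (Suc i, j)" if c: "(i, j) \<in> row_cells N r" "(Suc i, j) \<in> row_cells N r" for i j
  proof -
    have "j < s i" using s c by (auto simp: strips_def row_cells_def intro: less_le_trans)
    then have ci: "(i, j) \<in> row_cells N s" using c by (auto simp: row_cells_def)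
    show ?thesis
    proof (cases "(Suc i, j) \<in> row_cells N s")
      case True
      then show ?thesis using T ci by (auto simp: Ein tab_def)
    next
      case False
      then show ?thesis using Ta[OF ci] Eout[OF c(2)] Ein[OF ci] by simp
    qed
  qed
  show ?thesis using 1 2 3 unfolding tab_def by blast
qed

lemma extend_tab_inner_shape:
  assumes s: "s \<in> strips r" and T: "T \<in> tab N a s" and r: "\<And>i. i \<ge> N \<Longrightarrow> r i = 0"
  shows "inner_shape N a r (extend_tab N a r s T) = s"
proof
  fix i
  have sr: "s i \<le> r i" using s by (simp add: strips_def)
  show "inner_shape N a r (extend_tab N a r s T) i = s i"
  proof (cases "i < N")
    case True
    have "{j. j < r i \<and> extend_tab N a r s T (i, j) < a} = {..<s i}"
    proof (intro set_eqI)
      fix j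
      have "T (i, j) < a" if "j < s i" using T that True by (auto simp: tab_def row_cells_def)
      then show "j \<in> {j. j < r i \<and> extend_tab N a r s T (i, j) < a} \<longleftrightarrow> j \<in> {..<s i}"
        using True sr by (auto simp: extend_tab_def row_cells_def)
    qed
    then show ?thesis using True by (simp add: inner_shape_def)
  next
    case False
    then show ?thesis using sr r[of i] by (simp add: inner_shape_def)
  qed
qed

lemma finite_strips:
  assumes "\<And>i. i \<ge> N \<Longrightarrow> r i = 0"
  shows "finite (strips r)"
proof (rule inj_on_finite)
  show "inj_on (\<lambda>s. restrict s {..<N}) (strips r)"
  proof (rule inj_onI)
    fix s t assume st: "s \<in> strips r" "t \<in> strips r" "restrict s {..<N} = restrict t {..<N}"
    show "s = t"
    proof
      fix i show "s i = t i"
      proof (cases "i < N")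
        case True then show ?thesis using st(3) by (metis lessThan_iff restrict_apply')
      next
        case False
        then have "s i \<le> 0" "t i \<le> 0" using st assms[of i] unfolding strips_def by (metis (mono_tags) mem_Collect_eq not_less)+
        then show ?thesis by simp
      qed
    qed
  qed
  show "(\<lambda>s. restrict s {..<N}) ` strips r \<subseteq> (PiE {..<N} (\<lambda>i. {..r i}))"
    by (auto simp: strips_def split: if_splits)
  show "finite (PiE {..<N} (\<lambda>i. {..r i}))" by (intro finite_PiE) auto
qed

lemma card_strip_cells:
  assumes "s \<in> strips r"
  shows "card (row_cells N r - row_cells N s) = (\<Sum>i<N. r i - s i)"
proof -
  have "row_cells N r - row_cells N s = (SIGMA i:{..<N}. {s i..<r i})"
    by (auto simp: row_cells_def)
  then show ?thesis by simp
qed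

text \<open>Branching rule: a tableau is its restriction to the entries below \<open>a\<close>
  together with the horizontal strip of cells filled with \<open>a\<close>.\<close>

lemma tabsum_Suc:
  assumes r: "\<And>i. r (Suc i) \<le> r i" "\<And>i. i \<ge> N \<Longrightarrow> r i = 0"
  shows "tabsum N (Suc a) r x = (\<Sum>s\<in>strips r. tabsum N a s x * x a ^ (\<Sum>i<N. r i - s i))"
proof -
  let ?j = "\<lambda>T. (inner_shape N a r T, restrict T (row_cells N (inner_shape N a r T)))"
  let ?i = "\<lambda>(s, T). extend_tab N a r s T"
  have "(\<Sum>T\<in>tab N (Suc a) r. \<Prod>c\<in>row_cells N r. x (T c)) =
     (\<Sum>(s, T)\<in>(SIGMA s:strips r. tab N a s). (\<Prod>c\<in>row_cells N s. x (T c)) * x a ^ (\<Sum>i<N. r i - s i))"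
  proof (rule sum.reindex_bij_witness[where i = ?i and j = ?j])
    fix T assume T: "T \<in> tab N (Suc a) r"
    let ?s = "inner_shape N a r T"
    have sub: "row_cells N ?s \<subseteq> row_cells N r" by (rule strip_cells[OF inner_shape_strip[OF T r]])
    have out: "T c = a" if c: "c \<in> row_cells N r" "c \<notin> row_cells N ?s" for c
    proof -
      obtain i j where ij: "c = (i, j)" by (cases c)
      have "\<not> T (i, j) < a" using c ij inner_shape_iff[OF T, of i j a] by (auto simp: row_cells_def)
      moreover have "T c < Suc a" using T c by (auto simp: tab_def)
      ultimately show ?thesis using ij by simp
    qed
    show "?i (?j T) = T"
    proof
      fix c
      have "T c = undefined" if "c \<notin> row_cells N r" using T that by (auto simp: tab_def)
      then show "?i (?j T) c = T c" using sub out[of c] by (auto simp: extend_tab_def)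
    qed
    show "?j T \<in> (SIGMA s:strips r. tab N a s)"
      using inner_shape_strip[OF T r] restrict_tab[OF T r] by auto
    have "(\<Prod>c\<in>row_cells N r. x (T c)) = (\<Prod>c\<in>row_cells N ?s. x (T c)) * (\<Prod>c\<in>row_cells N r - row_cells N ?s. x (T c))"
      using prod.subset_diff[OF sub, of "\<lambda>c. x (T c)"] by (simp add: mult.commute)
    also have "(\<Prod>c\<in>row_cells N r - row_cells N ?s. x (T c)) = x a ^ (\<Sum>i<N. r i - ?s i)"
      using out by (simp add: card_strip_cells[OF inner_shape_strip[OF T r], symmetric])
    also have "(\<Prod>c\<in>row_cells N ?s. x (T c)) = (\<Prod>c\<in>row_cells N ?s. x (restrict T (row_cells N ?s) c))"
      by (rule prod.cong) auto
    finally show "(case ?j T of (s, T) \<Rightarrow> (\<Prod>c\<in>row_cells N s. x (T c)) * x a ^ (\<Sum>i<N. r i - s i)) = (\<Prod>c\<in>row_cells N r. x (T c))"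
      by simp
  next
    fix p assume "p \<in> (SIGMA s:strips r. tab N a s)"
    then obtain s T where p: "p = (s, T)" "s \<in> strips r" "T \<in> tab N a s" by auto
    have "restrict (extend_tab N a r s T) (row_cells N s) = T"
    proof
      fix c
      have "T c = undefined" if "c \<notin> row_cells N s" using p(3) that by (auto simp: tab_def)
      then show "restrict (extend_tab N a r s T) (row_cells N s) c = T c" by (auto simp: extend_tab_def)
    qed
    then show "?j (?i p) = p" using p extend_tab_inner_shape[OF p(2,3) r(2)] by simp
    show "?i p \<in> tab N (Suc a) r" using p extend_tab_in by simp
  qed
  also have "\<dots> = (\<Sum>s\<in>strips r. \<Sum>T\<in>tab N a s. (\<Prod>c\<in>row_cells N s. x (T c)) * x a ^ (\<Sum>i<N. r i - s i))"
    by (subst sum.Sigma) (auto intro: finite_strips r(2))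
  finally show ?thesis by (simp add: tabsum_def sum_distrib_right)
qed

text \<open>The first column has more than \<open>a\<close> cells and would need as many distinct
  entries below \<open>a\<close>.\<close>

lemma tab_empty:
  assumes s: "\<And>i. s (Suc i) \<le> s i" and a: "a < N" "s a > 0"
  shows "tab N a s = {}"
proof -
  have pos: "s i > 0" if "i \<le> a" for i
    using that lift_Suc_antimono_le[of s i a] s a(2) by simp
  have False if T: "T \<in> tab N a s" for T
  proof -
    have "i \<le> T (i, 0)" if "i \<le> a" for i
      using that
    proof (induction i)
      case (Suc i)
      then have "(i, 0) \<in> row_cells N s" "(Suc i, 0) \<in> row_cells N s"
        using pos[of i] pos[of "Suc i"] a(1) by (auto simp: row_cells_def)
      then have "T (i, 0) < T (Suc i, 0)" using T by (auto simp: tab_def)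
      then show ?case using Suc by simp
    qed simp
    moreover have "T (a, 0) < a" using T a by (auto simp: tab_def row_cells_def)
    ultimately show False by (metis leD order.refl)
  qed
  then show ?thesis by auto
qed

lemma tabsum_empty_shape:
  assumes "\<And>i. i < N \<Longrightarrow> r i = 0"
  shows "tabsum N a r x = 1"
proof -
  have "row_cells N r = {}" using assms by (auto simp: row_cells_def)
  then show ?thesis by (simp add: tabsum_def tab_def)
qed

section \<open>Determinants and alternants\<close>

text \<open>The Leibniz determinant of the leading n by n block of an infinite array, so that
  inductions can change the size and keep the array.\<close>

definition ldet :: "nat \<Rightarrow> (nat \<Rightarrow> nat \<Rightarrow> real) \<Rightarrow> real" where
  "ldet n M = (\<Sum>p | p permutes {..<n}. of_int (sign p) * (\<Prod>j<n. M (p j) j))"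

lemma permutes_lessThan: "p permutes {..<n} \<Longrightarrow> i < n \<Longrightarrow> p i < n" for n :: nat
  using permutes_in_image[of p "{..<n}" i] by simp

lemma ldet_cong: "(\<And>i j. i < n \<Longrightarrow> j < n \<Longrightarrow> M i j = M' i j) \<Longrightarrow> ldet n M = ldet n M'"
  unfolding ldet_def by (intro sum.cong refl arg_cong2[of _ _ _ _ "(*)"] prod.cong) (auto simp: permutes_lessThan)

lemma ldet_equal_columns:
  assumes "j < n" "k < n" "j \<noteq> k" "\<And>i. i < n \<Longrightarrow> M i j = M i k"
  shows "ldet n M = 0"
proof -
  let ?t = "Transposition.transpose j k"
  have t: "?t permutes {..<n}" using assms by (intro permutes_swap_id) auto
  let ?f = "\<lambda>p. of_int (sign p) * (\<Prod>i<n. M (p i) i)"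
  have "sum ?f {p. p permutes {..<n}} = sum (\<lambda>p. ?f (p \<circ> ?t)) {p. p permutes {..<n}}"
    by (rule sum_permutations_compose_right[OF t])
  also have "\<dots> = sum (\<lambda>p. - ?f p) {p. p permutes {..<n}}"
  proof (rule sum.cong)
    fix p assume "p \<in> {p. p permutes {..<n}}"
    then have p: "p permutes {..<n}" by simp
    have "permutation p" "permutation ?t" using p t permutation_permutes by (metis finite_lessThan)+
    then have sg: "sign (p \<circ> ?t) = - sign p" using assms(3) by (simp add: sign_compose sign_swap_id)
    have "(\<Prod>i<n. M (p (?t i)) i) = (\<Prod>i<n. M (p i) (?t i))"
      by (subst prod.permute[OF t]) (simp add: comp_def)
    also have "\<dots> = (\<Prod>i<n. M (p i) i)"
    proof (rule prod.cong)
      fix i assume "i \<in> {..<n}"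
      then have "p i < n" using p by (simp add: permutes_lessThan)
      then show "M (p i) (?t i) = M (p i) i" using assms(4)[of "p i"] by (auto simp: Transposition.transpose_def)
    qed simp
    finally show "?f (p \<circ> ?t) = - ?f p" by (simp add: sg)
  qed simp
  finally have "sum ?f {p. p permutes {..<n}} = - sum ?f {p. p permutes {..<n}}" by (simp add: sum_negf)
  then show ?thesis by (simp add: ldet_def)
qed

lemma ldet_add_column:
  assumes "k < n"
  shows "ldet n (\<lambda>i j. if j = k then u i + c * v i else M i j) =
    ldet n (\<lambda>i j. if j = k then u i else M i j) + c * ldet n (\<lambda>i j. if j = k then v i else M i j)"
proof -
  have split: "(\<Prod>j<n. if j = k then a j else b j) = a k * (\<Prod>j\<in>{..<n} - {k}. b j)" for a b :: "nat \<Rightarrow> real"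
    using assms by (subst prod.remove[of _ k]) auto
  show ?thesis unfolding ldet_def split
    by (simp add: sum_distrib_left sum.distrib[symmetric] algebra_simps)
qed

lemma ldet_column_operation:
  assumes "j < n" "k < n" "j \<noteq> k"
  shows "ldet n (\<lambda>i l. if l = j then M i j + c * M i k else M i l) = ldet n M"
proof -
  have "ldet n (\<lambda>i l. if l = j then M i k else M i l) = 0"
    by (rule ldet_equal_columns[of j _ k]) (use assms in auto)
  moreover have "ldet n (\<lambda>i l. if l = j then M i j else M i l) = ldet n M" by (rule ldet_cong) auto
  ultimately show ?thesis by (simp add: ldet_add_column[OF assms(1), of "\<lambda>i. M i j" c "\<lambda>i. M i k" M])
qed

text \<open>The columns are treated from left to right, so that column j + 1 is still unmodified
  when a multiple of it is subtracted from column j.\<close>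

lemma ldet_successive_columns:
  assumes "m < n"
  shows "ldet n (\<lambda>i j. if j < m then M i j - c j * M i (Suc j) else M i j) = ldet n M"
  using assms
proof (induction m)
  case 0
  then show ?case by simp
next
  case (Suc m)
  let ?M = "\<lambda>i j. if j < m then M i j - c j * M i (Suc j) else M i j"
  have "ldet n (\<lambda>i j. if j < Suc m then M i j - c j * M i (Suc j) else M i j) =
      ldet n (\<lambda>i j. if j = m then ?M i m + - c m * ?M i (Suc m) else ?M i j)"
    by (rule ldet_cong) (auto simp: less_Suc_eq)
  also have "\<dots> = ldet n ?M" using Suc.prems by (intro ldet_column_operation) auto
  finally show ?case using Suc by simp
qed

lemma ldet_last_row:
  assumes "\<And>j. j < n \<Longrightarrow> M n j = 0"
  shows "ldet (Suc n) M = M n n * ldet n M"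
proof -
  let ?f = "\<lambda>p. of_int (sign p) * (\<Prod>j<Suc n. M (p j) j)"
  have "ldet (Suc n) M = sum ?f {p. p permutes {..<n}}"
    unfolding ldet_def
  proof (rule sum.mono_neutral_right)
    show "{p. p permutes {..<n}} \<subseteq> {p. p permutes {..<Suc n}}"
      by (auto intro: permutes_subset)
    show "\<forall>p\<in>{p. p permutes {..<Suc n}} - {p. p permutes {..<n}}. ?f p = 0"
    proof
      fix p assume p: "p \<in> {p. p permutes {..<Suc n}} - {p. p permutes {..<n}}"
      then have ps: "p permutes {..<Suc n}" by simp
      have "p n \<noteq> n"
      proof
        assume "p n = n"
        then have "p permutes {..<n}"
          using ps by (intro permutes_superset[OF ps]) auto
        then show False using p by simp
      qed
      obtain j where j: "p j = n" using ps by (metis permutes_surj surjD)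
      have "j < Suc n" using ps j by (metis lessI permutes_in_image lessThan_iff)
      moreover have "j \<noteq> n" using j \<open>p n \<noteq> n\<close> by auto
      ultimately have "M (p j) j = 0" "j \<in> {..<Suc n}" using j assms[of j] by auto
      then show "?f p = 0" by (metis finite_lessThan mult_eq_0_iff prod_zero)
    qed
  qed (simp add: finite_permutations)
  also have "\<dots> = M n n * ldet n M"
    unfolding ldet_def sum_distrib_left
  proof (rule sum.cong)
    fix p assume "p \<in> {p. p permutes {..<n}}"
    then have "p n = n" by (simp add: permutes_def)
    then show "?f p = M n n * (of_int (sign p) * (\<Prod>j<n. M (p j) j))" by simp
  qed simp
  finally show ?thesis .
qed

lemma ldet_row_factor:
  "ldet n (\<lambda>i j. d i * M i j) = (\<Prod>i<n. d i) * ldet n M"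
proof -
  have "(\<Prod>j<n. d (p j)) = (\<Prod>i<n. d i)" if "p permutes {..<n}" for p
    using prod.permute[OF that, of d] by (simp add: comp_def)
  then show ?thesis
    unfolding ldet_def sum_distrib_left prod.distrib by (intro sum.cong) auto
qed

lemma ldet_sum_columns:
  assumes "\<And>j. j < n \<Longrightarrow> finite (B j)"
  shows "ldet n (\<lambda>i j. \<Sum>b\<in>B j. F i j b) = (\<Sum>\<beta>\<in>PiE {..<n} B. ldet n (\<lambda>i j. F i j (\<beta> j)))"
proof -
  have "(\<Prod>j<n. \<Sum>b\<in>B j. F (p j) j b) = (\<Sum>\<beta>\<in>PiE {..<n} B. \<Prod>j<n. F (p j) j (\<beta> j))" for p
    using assms by (intro prod_sum_PiE) auto
  then have "ldet n (\<lambda>i j. \<Sum>b\<in>B j. F i j b) =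
     (\<Sum>p | p permutes {..<n}. \<Sum>\<beta>\<in>PiE {..<n} B. of_int (sign p) * (\<Prod>j<n. F (p j) j (\<beta> j)))"
    by (simp add: ldet_def sum_distrib_left)
  then show ?thesis unfolding ldet_def by (subst sum.swap)
qed

definition alt :: "nat \<Rightarrow> (nat \<Rightarrow> nat) \<Rightarrow> (nat \<Rightarrow> real) \<Rightarrow> real" where
  "alt n \<alpha> x = ldet n (\<lambda>i j. x i ^ \<alpha> j)"

lemma alt_cong: "(\<And>j. j < n \<Longrightarrow> \<alpha> j = \<beta> j) \<Longrightarrow> alt n \<alpha> x = alt n \<beta> x"
  unfolding alt_def by (rule ldet_cong) auto

text \<open>Subtracting \<open>x\<^sub>n\<^bsup>\<alpha>\<^sub>j - \<alpha>\<^sub>j\<^sub>+\<^sub>1\<^esup>\<close> times column \<open>j + 1\<close> from column \<open>j\<close> clears the last row; the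
  geometric sums in the remaining columns run over the interlacing exponents.\<close>

lemma alt_Suc:
  assumes dec: "\<And>j. j < n \<Longrightarrow> \<alpha> (Suc j) < \<alpha> j"
  shows "alt (Suc n) \<alpha> x = (\<Prod>i<n. x i - x n) *
    (\<Sum>\<beta>\<in>PiE {..<n} (\<lambda>j. {\<alpha> (Suc j)..<\<alpha> j}). x n ^ (\<alpha> n + (\<Sum>j<n. \<alpha> j - 1 - \<beta> j)) * alt n \<beta> x)"
proof -
  let ?M = "\<lambda>i j. if j < n then x i ^ \<alpha> j - x n ^ (\<alpha> j - \<alpha> (Suc j)) * x i ^ \<alpha> (Suc j) else x i ^ \<alpha> j"
  let ?B = "\<lambda>j. {\<alpha> (Suc j)..<\<alpha> j}"
  have entry: "?M i j = (x i - x n) * (\<Sum>b\<in>?B j. x i ^ b * x n ^ (\<alpha> j - 1 - b))" if j: "j < n" for i j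
  proof -
    define d where "d = \<alpha> j - \<alpha> (Suc j)"
    have aj: "\<alpha> j = d + \<alpha> (Suc j)" using dec[OF j] by (simp add: d_def)
    have "?M i j = x i ^ \<alpha> (Suc j) * (x i ^ d - x n ^ d)"
      using j by (simp add: aj power_add algebra_simps)
    also have "\<dots> = (x i - x n) * (\<Sum>t<d. x i ^ \<alpha> (Suc j) * (x n ^ (d - Suc t) * x i ^ t))"
      unfolding power_diff_sumr2 by (simp add: sum_distrib_left mult_ac)
    also have "(\<Sum>t<d. x i ^ \<alpha> (Suc j) * (x n ^ (d - Suc t) * x i ^ t)) = (\<Sum>b\<in>?B j. x i ^ b * x n ^ (\<alpha> j - 1 - b))"
      by (rule sum.reindex_bij_witness[of _ "\<lambda>b. b - \<alpha> (Suc j)" "\<lambda>t. \<alpha> (Suc j) + t"])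
        (auto simp: aj power_add mult_ac)
    finally show ?thesis .
  qed
  have "alt (Suc n) \<alpha> x = ldet (Suc n) ?M"
    unfolding alt_def by (rule ldet_successive_columns[symmetric]) simp
  also have "\<dots> = ?M n n * ldet n ?M"
    by (rule ldet_last_row) (use entry in auto)
  also have "ldet n ?M = ldet n (\<lambda>i j. (x i - x n) * (\<Sum>b\<in>?B j. x i ^ b * x n ^ (\<alpha> j - 1 - b)))"
    by (rule ldet_cong) (rule entry)
  also have "\<dots> = (\<Prod>i<n. x i - x n) * (\<Sum>\<beta>\<in>PiE {..<n} ?B. ldet n (\<lambda>i j. x i ^ \<beta> j * x n ^ (\<alpha> j - 1 - \<beta> j)))"
    unfolding ldet_row_factor by (subst ldet_sum_columns) auto
  also have "(\<Sum>\<beta>\<in>PiE {..<n} ?B. ldet n (\<lambda>i j. x i ^ \<beta> j * x n ^ (\<alpha> j - 1 - \<beta> j))) =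
      (\<Sum>\<beta>\<in>PiE {..<n} ?B. x n ^ (\<Sum>j<n. \<alpha> j - 1 - \<beta> j) * alt n \<beta> x)"
    unfolding alt_def ldet_def by (simp add: prod.distrib power_sum sum_distrib_left mult_ac)
  finally show ?thesis by (simp add: power_add sum_distrib_left mult_ac)
qed

text \<open>The bialternant formula. When the last variable is removed, the tableau sum obeys the
  branching rule over horizontal strips and the alternant obeys \<open>alt_Suc\<close> over
  interlacing exponents; adding the staircase to a shape matches the two index sets.\<close>

lemma tabsum_alt:
  assumes "a \<le> N" "\<And>i. r (Suc i) \<le> r i" "\<And>i. i \<ge> a \<Longrightarrow> r i = 0"
  shows "tabsum N a r x * alt a (\<lambda>j. a - Suc j) x = alt a (\<lambda>j. r j + (a - Suc j)) x"
  using assms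
proof (induction a arbitrary: r)
  case 0
  then show ?case by (simp add: tabsum_empty_shape)
next
  case (Suc a)
  let ?\<delta> = "\<lambda>j. a - Suc j"
  have key: "alt (Suc a) (\<lambda>j. r j + (Suc a - Suc j)) x = (\<Prod>i<a. x i - x a) * tabsum N (Suc a) r x * alt a ?\<delta> x"
    if r: "\<And>i. r (Suc i) \<le> r i" "\<And>i. i \<ge> Suc a \<Longrightarrow> r i = 0" for r
  proof -
    let ?\<alpha> = "\<lambda>j. r j + (Suc a - Suc j)"
    \<comment> \<open>Interlacing exponents in \<open>a\<close> columns correspond to strips with at
      most \<open>a\<close> rows; the other strips carry no tableau with entries below
      \<open>a\<close>.\<close>
    let ?S = "{s \<in> strips r. s a = 0}"
    have rN: "r i = 0" if "i \<ge> N" for i using r(2)[of i] Suc.prems(1) that by simp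
    have "(\<Sum>\<beta>\<in>PiE {..<a} (\<lambda>j. {?\<alpha> (Suc j)..<?\<alpha> j}). x a ^ (?\<alpha> a + (\<Sum>j<a. ?\<alpha> j - 1 - \<beta> j)) * alt a \<beta> x) =
       (\<Sum>s\<in>?S. x a ^ (\<Sum>i<N. r i - s i) * alt a (\<lambda>j. s j + ?\<delta> j) x)"
    proof (rule sum.reindex_bij_witness[where i = "\<lambda>s. restrict (\<lambda>j. s j + ?\<delta> j) {..<a}"
          and j = "\<lambda>\<beta> j. if j < a then \<beta> j - ?\<delta> j else 0"])
      fix \<beta> assume \<beta>: "\<beta> \<in> PiE {..<a} (\<lambda>j. {?\<alpha> (Suc j)..<?\<alpha> j})"
      let ?s = "\<lambda>j. if j < a then \<beta> j - ?\<delta> j else 0"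
      have b: "r (Suc j) + ?\<delta> j \<le> \<beta> j" "\<beta> j < r j + Suc (?\<delta> j)" if "j < a" for j
        using PiE_mem[OF \<beta>, of j] that by auto
      show "restrict (\<lambda>j. ?s j + ?\<delta> j) {..<a} = \<beta>"
      proof
        fix j show "restrict (\<lambda>j. ?s j + ?\<delta> j) {..<a} j = \<beta> j"
          using b(1)[of j] PiE_arb[OF \<beta>, of j] by auto
      qed
      have "r (Suc j) \<le> ?s j \<and> ?s j \<le> r j" for j
        using b[of j] r(2)[of "Suc j"] by (cases "j < a") auto
      then show "?s \<in> ?S" by (simp add: strips_def)
      have "(\<Sum>i<N. r i - ?s i) = (\<Sum>i<Suc a. r i - ?s i)"
        using Suc.prems(1) r(2) by (intro sum.mono_neutral_right) auto
      also have "\<dots> = (\<Sum>j<a. ?\<alpha> j - 1 - \<beta> j) + r a"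
        using b by (simp) (intro sum.cong; force)
      finally have ex: "(\<Sum>i<N. r i - ?s i) = ?\<alpha> a + (\<Sum>j<a. ?\<alpha> j - 1 - \<beta> j)" by simp
      have "alt a (\<lambda>j. ?s j + ?\<delta> j) x = alt a \<beta> x"
      proof (rule alt_cong)
        fix j assume j: "j < a"
        have "?\<delta> j \<le> \<beta> j" using b(1)[OF j] by linarith
        then show "?s j + ?\<delta> j = \<beta> j" by (simp only: j if_True le_add_diff_inverse2)
      qed
      then show "x a ^ (\<Sum>i<N. r i - ?s i) * alt a (\<lambda>j. ?s j + ?\<delta> j) x = x a ^ (?\<alpha> a + (\<Sum>j<a. ?\<alpha> j - 1 - \<beta> j)) * alt a \<beta> x"
        by (simp only: ex)
    next
      fix s assume s: "s \<in> ?S"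
      then have st: "r (Suc j) \<le> s j" "s j \<le> r j" for j by (auto simp: strips_def)
      have s0: "s j = 0" if "a \<le> j" for j
      proof (cases "j = a")
        case True then show ?thesis using s by simp
      next
        case False
        then show ?thesis using st(2)[of j] r(2)[of j] that by simp
      qed
      then show "(\<lambda>j. if j < a then restrict (\<lambda>j. s j + ?\<delta> j) {..<a} j - ?\<delta> j else 0) = s" by auto
      show "restrict (\<lambda>j. s j + ?\<delta> j) {..<a} \<in> PiE {..<a} (\<lambda>j. {?\<alpha> (Suc j)..<?\<alpha> j})"
      proof (rule restrict_PiE_iff[THEN iffD2], rule ballI)
        fix j assume "j \<in> {..<a}"
        then show "s j + ?\<delta> j \<in> {?\<alpha> (Suc j)..<?\<alpha> j}" using st[of j] by auto
      qed
    qed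
    also have "\<dots> = (\<Sum>s\<in>?S. x a ^ (\<Sum>i<N. r i - s i) * (tabsum N a s x * alt a ?\<delta> x))"
    proof (rule sum.cong)
      fix s assume s: "s \<in> ?S"
      then have st: "r (Suc j) \<le> s j" "s j \<le> r j" for j by (auto simp: strips_def)
      have "s i = 0" if "i \<ge> a" for i
        using s st(2)[of i] r(2)[of i] that by (cases "i = a") auto
      moreover have "s (Suc i) \<le> s i" for i using st(1)[of i] st(2)[of "Suc i"] by simp
      ultimately have "tabsum N a s x * alt a ?\<delta> x = alt a (\<lambda>j. s j + ?\<delta> j) x"
        using Suc.prems(1) by (intro Suc.IH) auto
      then show "x a ^ (\<Sum>i<N. r i - s i) * alt a (\<lambda>j. s j + ?\<delta> j) x = x a ^ (\<Sum>i<N. r i - s i) * (tabsum N a s x * alt a ?\<delta> x)"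
        by simp
    qed simp
    also have "\<dots> = (\<Sum>s\<in>strips r. x a ^ (\<Sum>i<N. r i - s i) * (tabsum N a s x * alt a ?\<delta> x))"
    proof (rule sum.mono_neutral_left)
      show "finite (strips r)" by (rule finite_strips[OF rN])
      show "\<forall>s\<in>strips r - ?S. x a ^ (\<Sum>i<N. r i - s i) * (tabsum N a s x * alt a ?\<delta> x) = 0"
      proof
        fix s assume s: "s \<in> strips r - ?S"
        then have st: "r (Suc j) \<le> s j" "s j \<le> r j" for j by (auto simp: strips_def)
        have "s (Suc i) \<le> s i" for i using st(1)[of i] st(2)[of "Suc i"] by simp
        moreover have "s a > 0" using s by auto
        ultimately have "tab N a s = {}" using Suc.prems(1) by (intro tab_empty) auto
        then show "x a ^ (\<Sum>i<N. r i - s i) * (tabsum N a s x * alt a ?\<delta> x) = 0" by (simp add: tabsum_def)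
      qed
    qed auto
    also have "\<dots> = tabsum N (Suc a) r x * alt a ?\<delta> x"
    proof -
      have "tabsum N (Suc a) r x = (\<Sum>s\<in>strips r. tabsum N a s x * x a ^ (\<Sum>i<N. r i - s i))"
        by (rule tabsum_Suc) (fact r(1), fact rN)
      then show ?thesis by (simp only: sum_distrib_left sum_distrib_right mult_ac)
    qed
    finally have "(\<Sum>\<beta>\<in>PiE {..<a} (\<lambda>j. {?\<alpha> (Suc j)..<?\<alpha> j}). x a ^ (?\<alpha> a + (\<Sum>j<a. ?\<alpha> j - 1 - \<beta> j)) * alt a \<beta> x) =
       tabsum N (Suc a) r x * alt a ?\<delta> x" .
    moreover have "?\<alpha> (Suc j) < ?\<alpha> j" if "j < a" for j using r(1)[of j] that by simp
    ultimately show ?thesis using alt_Suc[of a ?\<alpha> x] by (simp only: mult.assoc)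
  qed
  have "alt (Suc a) (\<lambda>j. Suc a - Suc j) x = (\<Prod>i<a. x i - x a) * alt a ?\<delta> x"
    using key[of "\<lambda>i. 0"] by (simp add: tabsum_empty_shape)
  moreover have "alt (Suc a) (\<lambda>j. r j + (Suc a - Suc j)) x = (\<Prod>i<a. x i - x a) * tabsum N (Suc a) r x * alt a ?\<delta> x"
    by (rule key) (fact Suc.prems(2), fact Suc.prems(3))
  ultimately show ?case by (simp add: mult_ac)
qed

lemma alt_delta: "alt n (\<lambda>j. n - Suc j) x = (\<Prod>j<n. \<Prod>i<j. x i - x j)"
proof (induction n)
  case 0
  then show ?case by (simp add: alt_def ldet_def)
next
  case (Suc n)
  let ?\<alpha> = "\<lambda>j. Suc n - Suc j"
  have "PiE {..<n} (\<lambda>j. {?\<alpha> (Suc j)..<?\<alpha> j}) = PiE {..<n} (\<lambda>j. {restrict (\<lambda>j. n - Suc j) {..<n} j})"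
    by (rule PiE_cong) auto
  also have "\<dots> = {restrict (\<lambda>j. n - Suc j) {..<n}}" by (rule PiE_singleton) (rule restrict_extensional)
  finally have "alt (Suc n) ?\<alpha> x = (\<Prod>i<n. x i - x n) * alt n (restrict (\<lambda>j. n - Suc j) {..<n}) x"
    by (subst alt_Suc) auto
  also have "alt n (restrict (\<lambda>j. n - Suc j) {..<n}) x = alt n (\<lambda>j. n - Suc j) x" by (rule alt_cong) simp
  finally show ?case using Suc by (simp add: mult.commute)
qed

section \<open>The Pieri rule and the dimension formula\<close>

text \<open>On nonnegative signatures Schur functions are polynomials and exponents are natural
  numbers. The chain starts there and only adds boxes.\<close>

definition GTpos :: "nat \<Rightarrow> int list set" where
  "GTpos N = {l \<in> GT N. \<forall>i<N. 0 \<le> l ! i}"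

definition expo :: "nat \<Rightarrow> int list \<Rightarrow> nat \<Rightarrow> nat" where
  "expo N l j = nat (l ! j) + (N - Suc j)"

definition row_len :: "nat \<Rightarrow> int list \<Rightarrow> nat \<Rightarrow> nat" where
  "row_len N l i = (if i < N then nat (l ! i - l ! (N - 1)) else 0)"

lemma GT_nth_mono: "l \<in> GT N \<Longrightarrow> i \<le> j \<Longrightarrow> j < N \<Longrightarrow> l ! j \<le> l ! i"
  using sorted_wrt_nth_less[of "(\<ge>)" l i j] by (cases "i = j") (auto simp: GT_def)

lemma expo_pos: "l \<in> GTpos N \<Longrightarrow> j < N \<Longrightarrow> real (expo N l j) = pos N l j"
  by (auto simp: expo_def pos_def GTpos_def of_nat_diff)

lemma expo_less: "l \<in> GTpos N \<Longrightarrow> i < j \<Longrightarrow> j < N \<Longrightarrow> expo N l j < expo N l i"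
  using GT_nth_mono[of l N i j] by (auto simp: expo_def GTpos_def)

lemma cells_rows: "cells N l = row_cells N (row_len N l)"
  by (auto simp: cells_def row_cells_def row_len_def)

lemma SSYT_rows: "SSYT N l = tab N N (row_len N l)"
  unfolding SSYT_def tab_def cells_rows by (simp add: atLeast0LessThan)

lemma schur_rows: "schur N l x = (\<Prod>i<N. x i) powi (l ! (N - 1)) * tabsum N N (row_len N l) x"
  by (simp add: schur_def tabsum_def SSYT_rows cells_rows)

lemma schur_rows_pos:
  "l \<in> GTpos N \<Longrightarrow> N \<ge> 1 \<Longrightarrow> schur N l x = (\<Prod>i<N. x i) ^ nat (l ! (N - 1)) * tabsum N N (row_len N l) x"
  by (simp add: schur_rows GTpos_def power_int_def)

lemma rows_antimono:
  assumes "l \<in> GT N"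
  shows "row_len N l (Suc i) \<le> row_len N l i"
proof (cases "Suc i < N")
  case True
  then have "l ! Suc i \<le> l ! i" using GT_nth_mono[OF assms] by simp
  then show ?thesis using True by (simp add: row_len_def nat_mono)
qed (simp add: row_len_def)

lemma alt_shift: "alt n (\<lambda>j. \<alpha> j + m) x = (\<Prod>i<n. x i) ^ m * alt n \<alpha> x"
  unfolding alt_def power_add mult.commute[of "_ ^ _" "_ ^ m"] ldet_row_factor by (simp add: prod_power_distrib)

text \<open>The factor (x_1 ... x_N)^(lambda_N) shifts every exponent of the alternant by lambda_N,
  which undoes the normalisation of the shape.\<close>

lemma schur_alt:
  assumes "l \<in> GTpos N" "N \<ge> 1"
  shows "schur N l x * alt N (\<lambda>j. N - Suc j) x = alt N (expo N l) x"
proof -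
  have l: "l \<in> GT N" "0 \<le> l ! (N - 1)" using assms by (auto simp: GTpos_def)
  have "tabsum N N (row_len N l) x * alt N (\<lambda>j. N - Suc j) x = alt N (\<lambda>j. row_len N l j + (N - Suc j)) x"
    by (rule tabsum_alt) (simp, rule rows_antimono[OF l(1)], simp add: row_len_def)
  then have "schur N l x * alt N (\<lambda>j. N - Suc j) x = alt N (\<lambda>j. row_len N l j + (N - Suc j) + nat (l ! (N - 1))) x"
    unfolding alt_shift schur_rows_pos[OF assms] by simp
  also have "\<dots> = alt N (expo N l) x"
  proof (rule alt_cong)
    fix j assume j: "j < N"
    then have "j \<le> N - 1" "N - 1 < N" by auto
    then have "l ! (N - 1) \<le> l ! j" by (rule GT_nth_mono[OF l(1)])
    then have "nat (l ! j - l ! (N - 1)) + nat (l ! (N - 1)) = nat (l ! j)" using l(2) by linarith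
    then show "row_len N l j + (N - Suc j) + nat (l ! (N - 1)) = expo N l j"
      unfolding row_len_def expo_def if_P[OF j] by linarith
  qed
  finally show ?thesis .
qed

text \<open>In the term of a permutation p the sum of the variables is the sum of x_(p k), and each
  summand raises the exponent of column k by one.\<close>

lemma alt_times_sum: "(\<Sum>i<n. x i) * alt n \<alpha> x = (\<Sum>j<n. alt n (\<alpha>(j := Suc (\<alpha> j))) x)"
proof -
  have "(\<Prod>j<n. x (p j) ^ (\<alpha>(k := Suc (\<alpha> k))) j) = x (p k) * (\<Prod>j<n. x (p j) ^ \<alpha> j)" if "k < n" for p k
    using that by (simp add: prod.remove[of "{..<n}" k])
  then have "(\<Sum>j<n. alt n (\<alpha>(j := Suc (\<alpha> j))) x) =
      (\<Sum>p | p permutes {..<n}. \<Sum>k<n. of_int (sign p) * (x (p k) * (\<Prod>j<n. x (p j) ^ \<alpha> j)))"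
    unfolding alt_def ldet_def by (subst sum.swap) simp
  also have "\<dots> = (\<Sum>p | p permutes {..<n}. (\<Sum>i<n. x i) * (of_int (sign p) * (\<Prod>j<n. x (p j) ^ \<alpha> j)))"
  proof (rule sum.cong)
    fix p assume "p \<in> {p. p permutes {..<n}}"
    then have "(\<Sum>k<n. x (p k)) = (\<Sum>i<n. x i)" using sum.permute[of p "{..<n}" x] by (simp add: comp_def)
    then show "(\<Sum>k<n. of_int (sign p) * (x (p k) * (\<Prod>j<n. x (p j) ^ \<alpha> j))) =
       (\<Sum>i<n. x i) * (of_int (sign p) * (\<Prod>j<n. x (p j) ^ \<alpha> j))"
      by (simp add: sum_distrib_left[symmetric] sum_distrib_right[symmetric] mult_ac)
  qed simp
  finally show ?thesis by (simp add: alt_def ldet_def sum_distrib_left)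
qed

lemma add_box_blocked:
  assumes l: "l \<in> GT N" and i: "i < N" and n: "add_box l i \<notin> GT N"
  shows "i > 0 \<and> l ! (i - 1) = l ! i"
proof (rule ccontr)
  assume "\<not> ?thesis"
  then have d: "l ! i < l ! (i - 1)" if "i > 0" using that GT_nth_mono[OF l, of "i - 1" i] i by force
  have "add_box l i ! b \<le> add_box l i ! a" if ab: "a < b" "b < N" for a b
  proof (cases "b = i")
    case True
    then have "l ! i < l ! a" using d GT_nth_mono[OF l, of a "i - 1"] ab i by force
    then show ?thesis using True ab l i by (auto simp: add_box_def GT_def)
  next
    case False
    then show ?thesis using GT_nth_mono[OF l, of a b] ab l i by (cases "a = i") (auto simp: add_box_def GT_def)
  qed
  then have "add_box l i \<in> GT N" using l unfolding GT_def sorted_wrt_iff_nth_less by (auto simp: add_box_def)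
  then show False using n by simp
qed

lemma add_box_GTpos: "l \<in> GTpos N \<Longrightarrow> i < N \<Longrightarrow> add_box l i \<in> GT N \<Longrightarrow> add_box l i \<in> GTpos N"
  by (auto simp: GTpos_def GT_def add_box_def nth_list_update)

lemma expo_add_box:
  "l \<in> GTpos N \<Longrightarrow> i < N \<Longrightarrow> j < N \<Longrightarrow> expo N (add_box l i) j = ((expo N l)(i := Suc (expo N l i))) j"
  by (auto simp: expo_def add_box_def GTpos_def GT_def nat_add_distrib)

text \<open>After multiplication by the Vandermonde determinant this is
  \<open>alt_times_sum\<close>; a blocked box makes two exponents equal and its alternant
  vanishes.\<close>

lemma pieri_generic:
  assumes l: "l \<in> GTpos N" and N: "N \<ge> 1" and x: "alt N (\<lambda>j. N - Suc j) x \<noteq> 0"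
  shows "(\<Sum>i<N. x i) * schur N l x = (\<Sum>i<N. if add_box l i \<in> GT N then schur N (add_box l i) x else 0)"
proof -
  let ?d = "alt N (\<lambda>j. N - Suc j) x"
  have "(if add_box l i \<in> GT N then schur N (add_box l i) x else 0) * ?d = alt N ((expo N l)(i := Suc (expo N l i))) x"
    if i: "i < N" for i
  proof (cases "add_box l i \<in> GT N")
    case True
    have "schur N (add_box l i) x * ?d = alt N (expo N (add_box l i)) x"
      by (rule schur_alt[OF add_box_GTpos[OF l i True] N])
    also have "\<dots> = alt N ((expo N l)(i := Suc (expo N l i))) x"
      by (rule alt_cong) (rule expo_add_box[OF l i])
    finally show ?thesis using True by simp
  next
    case False
    then have b: "i > 0" "l ! (i - 1) = l ! i" using add_box_blocked[OF _ i] l by (auto simp: GTpos_def)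
    have "expo N l (i - 1) = Suc (expo N l i)" using b i by (simp add: expo_def Suc_diff_Suc)
    then have "alt N ((expo N l)(i := Suc (expo N l i))) x = 0"
      unfolding alt_def by (intro ldet_equal_columns[of "i - 1" _ i]) (use b i in auto)
    then show ?thesis using False by simp
  qed
  then have "(\<Sum>i<N. if add_box l i \<in> GT N then schur N (add_box l i) x else 0) * ?d = (\<Sum>i<N. x i) * alt N (expo N l) x"
    unfolding alt_times_sum unfolding sum_distrib_right by (intro sum.cong) auto
  also have "\<dots> = (\<Sum>i<N. x i) * schur N l x * ?d" using schur_alt[OF l N] by simp
  finally show ?thesis using x by simp
qed

lemma tendsto_schur:
  assumes "l \<in> GTpos N" "N \<ge> 1" "\<And>i. ((\<lambda>t. y t i) \<longlongrightarrow> x i) F"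
  shows "((\<lambda>t. schur N l (y t)) \<longlongrightarrow> schur N l x) F"
  unfolding schur_rows_pos[OF assms(1,2)] tabsum_def by (intro tendsto_intros assms(3))

text \<open>Both sides are continuous in x, and the points x_i + t i have distinct coordinates for
  all small t > 0, even when coordinates of x coincide.\<close>

lemma pieri:
  assumes l: "l \<in> GTpos N" and N: "N \<ge> 1"
  shows "(\<Sum>i<N. x i) * schur N l x = (\<Sum>i<N. if add_box l i \<in> GT N then schur N (add_box l i) x else 0)"
proof -
  let ?y = "\<lambda>t i. x i + t * real i"
  have y: "((\<lambda>t. ?y t i) \<longlongrightarrow> x i) (at_right 0)" for i
    by (auto intro!: tendsto_eq_intros)
  have "\<forall>\<^sub>F t in at_right 0. \<forall>j\<in>{..<N}. \<forall>i\<in>{..<j}. ?y t i - ?y t j \<noteq> 0"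
  proof (intro eventually_ball_finite ballI)
    fix j i assume "j \<in> {..<N}" "i \<in> {..<j}"
    then have ij: "real i - real j \<noteq> 0" by auto
    show "\<forall>\<^sub>F t in at_right 0. ?y t i - ?y t j \<noteq> 0"
    proof (cases "x i = x j")
      case True
      have "\<forall>\<^sub>F t in at_right 0. t > (0::real)" by (rule eventually_at_right_less)
      then show ?thesis by eventually_elim (use True ij in auto)
    next
      case False
      have "((\<lambda>t. ?y t i - ?y t j) \<longlongrightarrow> x i - x j) (at_right 0)" by (intro tendsto_diff y)
      then show ?thesis by (rule tendsto_imp_eventually_ne) (use False in simp)
    qed
  qed auto
  then have ev: "\<forall>\<^sub>F t in at_right 0. (\<Sum>i<N. ?y t i) * schur N l (?y t) = (\<Sum>i<N. if add_box l i \<in> GT N then schur N (add_box l i) (?y t) else 0)"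
  proof eventually_elim
    case (elim t)
    have "alt N (\<lambda>j. N - Suc j) (?y t) \<noteq> 0" unfolding alt_delta using elim by auto
    then show ?case by (rule pieri_generic[OF l N])
  qed
  have L1: "((\<lambda>t. (\<Sum>i<N. ?y t i) * schur N l (?y t)) \<longlongrightarrow> (\<Sum>i<N. x i) * schur N l x) (at_right 0)"
    by (intro tendsto_mult tendsto_sum tendsto_schur[OF l N] y)
  have L2: "((\<lambda>t. \<Sum>i<N. if add_box l i \<in> GT N then schur N (add_box l i) (?y t) else 0) \<longlongrightarrow>
      (\<Sum>i<N. if add_box l i \<in> GT N then schur N (add_box l i) x else 0)) (at_right 0)"
  proof (rule tendsto_sum)
    fix i assume "i \<in> {..<N}"
    then show "((\<lambda>t. if add_box l i \<in> GT N then schur N (add_box l i) (?y t) else 0) \<longlongrightarrow>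
      (if add_box l i \<in> GT N then schur N (add_box l i) x else 0)) (at_right 0)"
      using tendsto_schur[OF add_box_GTpos[OF l] N y] by (cases "add_box l i \<in> GT N") auto
  qed
  show ?thesis by (rule tendsto_unique[OF _ Lim_transform_eventually[OF L1 ev] L2]) simp
qed

section \<open>Principal specialization and ratios of dimensions\<close>

lemma alt_transpose: "alt n \<alpha> (\<lambda>i. q ^ \<beta> i) = alt n \<beta> (\<lambda>i. q ^ \<alpha> i)"
proof -
  have "alt n \<alpha> (\<lambda>i. q ^ \<beta> i) = (\<Sum>p | p permutes {..<n}. of_int (sign (inv p)) * (\<Prod>j<n. (q ^ \<beta> (inv p j)) ^ \<alpha> j))"
    unfolding alt_def ldet_def by (rule sum_permutations_inverse)
  also have "\<dots> = (\<Sum>p | p permutes {..<n}. of_int (sign p) * (\<Prod>j<n. (q ^ \<alpha> (p j)) ^ \<beta> j))"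
  proof (rule sum.cong)
    fix p assume "p \<in> {p. p permutes {..<n}}"
    then have p: "p permutes {..<n}" by simp
    have "permutation p" using p permutation_permutes by (metis finite_lessThan)
    moreover have "(\<Prod>j<n. (q ^ \<beta> (inv p j)) ^ \<alpha> j) = (\<Prod>j<n. (q ^ \<alpha> (p j)) ^ \<beta> j)"
      by (subst prod.permute[OF p]) (simp add: comp_def permutes_inverses(2)[OF p] power_mult[symmetric] mult.commute)
    ultimately show "of_int (sign (inv p)) * (\<Prod>j<n. (q ^ \<beta> (inv p j)) ^ \<alpha> j) = of_int (sign p) * (\<Prod>j<n. (q ^ \<alpha> (p j)) ^ \<beta> j)"
      by (simp add: sign_inverse)
  qed simp
  finally show ?thesis by (simp add: alt_def ldet_def)
qed

definition vdm :: "nat \<Rightarrow> (nat \<Rightarrow> real) \<Rightarrow> real" where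
  "vdm n y = (\<Prod>j<n. \<Prod>i<j. y i - y j)"

lemma vdm_pos: "(\<And>i j. i < j \<Longrightarrow> j < n \<Longrightarrow> y j < y i) \<Longrightarrow> vdm n y > 0"
  unfolding vdm_def by (intro prod_pos) auto

text \<open>Principal specialization \<open>x\<^sub>i = q\<^bsup>N-1-i\<^esup>\<close> turns both alternants into Vandermonde products in powers
  of \<open>q\<close>; the dimension formula is the limit \<open>q \<rightarrow> 1\<close>.\<close>

lemma schur_dimension:
  assumes l: "l \<in> GTpos N" and N: "N \<ge> 1"
  shows "schur N l (\<lambda>_. 1) * vdm N (\<lambda>j. real (N - Suc j)) = vdm N (\<lambda>j. real (expo N l j))"
proof -
  \<comment> \<open>Both alternants have the same number of factors, so dividing each factor by q -
    1 keeps the identity and gives every factor the limit \<alpha>_i - \<alpha>_j.\<close>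
  let ?\<delta> = "\<lambda>j. N - Suc j" and ?V = "\<lambda>\<alpha> q. \<Prod>j<N. \<Prod>i<j. (q ^ \<alpha> i - q ^ \<alpha> j) / (q - 1)"
  have lim: "((\<lambda>q. (q ^ a - q ^ b) / (q - 1)) \<longlongrightarrow> real a - real b) (at_right 1)" for a b
  proof -
    have "((\<lambda>q. q ^ a - q ^ b) has_real_derivative real a - real b) (at 1)"
      by (auto intro!: derivative_eq_intros)
    then have "((\<lambda>q. (q ^ a - q ^ b - (1 ^ a - 1 ^ b)) / (q - 1)) \<longlongrightarrow> real a - real b) (at 1)"
      by (simp add: has_field_derivative_iff)
    then show ?thesis by (simp add: filterlim_at_split)
  qed
  have V: "(?V \<alpha> \<longlongrightarrow> vdm N (\<lambda>j. real (\<alpha> j))) (at_right 1)" for \<alpha>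
    unfolding vdm_def by (intro tendsto_prod lim)
  have eq: "schur N l (\<lambda>i. q ^ ?\<delta> i) * ?V ?\<delta> q = ?V (expo N l) q" for q
  proof -
    have "schur N l (\<lambda>i. q ^ ?\<delta> i) * alt N ?\<delta> (\<lambda>i. q ^ ?\<delta> i) = alt N ?\<delta> (\<lambda>i. q ^ expo N l i)"
      unfolding schur_alt[OF l N] by (rule alt_transpose)
    moreover have "?V \<alpha> q = alt N ?\<delta> (\<lambda>i. q ^ \<alpha> i) / (\<Prod>j<N. \<Prod>i<j. q - 1)" for \<alpha>
      unfolding alt_delta prod_dividef ..
    ultimately show ?thesis by simp
  qed
  have "((\<lambda>q::real. q ^ ?\<delta> i) \<longlongrightarrow> 1) (at_right 1)" for i
    by (auto intro!: tendsto_eq_intros)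
  then have "((\<lambda>q. schur N l (\<lambda>i. q ^ ?\<delta> i)) \<longlongrightarrow> schur N l (\<lambda>_. 1)) (at_right 1)"
    by (intro tendsto_schur[OF l N])
  then have "(?V (expo N l) \<longlongrightarrow> schur N l (\<lambda>_. 1) * vdm N (\<lambda>j. real (?\<delta> j))) (at_right 1)"
    using V[of ?\<delta>] unfolding eq[symmetric] by (intro tendsto_mult)
  then show ?thesis using V[of "expo N l"] tendsto_unique trivial_limit_at_right_real by blast
qed

lemma schur_one_pos:
  assumes l: "l \<in> GTpos N" and N: "N \<ge> 1"
  shows "schur N l (\<lambda>_. 1) > 0"
proof -
  have "vdm N (\<lambda>j. real (N - Suc j)) > 0" by (rule vdm_pos) auto
  moreover have "vdm N (\<lambda>j. real (expo N l j)) > 0" by (rule vdm_pos) (auto intro: expo_less[OF l])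
  ultimately show ?thesis using schur_dimension[OF assms] by (metis zero_less_mult_pos2)
qed

text \<open>Only differences involving k change, and by the same kind of factor whether k comes
  first or second, since numerator and denominator change sign together.\<close>

lemma vdm_increment:
  assumes k: "k < n" and inj: "\<And>i j. i < j \<Longrightarrow> j < n \<Longrightarrow> y i \<noteq> y j"
  shows "vdm n (y(k := y k + 1)) = vdm n y * (\<Prod>j\<in>{..<n} - {k}. (y k + 1 - y j) / (y k - y j))"
proof -
  let ?y = "y(k := y k + 1)" and ?h = "\<lambda>j. (y k + 1 - y j) / (y k - y j)"
  have g: "?y i - ?y j = (y i - y j) * (if i = k then ?h j else if j = k then ?h i else 1)" if "i < j" "j < n" for i j
    using inj[OF that] that by (auto simp: divide_simps) (auto simp: algebra_simps)
  have inner: "(\<Prod>i<j. if i = k then ?h j else if j = k then ?h i else 1) = (if j = k then \<Prod>i<k. ?h i else if k < j then ?h j else 1)" for j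
  proof (cases "j = k")
    case True
    then show ?thesis by (auto intro!: prod.cong)
  next
    case False
    then have "(\<Prod>i<j. if i = k then ?h j else if j = k then ?h i else 1) = (\<Prod>i<j. if i = k then ?h j else 1)"
      by (intro prod.cong) auto
    then show ?thesis using False by simp
  qed
  have "vdm n ?y = (\<Prod>j<n. \<Prod>i<j. (y i - y j) * (if i = k then ?h j else if j = k then ?h i else 1))"
    unfolding vdm_def by (intro prod.cong refl g) auto
  also have "\<dots> = vdm n y * (\<Prod>j<n. if j = k then \<Prod>i<k. ?h i else if k < j then ?h j else 1)"
    unfolding prod.distrib inner vdm_def ..
  also have "(\<Prod>j<n. if j = k then \<Prod>i<k. ?h i else if k < j then ?h j else 1) = (\<Prod>i<k. ?h i) * (\<Prod>j\<in>{..<n} - {k}. if k < j then ?h j else 1)"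
    using k by (subst prod.remove[of _ k]) auto
  also have "(\<Prod>j\<in>{..<n} - {k}. if k < j then ?h j else 1) = (\<Prod>j\<in>{k<..<n}. ?h j)"
    by (rule prod.mono_neutral_cong_right) auto
  also have "(\<Prod>i<k. ?h i) * (\<Prod>j\<in>{k<..<n}. ?h j) = (\<Prod>j\<in>{..<k} \<union> {k<..<n}. ?h j)"
    by (rule prod.union_disjoint[symmetric]) auto
  also have "{..<k} \<union> {k<..<n} = {..<n} - {k}" using k by auto
  finally show ?thesis .
qed

lemma schur_ratio_wgt:
  assumes l: "l \<in> GTpos N" and N: "N \<ge> 1" and i: "i < N" and b: "add_box l i \<in> GT N"
  shows "wgt N l i = schur N (add_box l i) (\<lambda>_. 1) / (real N * schur N l (\<lambda>_. 1))"
proof -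
  let ?d = "vdm N (\<lambda>j. real (N - Suc j))" and ?e = "\<lambda>j. real (expo N l j)"
  have d: "?d > 0" by (rule vdm_pos) auto
  have lb: "add_box l i \<in> GTpos N" by (rule add_box_GTpos[OF l i b])
  have "schur N (add_box l i) (\<lambda>_. 1) * ?d = vdm N (\<lambda>j. real (expo N (add_box l i) j))"
    by (rule schur_dimension[OF lb N])
  also have "\<dots> = vdm N (?e(i := ?e i + 1))"
    unfolding vdm_def by (intro prod.cong refl) (auto simp: expo_add_box[OF l i])
  also have "\<dots> = vdm N ?e * (\<Prod>j\<in>{..<N} - {i}. (?e i + 1 - ?e j) / (?e i - ?e j))"
    by (rule vdm_increment[OF i]) (use expo_less[OF l] in force)
  also have "vdm N ?e = schur N l (\<lambda>_. 1) * ?d" by (rule schur_dimension[OF l N, symmetric])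
  also have "(\<Prod>j\<in>{..<N} - {i}. (?e i + 1 - ?e j) / (?e i - ?e j)) = real N * wgt N l i"
    using N unfolding wgt_def by (simp add: expo_pos[OF l] i)
  finally have "schur N (add_box l i) (\<lambda>_. 1) = schur N l (\<lambda>_. 1) * (real N * wgt N l i)" using d by simp
  then show ?thesis using schur_one_pos[OF l N] N by simp
qed

lemma wgt_blocked:
  assumes "l \<in> GT N" "i < N" "add_box l i \<notin> GT N"
  shows "wgt N l i = 0"
  using add_box_GT[OF assms(1,2)] assms(3) by blast

text \<open>The weights are ratios of dimensions, so this is the Pieri rule divided by N
  s_lambda(1^N). Normalised Schur functions are eigenfunctions of the transition operator, and each
  step multiplies the generating function by the mean of the variables.\<close>

lemma schur_harmonic:
  assumes l: "l \<in> GTpos N" and N: "N \<ge> 1"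
  shows "(\<Sum>i<N. wgt N l i * (schur N (add_box l i) x / schur N (add_box l i) (\<lambda>_. 1))) =
    (\<Sum>i<N. x i) / real N * (schur N l x / schur N l (\<lambda>_. 1))"
proof -
  have "wgt N l i * (schur N (add_box l i) x / schur N (add_box l i) (\<lambda>_. 1)) =
     (if add_box l i \<in> GT N then schur N (add_box l i) x else 0) / (real N * schur N l (\<lambda>_. 1))" if i: "i < N" for i
  proof (cases "add_box l i \<in> GT N")
    case True
    have "schur N (add_box l i) (\<lambda>_. 1) > 0" by (rule schur_one_pos[OF add_box_GTpos[OF l i True] N])
    then show ?thesis using True by (simp add: schur_ratio_wgt[OF l N i True])
  next
    case False
    then show ?thesis using wgt_blocked[OF _ i False] l by (simp add: GTpos_def)
  qed
  then have "(\<Sum>i<N. wgt N l i * (schur N (add_box l i) x / schur N (add_box l i) (\<lambda>_. 1))) =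
     (\<Sum>i<N. if add_box l i \<in> GT N then schur N (add_box l i) x else 0) / (real N * schur N l (\<lambda>_. 1))"
    unfolding sum_divide_distrib by (intro sum.cong) auto
  then show ?thesis unfolding pieri[OF l N, symmetric] by simp
qed

section \<open>The decomposition measure\<close>

lemma GTpos_replicate: "replicate N 0 \<in> GTpos N"
  using GT_replicate by (simp add: GTpos_def)

lemma GTpos_step: "l \<in> GTpos N \<Longrightarrow> i < N \<Longrightarrow> wgt N l i \<noteq> 0 \<Longrightarrow> add_box l i \<in> GTpos N"
  using add_box_GTpos add_box_GT by (simp add: GTpos_def)

lemma EE_normalized_schur:
  assumes N: "N \<ge> 1"
  shows "EE N n (\<lambda>l. schur N l x / schur N l (\<lambda>_. 1)) = ((\<Sum>i<N. x i) / real N) ^ n"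
proof (induction n)
  case 0
  have "schur N (replicate N 0) y = 1" for y
    using N by (simp add: schur_rows tabsum_empty_shape row_len_def)
  then show ?case by simp
next
  case (Suc n)
  have "EE N (Suc n) (\<lambda>l. schur N l x / schur N l (\<lambda>_. 1)) =
      EE N n (\<lambda>l. (\<Sum>i<N. x i) / real N * (schur N l x / schur N l (\<lambda>_. 1)))"
    unfolding EE.simps
    by (rule EE_cong_invariant[where I = "GTpos N"]) (rule GTpos_replicate, erule (2) GTpos_step, erule schur_harmonic[OF _ N])
  then show ?case unfolding EE_cmult Suc by simp
qed

definition step_pmf :: "nat \<Rightarrow> int list \<Rightarrow> nat pmf" where
  "step_pmf N l = embed_pmf (\<lambda>i. if i < N then wgt N l i else 0)"

primrec chain :: "nat \<Rightarrow> nat \<Rightarrow> int list pmf" where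
  "chain N 0 = return_pmf (replicate N 0)"
| "chain N (Suc n) = bind_pmf (chain N n) (\<lambda>l. map_pmf (add_box l) (step_pmf N l))"

lemma pmf_step_pmf:
  assumes "l \<in> GT N" "N \<ge> 1"
  shows "pmf (step_pmf N l) i = (if i < N then wgt N l i else 0)"
  unfolding step_pmf_def
proof (rule pmf_embed_pmf)
  show "0 \<le> (if i < N then wgt N l i else 0)" for i using wgt_nonneg[OF assms(1)] by simp
  have "(\<integral>\<^sup>+ i. ennreal (if i < N then wgt N l i else 0) \<partial>count_space UNIV) = (\<Sum>i<N. ennreal (if i < N then wgt N l i else 0))"
    by (rule nn_integral_count_space') auto
  also have "\<dots> = ennreal (\<Sum>i<N. if i < N then wgt N l i else 0)"
    using wgt_nonneg[OF assms(1)] by (intro sum_ennreal) auto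
  also have "(\<Sum>i<N. if i < N then wgt N l i else 0) = (\<Sum>i<N. wgt N l i)" by simp
  finally show "(\<integral>\<^sup>+ i. ennreal (if i < N then wgt N l i else 0) \<partial>count_space UNIV) = 1"
    using sum_wgt[OF assms] by simp
qed

lemma set_step_pmf: "l \<in> GT N \<Longrightarrow> N \<ge> 1 \<Longrightarrow> set_pmf (step_pmf N l) = {i. i < N \<and> wgt N l i \<noteq> 0}"
  by (auto simp: set_pmf_eq pmf_step_pmf split: if_splits)

text \<open>Finite support makes every expectation a finite sum, so the law of the chain and
  \<open>EE\<close> agree for arbitrary test functions.\<close>

lemma chain_properties:
  assumes N: "N \<ge> 1"
  shows "finite (set_pmf (chain N n)) \<and> set_pmf (chain N n) \<subseteq> GTpos N \<and>
    (\<forall>F. measure_pmf.expectation (chain N n) F = EE N n F)"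
proof (induction n)
  case 0
  then show ?case using GTpos_replicate by simp
next
  case (Suc n)
  then have fin: "finite (set_pmf (chain N n))" and sub: "set_pmf (chain N n) \<subseteq> GTpos N"
    and E: "\<And>F. measure_pmf.expectation (chain N n) F = EE N n F" by auto
  have GT: "l \<in> GT N" if "l \<in> set_pmf (chain N n)" for l using sub that by (auto simp: GTpos_def)
  have s: "set_pmf (step_pmf N l) = {i. i < N \<and> wgt N l i \<noteq> 0}" if "l \<in> set_pmf (chain N n)" for l
    by (rule set_step_pmf[OF GT[OF that] N])
  have "set_pmf (chain N (Suc n)) = (\<Union>l\<in>set_pmf (chain N n). add_box l ` {i. i < N \<and> wgt N l i \<noteq> 0})"
    using s by simp
  then have 1: "finite (set_pmf (chain N (Suc n)))" "set_pmf (chain N (Suc n)) \<subseteq> GTpos N"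
    using fin sub GTpos_step by auto
  have 2: "measure_pmf.expectation (chain N (Suc n)) F = EE N (Suc n) F" for F
  proof -
    have "measure_pmf.expectation (chain N (Suc n)) F =
       (\<Sum>l\<in>set_pmf (chain N n). pmf (chain N n) l *\<^sub>R measure_pmf.expectation (map_pmf (add_box l) (step_pmf N l)) F)"
      unfolding chain.simps by (rule pmf_expectation_bind[OF fin]) (auto simp: s)
    also have "\<dots> = (\<Sum>l\<in>set_pmf (chain N n). pmf (chain N n) l *\<^sub>R (\<Sum>i<N. wgt N l i * F (add_box l i)))"
    proof (rule sum.cong)
      fix l assume l: "l \<in> set_pmf (chain N n)"
      have "measure_pmf.expectation (map_pmf (add_box l) (step_pmf N l)) F = (\<Sum>i<N. F (add_box l i) * pmf (step_pmf N l) i)"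
        unfolding integral_map_pmf by (rule integral_measure_pmf_real) (auto simp: s[OF l])
      then show "pmf (chain N n) l *\<^sub>R measure_pmf.expectation (map_pmf (add_box l) (step_pmf N l)) F =
          pmf (chain N n) l *\<^sub>R (\<Sum>i<N. wgt N l i * F (add_box l i))"
        by (simp add: pmf_step_pmf[OF GT[OF l] N] mult.commute)
    qed simp
    also have "\<dots> = measure_pmf.expectation (chain N n) (\<lambda>l. \<Sum>i<N. wgt N l i * F (add_box l i))"
      by (rule integral_measure_pmf[symmetric]) (auto simp: fin)
    finally show ?thesis by (simp add: E)
  qed
  show ?case using 1 2 by blast
qed

lemma has_SGF_chain:
  assumes N: "N \<ge> 1"
  shows "has_SGF N (chain N n) (\<lambda>x. (\<Sum>i<N. x i) ^ n / real N ^ n)"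
proof -
  have fin: "finite (set_pmf (chain N n))" and sub: "set_pmf (chain N n) \<subseteq> GTpos N"
    and E: "\<And>F. measure_pmf.expectation (chain N n) F = EE N n F" using chain_properties[OF N] by auto
  have "((\<lambda>l. pmf (chain N n) l * schur N l x / schur N l (\<lambda>_. 1)) has_sum (\<Sum>i<N. x i) ^ n / real N ^ n) (GT N)" for x
  proof (rule has_sum_finite_neutralI[OF fin])
    show "set_pmf (chain N n) \<subseteq> GT N" using sub by (auto simp: GTpos_def)
    show "pmf (chain N n) l * schur N l x / schur N l (\<lambda>_. 1) = 0" if "l \<in> GT N - set_pmf (chain N n)" for l
      using that by (simp add: set_pmf_iff)
    have "measure_pmf.expectation (chain N n) (\<lambda>l. schur N l x / schur N l (\<lambda>_. 1)) =
       (\<Sum>l\<in>set_pmf (chain N n). schur N l x / schur N l (\<lambda>_. 1) * pmf (chain N n) l)"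
      by (rule integral_measure_pmf_real) (auto simp: fin)
    then show "(\<Sum>i<N. x i) ^ n / real N ^ n = (\<Sum>l\<in>set_pmf (chain N n). pmf (chain N n) l * schur N l x / schur N l (\<lambda>_. 1))"
      unfolding E EE_normalized_schur[OF N] by (simp add: power_divide mult_ac)
  qed
  then show ?thesis using sub by (auto simp: has_SGF_def GTpos_def)
qed

text \<open>The tableau with constant rows \<open>T(i, j) = i\<close> contributes the highest weight monomial.\<close>

lemma schur_lower_bound:
  assumes l: "l \<in> GT N" and N: "N \<ge> 1" and x: "\<And>i. i < N \<Longrightarrow> x i > 0"
  shows "(\<Prod>i<N. x i powi (l ! i)) \<le> schur N l x"
proof -
  let ?r = "row_len N l" and ?m = "l ! (N - 1)"
  let ?T = "restrict fst (row_cells N ?r)"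
  have "?T \<in> row_cells N ?r \<rightarrow>\<^sub>E {..<N}"
    unfolding restrict_PiE_iff by (auto simp: row_cells_def)
  moreover have "?T (i, j) \<le> ?T (i, Suc j)" if "(i, j) \<in> row_cells N ?r \<and> (i, Suc j) \<in> row_cells N ?r" for i j
    using that by simp
  moreover have "?T (i, j) < ?T (Suc i, j)" if "(i, j) \<in> row_cells N ?r \<and> (Suc i, j) \<in> row_cells N ?r" for i j
    using that by simp
  ultimately have T: "?T \<in> tab N N ?r" unfolding tab_def by blast
  have nn: "0 \<le> (\<Prod>c\<in>row_cells N ?r. x (T c))" if "T \<in> tab N N ?r" for T
  proof (rule prod_nonneg)
    fix c assume "c \<in> row_cells N ?r"
    then have "T c < N" using that by (auto simp: tab_def)
    then show "0 \<le> x (T c)" using x by (simp add: less_imp_le)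
  qed
  have sig: "row_cells N ?r = (SIGMA i:{..<N}. {..<?r i})" by (auto simp: row_cells_def)
  have "(\<Prod>c\<in>row_cells N ?r. x (?T c)) = (\<Prod>c\<in>row_cells N ?r. x (fst c))" by (rule prod.cong) auto
  also have "\<dots> = (\<Prod>i<N. \<Prod>j<?r i. x i)" unfolding sig by (subst prod.Sigma) (auto simp: case_prod_unfold)
  finally have mono: "(\<Prod>c\<in>row_cells N ?r. x (?T c)) = (\<Prod>i<N. x i ^ ?r i)" by simp
  have "(\<Prod>i<N. x i powi (l ! i)) = (\<Prod>i<N. x i powi ?m * x i ^ ?r i)"
  proof (rule prod.cong)
    fix i assume i: "i \<in> {..<N}"
    have "l ! i = ?m + int (?r i)" using GT_nth_mono[OF l, of i "N - 1"] i by (auto simp: row_len_def)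
    moreover have "x i powi (?m + int (?r i)) = x i powi ?m * x i powi int (?r i)"
      using x[of i] i by (intro power_int_add) auto
    ultimately show "x i powi (l ! i) = x i powi ?m * x i ^ ?r i" by simp
  qed simp
  also have "\<dots> = (\<Prod>i<N. x i) powi ?m * (\<Prod>c\<in>row_cells N ?r. x (?T c))"
  proof -
    have "(\<Prod>i<n. x i powi ?m) = (\<Prod>i<n. x i) powi ?m" for n
      by (induction n) (simp_all add: power_int_mult_distrib)
    then show ?thesis unfolding mono prod.distrib by simp
  qed
  also have "\<dots> \<le> (\<Prod>i<N. x i) powi ?m * tabsum N N ?r x"
    unfolding tabsum_def
  proof (rule mult_left_mono)
    show "(\<Prod>c\<in>row_cells N ?r. x (?T c)) \<le> (\<Sum>T\<in>tab N N ?r. \<Prod>c\<in>row_cells N ?r. x (T c))"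
      by (rule member_le_sum[OF T]) (auto intro: nn)
    show "0 \<le> (\<Prod>i<N. x i) powi ?m" using x by (intro zero_le_power_int prod_nonneg) (auto intro: less_imp_le)
  qed
  finally show ?thesis by (simp add: schur_rows)
qed

section \<open>Support and uniqueness of the measure\<close>

text \<open>All terms of the series are nonnegative, so each is bounded by the total. With one
  variable small or large, a negative last part or a first part above n would make the term of
  \<open>l\<close> exceed that total. Hence the support is finite and uniqueness becomes linear
  algebra.\<close>

lemma SGF_support:
  assumes N: "N \<ge> 1" and sgf: "has_SGF N \<rho> (\<lambda>x. (\<Sum>i<N. x i) ^ n / real N ^ n)" and l: "l \<in> set_pmf \<rho>"
  shows "l \<in> GTpos N \<and> (\<forall>i<N. l ! i \<le> int n)"
proof -
  have GT: "l \<in> GT N" using sgf l by (auto simp: has_SGF_def)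
  have pos1: "schur N m (\<lambda>_. 1) > 0" if "m \<in> GT N" for m
    using schur_lower_bound[OF that N, of "\<lambda>_. 1"] by simp
  define c where "c = pmf \<rho> l / schur N l (\<lambda>_. 1)"
  have c: "c > 0" using l pos1[OF GT] by (simp add: c_def pmf_positive)
  have bound: "c * (\<Prod>i<N. x i powi (l ! i)) \<le> (\<Sum>i<N. x i) ^ n / real N ^ n" if x: "\<And>i. i < N \<Longrightarrow> x i > 0" for x
  proof -
    have hs: "((\<lambda>l. pmf \<rho> l * schur N l x / schur N l (\<lambda>_. 1)) has_sum (\<Sum>i<N. x i) ^ n / real N ^ n) (GT N)"
      using sgf x by (auto simp: has_SGF_def)
    have nn: "0 \<le> pmf \<rho> m * schur N m x / schur N m (\<lambda>_. 1)" if "m \<in> GT N" for m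
    proof -
      have "0 \<le> (\<Prod>i<N. x i powi (m ! i))" using x by (intro prod_nonneg) (auto intro!: zero_le_power_int less_imp_le)
      then have "0 \<le> schur N m x" using schur_lower_bound[of m N x, OF that N x] by linarith
      then show ?thesis using pos1[OF that] by simp
    qed
    have "c * (\<Prod>i<N. x i powi (l ! i)) \<le> c * schur N l x"
      using c schur_lower_bound[of l N x, OF GT N x] by (intro mult_left_mono) auto
    also have "\<dots> = (\<Sum>l\<in>{l}. pmf \<rho> l * schur N l x / schur N l (\<lambda>_. 1))" by (simp add: c_def)
    also have "\<dots> \<le> (\<Sum>i<N. x i) ^ n / real N ^ n"
      by (rule finite_sum_le_has_sum[OF hs]) (use GT nn in auto)
    finally show ?thesis .
  qed
  have single: "(\<Prod>i<N. ((\<lambda>_. 1)(k := y)) i powi (l ! i)) = y powi (l ! k)" if "k < N" for k and y :: real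
    using that by (subst prod.remove[of _ k]) (auto intro!: prod.neutral)
  have c1: "c \<le> 1" using bound[of "\<lambda>_. 1"] N by simp
  have "0 \<le> l ! (N - 1)"
  proof (rule ccontr)
    assume neg: "\<not> ?thesis"
    \<comment> \<open>Then c * y^(-1) = 2, while the total at this point is at most 1.\<close>
    define y where "y = c / 2"
    have y: "0 < y" "y < 1" using c c1 by (auto simp: y_def)
    have "y powi (- 1) \<le> y powi (l ! (N - 1))"
      using y neg by (intro power_int_decreasing) auto
    then have "c * y powi (- 1) \<le> c * y powi (l ! (N - 1))" using c by (intro mult_left_mono) auto
    also have "\<dots> \<le> (\<Sum>i<N. ((\<lambda>_. 1)(N - 1 := y)) i) ^ n / real N ^ n"
      using bound[of "(\<lambda>_. 1)(N - 1 := y)"] y N unfolding single[of "N - 1", OF diff_less[OF zero_less_one N[unfolded One_nat_def Suc_le_eq]]] by auto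
    also have "\<dots> \<le> 1"
    proof -
      have "(\<Sum>i<N. ((\<lambda>_. 1)(N - 1 := y)) i) \<le> (\<Sum>i<N. 1)" using y by (intro sum_mono) auto
      moreover have "0 \<le> (\<Sum>i<N. ((\<lambda>_. 1)(N - 1 := y)) i)" using y by (intro sum_nonneg) auto
      ultimately have "(\<Sum>i<N. ((\<lambda>_. 1)(N - 1 := y)) i) ^ n \<le> real N ^ n" by (intro power_mono) auto
      then show ?thesis using N by simp
    qed
    finally show False using c by (simp add: y_def power_int_minus)
  qed
  moreover have "l ! 0 \<le> int n"
  proof (rule ccontr)
    assume big: "\<not> ?thesis"
    \<comment> \<open>Then c * y = 2, while the comparison forces c * y <= 1.\<close>
    define y where "y = 2 / c"
    have y: "1 < y" using c c1 by (simp add: y_def field_simps)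
    have "y ^ n * y = y powi (int n + 1)" using y by (simp add: power_int_add)
    also have "\<dots> \<le> y powi (l ! 0)" using y big by (intro power_int_increasing) auto
    finally have "c * (y ^ n * y) \<le> c * y powi (l ! 0)" using c by (intro mult_left_mono) auto
    also have "\<dots> \<le> (\<Sum>i<N. ((\<lambda>_. 1)(0 := y)) i) ^ n / real N ^ n"
      using bound[of "(\<lambda>_. 1)(0 := y)"] y N unfolding single[of 0, OF N[unfolded One_nat_def Suc_le_eq]] by auto
    also have "\<dots> \<le> (real N * y) ^ n / real N ^ n"
    proof -
      have "(\<Sum>i<N. ((\<lambda>_. 1)(0 := y)) i) \<le> (\<Sum>i<N. y)" using y by (intro sum_mono) auto
      moreover have "0 \<le> (\<Sum>i<N. ((\<lambda>_. 1)(0 := y)) i)" using y by (intro sum_nonneg) auto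
      ultimately show ?thesis by (intro divide_right_mono power_mono) auto
    qed
    also have "\<dots> = y ^ n" using N by (simp add: power_mult_distrib)
    finally have "(c * y) * y ^ n \<le> 1 * y ^ n" by (simp only: mult_ac mult_1_left mult_1_right)
    moreover have "0 < y ^ n" using y by simp
    ultimately have "c * y \<le> 1" by (rule mult_right_le_imp_le)
    then show False using c by (simp add: y_def)
  qed
  moreover have "l ! (N - 1) \<le> l ! i \<and> l ! i \<le> l ! 0" if "i < N" for i
    using GT_nth_mono[OF GT, of 0 i] GT_nth_mono[OF GT, of i "N - 1"] that by simp
  ultimately show ?thesis
    using GT order_trans unfolding GTpos_def by blast
qed

lemma finite_GT_box: "finite {l \<in> GTpos N. \<forall>i<N. l ! i \<le> int n}"
proof (rule finite_subset)
  show "{l \<in> GTpos N. \<forall>i<N. l ! i \<le> int n} \<subseteq> {xs. set xs \<subseteq> {0..int n} \<and> length xs = N}"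
    by (auto simp: GTpos_def GT_def in_set_conv_nth)
  show "finite {xs. set xs \<subseteq> {0..int n} \<and> length xs = N}" by (intro finite_lists_length_eq) simp
qed

lemma expo_inj:
  assumes "l \<in> GTpos N" "m \<in> GTpos N" "\<And>j. j < N \<Longrightarrow> expo N l j = expo N m j"
  shows "l = m"
proof (rule nth_equalityI)
  show "length l = length m" using assms by (simp add: GTpos_def GT_def)
  fix i assume "i < length l"
  then have "i < N" using assms by (simp add: GTpos_def GT_def)
  then have "nat (l ! i) = nat (m ! i)" using assms(3)[of i] unfolding expo_def by linarith
  then show "l ! i = m ! i" using \<open>i < N\<close> assms(1,2) by (simp add: GTpos_def eq_nat_nat_iff)
qed

text \<open>Both sequences decrease strictly, so p is increasing; then i <= p i for every i, and
  equality of the sums forces equality termwise.\<close>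

lemma strict_decreasing_perm_id:
  fixes n :: nat
  assumes p: "p permutes {..<n}" and a: "\<And>i j. i < j \<Longrightarrow> j < n \<Longrightarrow> a j < (a i :: nat)"
    and b: "\<And>i j. i < j \<Longrightarrow> j < n \<Longrightarrow> b j < (b i :: nat)" and ab: "\<And>j. j < n \<Longrightarrow> a (p j) = b j"
  shows "p = id"
proof -
  have inc: "p i < p j" if "i < j" "j < n" for i j
  proof (rule ccontr)
    assume "\<not> p i < p j"
    moreover have "p i \<noteq> p j" using that injD[OF permutes_inj[OF p], of i j] by auto
    ultimately have "p j < p i" "p i < n" using permutes_lessThan[OF p, of i] that by auto
    then have "a (p i) < a (p j)" by (rule a)
    then show False using b[OF that] ab[of i] ab[of j] that by simp
  qed
  have ge: "i \<le> p i" if "i < n" for i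
    using that
  proof (induction i)
    case (Suc i)
    then show ?case using inc[of i "Suc i"] by simp
  qed simp
  have "(\<Sum>i<n. p i) = (\<Sum>i<n. i)" using sum.permute[OF p, of id] by (simp add: comp_def)
  then have "p i = i" if "i < n" for i
    using sum_mono_inv[of "\<lambda>i. i" "{..<n}" p i] ge that by simp
  then show ?thesis using permutes_not_in[OF p] by (auto simp: fun_eq_iff)
qed

text \<open>Take \<open>x\<^sub>i = q\<^bsup>\<mu>\<^sub>i\<^esup>\<close> with \<open>\<mu>\<close> of maximal Euclidean norm in the support: by Cauchy-Schwarz the power
  \<open>q\<^bsup>\<bar>\<mu>\<bar>\<^sup>2\<^esup>\<close> arises only from the diagonal term of \<open>\<mu>\<close>.\<close>

lemma alt_independent:
  assumes fin: "finite B" and sub: "B \<subseteq> GTpos N"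
    and zero: "\<And>x. (\<And>i. i < N \<Longrightarrow> x i > 0) \<Longrightarrow> (\<Sum>l\<in>B. d l * alt N (expo N l) x) = 0"
    and l: "l \<in> B"
  shows "d l = (0 :: real)"
proof (rule ccontr)
  assume "d l \<noteq> 0"
  define S where "S = {l \<in> B. d l \<noteq> 0}"
  define nrm where "nrm = (\<lambda>l. \<Sum>j<N. expo N l j ^ 2)"
  have S: "finite S" "S \<noteq> {}" using fin l \<open>d l \<noteq> 0\<close> by (auto simp: S_def)
  have "Max (nrm ` S) \<in> nrm ` S" using S by (intro Max_in) auto
  then obtain m where mS: "m \<in> S" and mM: "Max (nrm ` S) = nrm m" by auto
  have m: "m \<in> S" "\<And>l. l \<in> S \<Longrightarrow> nrm l \<le> nrm m" using mS S unfolding mM[symmetric] by auto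
  define \<mu> where "\<mu> = expo N m"
  let ?ex = "\<lambda>l p. \<Sum>j<N. \<mu> (p j) * expo N l j"
  define Q where "Q = (\<Sum>l\<in>S. \<Sum>p | p permutes {..<N}. monom (d l * of_int (sign p)) (?ex l p))"
  have "poly Q q = 0" if q: "q > 0" for q
  proof -
    have "poly Q q = (\<Sum>l\<in>S. d l * alt N (expo N l) (\<lambda>i. q ^ \<mu> i))"
      unfolding Q_def alt_def ldet_def
      by (simp add: poly_sum poly_monom sum_distrib_left power_sum power_mult mult.assoc)
    also have "\<dots> = (\<Sum>l\<in>B. d l * alt N (expo N l) (\<lambda>i. q ^ \<mu> i))"
      by (rule sum.mono_neutral_left) (auto simp: S_def fin)
    also have "\<dots> = 0" by (rule zero) (use q in simp)
    finally show ?thesis .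
  qed
  then have "{0<..} \<subseteq> {q. poly Q q = 0}" by auto
  then have "infinite {q. poly Q q = 0}" by (rule infinite_super) (rule infinite_Ioi)
  then have "Q = 0" using poly_roots_finite by blast
  have diag: "l = m \<and> p = id" if lS: "l \<in> S" and p: "p permutes {..<N}" and e: "?ex l p = nrm m" for l p
  proof -
    have lG: "l \<in> GTpos N" "m \<in> GTpos N" using lS m sub by (auto simp: S_def)
    \<comment> \<open>Completing the square: when \<open>?ex l p\<close> equals
      \<open>nrm m\<close>, the sum of squares is \<open>nrm l\<close> minus \<open>nrm m\<close>,
      which maximality makes nonpositive.\<close>
    have "(\<Sum>j<N. (real (\<mu> (p j)) - real (expo N l j))\<^sup>2) = (\<Sum>j<N. real (\<mu> (p j))^2) + (\<Sum>j<N. real (expo N l j)^2) - 2 * real (?ex l p)"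
      by (simp add: power2_diff sum.distrib sum_subtractf sum_distrib_left mult.assoc)
    also have "(\<Sum>j<N. real (\<mu> (p j))^2) = real (nrm m)"
      using sum.permute[OF p, of "\<lambda>j. real (\<mu> j)^2"] by (simp add: comp_def nrm_def \<mu>_def)
    also have "(\<Sum>j<N. real (expo N l j)^2) = real (nrm l)" by (simp add: nrm_def)
    finally have "(\<Sum>j<N. (real (\<mu> (p j)) - real (expo N l j))\<^sup>2) = real (nrm l) - real (nrm m)" unfolding e by simp
    moreover have "real (nrm l) \<le> real (nrm m)" using m(2)[OF lS] by simp
    ultimately have "(\<Sum>j<N. (real (\<mu> (p j)) - real (expo N l j))\<^sup>2) \<le> 0" by simp
    moreover have "(\<Sum>j<N. (real (\<mu> (p j)) - real (expo N l j))\<^sup>2) \<ge> 0" by (intro sum_nonneg) simp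
    ultimately have "(\<Sum>j<N. (real (\<mu> (p j)) - real (expo N l j))\<^sup>2) = 0" by linarith
    then have ab: "\<mu> (p j) = expo N l j" if "j < N" for j
      using that by (subst (asm) sum_nonneg_eq_0_iff) auto
    have id: "p = id"
      by (rule strict_decreasing_perm_id[OF p, of \<mu> "expo N l"]) (use ab expo_less lG \<mu>_def in auto)
    then show ?thesis using ab expo_inj[OF lG] by (simp add: \<mu>_def)
  qed
  have "coeff Q (nrm m) = (\<Sum>l\<in>S. \<Sum>p | p permutes {..<N}. if ?ex l p = nrm m then d l * of_int (sign p) else 0)"
    unfolding Q_def by (simp add: coeff_sum)
  also have "\<dots> = (\<Sum>l\<in>S. \<Sum>p | p permutes {..<N}. if l = m \<and> p = id then d m else 0)"
  proof (intro sum.cong refl)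
    fix l p assume lp: "l \<in> S" "p \<in> {p. p permutes {..<N}}"
    have "?ex m id = nrm m" by (simp add: nrm_def \<mu>_def power2_eq_square)
    then show "(if ?ex l p = nrm m then d l * of_int (sign p) else 0) = (if l = m \<and> p = id then d m else 0)"
      using diag[OF lp(1)] lp(2) by auto
  qed
  also have "\<dots> = (\<Sum>l\<in>S. if l = m then d m else 0)"
    by (intro sum.cong refl) (auto simp: permutes_id finite_permutations)
  also have "\<dots> = d m" using m S by simp
  finally have "d m = 0" using \<open>Q = 0\<close> by simp
  then show False using m by (simp add: S_def)
qed

text \<open>Both candidates live on the same finite box. The difference of their expansions,
  multiplied by the Vandermonde determinant, is a vanishing combination of alternants.\<close>

lemma SGF_unique:
  assumes N: "N \<ge> 1" and \<rho>: "has_SGF N \<rho> (\<lambda>x. (\<Sum>i<N. x i) ^ n / real N ^ n)"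
    and \<rho>': "has_SGF N \<rho>' (\<lambda>x. (\<Sum>i<N. x i) ^ n / real N ^ n)"
  shows "\<rho> = \<rho>'"
proof -
  let ?B = "{l \<in> GTpos N. \<forall>i<N. l ! i \<le> int n}"
  have supp: "pmf \<sigma> l = 0" if "has_SGF N \<sigma> (\<lambda>x. (\<Sum>i<N. x i) ^ n / real N ^ n)" "l \<notin> ?B" for \<sigma> l
    using SGF_support[OF N that(1), of l] that(2) by (auto simp: set_pmf_iff)
  have val: "(\<Sum>l\<in>?B. pmf \<sigma> l / schur N l (\<lambda>_. 1) * schur N l x) = (\<Sum>i<N. x i) ^ n / real N ^ n"
    if s: "has_SGF N \<sigma> (\<lambda>x. (\<Sum>i<N. x i) ^ n / real N ^ n)" and x: "\<And>i. i < N \<Longrightarrow> x i > 0" for \<sigma> x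
  proof -
    have "((\<lambda>l. pmf \<sigma> l * schur N l x / schur N l (\<lambda>_. 1)) has_sum (\<Sum>i<N. x i) ^ n / real N ^ n) (GT N)"
      using s x by (auto simp: has_SGF_def)
    moreover have "((\<lambda>l. pmf \<sigma> l * schur N l x / schur N l (\<lambda>_. 1)) has_sum (\<Sum>l\<in>?B. pmf \<sigma> l * schur N l x / schur N l (\<lambda>_. 1))) (GT N)"
      by (rule has_sum_finite_neutralI[OF finite_GT_box]) (auto simp: GTpos_def supp[OF s])
    ultimately show ?thesis using has_sum_unique by (simp add: has_sum_unique)
  qed
  let ?d = "\<lambda>l. pmf \<rho> l / schur N l (\<lambda>_. 1) - pmf \<rho>' l / schur N l (\<lambda>_. 1)"
  have "pmf \<rho> l = pmf \<rho>' l" for l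
  proof (cases "l \<in> ?B")
    case True
    have "?d l = 0"
    proof (rule alt_independent[OF finite_GT_box _ _ True])
      fix x :: "nat \<Rightarrow> real" assume x: "\<And>i. i < N \<Longrightarrow> x i > 0"
      have "(\<Sum>l\<in>?B. ?d l * schur N l x) = 0"
        unfolding left_diff_distrib sum_subtractf using val[OF \<rho> x] val[OF \<rho>' x] by simp
      then have "(\<Sum>l\<in>?B. ?d l * schur N l x) * alt N (\<lambda>j. N - Suc j) x = 0" by simp
      then show "(\<Sum>l\<in>?B. ?d l * alt N (expo N l) x) = 0"
        unfolding sum_distrib_right by (simp add: mult.assoc schur_alt[OF _ N])
    qed auto
    moreover have "schur N l (\<lambda>_. 1) > 0" using True by (intro schur_one_pos N) auto
    ultimately show ?thesis by simp
  next
    case False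
    then show ?thesis using supp[OF \<rho>] supp[OF \<rho>'] by simp
  qed
  then show ?thesis by (rule pmf_eqI)
qed

text \<open>A definite description can be evaluated only when existence and uniqueness are both
  known.\<close>

lemma tensor_measure_chain: "N \<ge> 1 \<Longrightarrow> tensor_measure N n = chain N n"
  unfolding tensor_measure_def by (intro the_equality has_SGF_chain SGF_unique[OF _ _ has_SGF_chain])

section \<open>The limit theorem\<close>

text \<open>Along n = floor(c N^2) the time n / N^2 tends to c and stays in [0, T], so uniform
  convergence and continuity of the limit combine.\<close>

lemma conv_along_diagonal:
  assumes f: "unif_conv T f \<phi>" and c: "c > 0" "c < T"
  shows "(\<lambda>N. f N (nat \<lfloor>c * real N ^ 2\<rfloor>)) \<longlonglongrightarrow> \<phi> c"
proof -
  let ?n = "\<lambda>N. nat \<lfloor>c * real N ^ 2\<rfloor>"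
  let ?t = "\<lambda>N. real (?n N) / (real N)\<^sup>2"
  have n: "real (?n N) \<le> c * real N ^ 2" "c * real N ^ 2 - 1 \<le> real (?n N)" for N
    using c by (auto simp: of_nat_nat)
  have up: "upto_time T N (?n N)" for N
  proof -
    have "c * real N ^ 2 \<le> T * real N ^ 2" using c by (intro mult_right_mono) auto
    then show ?thesis using n(1)[of N] by (simp add: upto_time_def)
  qed
  have "?t \<longlonglongrightarrow> c"
  proof (rule tendsto_sandwich)
    have "(\<lambda>N. c - (1 / real N)\<^sup>2) \<longlonglongrightarrow> c - 0\<^sup>2" by (intro tendsto_intros lim_1_over_n)
    then show "(\<lambda>N. c - (1 / real N)\<^sup>2) \<longlonglongrightarrow> c" by simp
    show "\<forall>\<^sub>F N in sequentially. c - (1 / real N)\<^sup>2 \<le> ?t N"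
      using eventually_ge_at_top[of 1]
    proof eventually_elim
      case (elim N)
      have "(c * real N ^ 2 - 1) / (real N)\<^sup>2 \<le> ?t N" using n(2)[of N] by (intro divide_right_mono) auto
      then show ?case using elim by (simp add: diff_divide_distrib power_divide)
    qed
    show "\<forall>\<^sub>F N in sequentially. ?t N \<le> c"
      using eventually_ge_at_top[of 1]
    proof eventually_elim
      case (elim N)
      then show ?case using n(1)[of N] by (simp add: divide_le_eq)
    qed
  qed simp
  moreover have "continuous_on {0..T} \<phi>" using f by (simp add: unif_conv_def)
  moreover have "\<forall>\<^sub>F N in sequentially. ?t N \<in> {0..T}"
    using eventually_ge_at_top[of 1] by eventually_elim (rule macro_time[OF up])
  ultimately have "(\<lambda>N. \<phi> (?t N)) \<longlonglongrightarrow> \<phi> c"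
    using c by (intro continuous_on_tendsto_compose[of "{0..T}" \<phi>]) auto
  moreover have "(\<lambda>N. f N (?n N) - \<phi> (?t N)) \<longlonglongrightarrow> 0"
  proof (rule tendstoI)
    fix e :: real assume e: "e > 0"
    have "\<forall>\<^sub>F N in sequentially. \<forall>n. upto_time T N n \<longrightarrow> \<bar>f N n - \<phi> (real n / (real N)\<^sup>2)\<bar> \<le> e / 2"
      using f half_gt_zero[OF e] unfolding unif_conv_def by blast
    then show "\<forall>\<^sub>F N in sequentially. dist (f N (?n N) - \<phi> (?t N)) 0 < e"
    proof eventually_elim
      case (elim N)
      then have "\<bar>f N (?n N) - \<phi> (?t N)\<bar> \<le> e / 2" using up by blast
      then show ?case using e by (simp add: dist_real_def)
    qed
  qed
  ultimately show ?thesis using tendsto_add[of "\<lambda>N. f N (?n N) - \<phi> (?t N)" 0 sequentially "\<lambda>N. \<phi> (?t N)" "\<phi> c"] by simp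
qed

lemma centered_moment_EE:
  assumes "N \<ge> 1"
  shows "centered_moment c N ks = EE N (nat \<lfloor>c * real N ^ 2\<rfloor>) (fluct_prod N (nat \<lfloor>c * real N ^ 2\<rfloor>) ks)"
proof -
  have "measure_pmf.expectation (chain N n) F = EE N n F" for n F
    using chain_properties[OF assms] by blast
  then show ?thesis
    by (simp add: centered_moment_def tensor_measure_chain[OF assms] fluct_def)
qed

lemma fluctuation_limit_lim: "T > 0 \<Longrightarrow> fluctuation_limit T lim_x lim_rho lim_cov"
proof (unfold_locales, goal_cases)
  case (3 m t) show ?case by (rule lim_rho_Newton)
next
  case (4 k t) show ?case by (rule lim_x_deriv)
next
  case (5 k) show ?case by (rule lim_x_init)
next
  case (6 k l t) then show ?case by (intro lim_cov_deriv)
next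
  case (7 k l) then show ?case by (intro lim_cov_init)
qed (simp_all add: lim_rho_def)

theorem mainTheorem5:
  fixes c :: real
  assumes "c > 0"
  shows "\<exists>\<epsilon>0>0. \<forall>\<epsilon>. 0 < \<epsilon> \<and> \<epsilon> < \<epsilon>0 \<longrightarrow>
           (\<forall>ks. (\<forall>k\<in>set ks. k \<ge> 1) \<longrightarrow>
              (\<lambda>N. complex_of_real (centered_moment c N ks))
                \<longlonglongrightarrow> wick (limit_cov c \<epsilon>) ks)"
proof (intro exI[of _ 1] conjI allI impI)
  fix \<epsilon> :: real and ks :: "nat list"
  assume \<epsilon>: "0 < \<epsilon> \<and> \<epsilon> < 1" and ks: "\<forall>k\<in>set ks. k \<ge> 1"
  let ?n = "\<lambda>N. nat \<lfloor>c * real N ^ 2\<rfloor>"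
  \<comment> \<open>The horizon c + 1 puts the time c strictly inside the interval.\<close>
  have "unif_conv (c + 1) (\<lambda>N n. EE N n (fluct_prod N n ks)) (\<lambda>t. wickr (\<lambda>k l. lim_cov k l t) ks)"
    using fluctuation_limit.moments_converge[OF fluctuation_limit_lim] assms ks by simp
  then have "(\<lambda>N. EE N (?n N) (fluct_prod N (?n N) ks)) \<longlonglongrightarrow> wickr (\<lambda>k l. lim_cov k l c) ks"
    using assms by (intro conv_along_diagonal[where f = "\<lambda>N n. EE N n (fluct_prod N n ks)"]) auto
  moreover have "\<forall>\<^sub>F N in sequentially. EE N (?n N) (fluct_prod N (?n N) ks) = centered_moment c N ks"
    using eventually_ge_at_top[of 1] by eventually_elim (simp add: centered_moment_EE)
  ultimately have "(\<lambda>N. centered_moment c N ks) \<longlonglongrightarrow> wickr (\<lambda>k l. lim_cov k l c) ks"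
    by (rule Lim_transform_eventually)
  moreover have "limit_cov c \<epsilon> = (\<lambda>k l. complex_of_real (lim_cov k l c))"
    using limit_cov_eq \<epsilon> by (intro ext) simp
  ultimately show "(\<lambda>N. complex_of_real (centered_moment c N ks)) \<longlonglongrightarrow> wick (limit_cov c \<epsilon>) ks"
    by (simp add: wick_of_real tendsto_of_real)
qed simp

end
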